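(* The $\mathbb{Q}$-linear map $\mathcal{H}_{\mathrm{Des}} \to \mathrm{QSym}$ defined by $[\pi]_{\mathrm{Des}} \mapsto F_{\mathrm{Comp}(\pi)}$ is an isomorphism of Hopf algebras.
   Context: A permutation is a finite (possibly empty) sequence $\pi = \pi_1 \cdots \pi_n$ of distinct positive integers, called its letters; $|\pi| = n$ is its length. $\mathrm{Des}(\pi) = \{1 \le i \le n-1 : \pi_i > \pi_{i+1}\}$ is the descent set. Write $\pi \sim_{\mathrm{Des}} \sigma$ if $|\pi| = |\sigma|$ and $\mathrm{Des}(\pi) = \mathrm{Des}(\sigma)$; $[\pi]_{\mathrm{Des}}$ is the equivalence class of $\pi$. For permutations with no letters in common, the shuffle set $\pi ⧢ \sigma$ is the set of all $\binom{|\pi|+|\sigma|}{|\pi|}$ permutations of length $|\pi|+|\sigma|$ containing both $\pi$ and $\sigma$ as subsequences. It is known that $\mathrm{Des}$ is shuffle-compatible (for disjoint $\pi,\sigma$ the multiset $\{\mathrm{Des}(\tau):\tau\in\pi⧢\sigma\}$ depends only on the descent sets and lengths of $\pi$ and $\sigma$) and substring-compatible (the descent set and length of $\pi$ determine the descent set of every substring $\pi_i\cdots\pi_j$). $\mathcal{H}_{\mathrm{Des}}$ is the graded connected Hopf algebra over $\mathbb{Q}$ with basis the classes $[\pi]_{\mathrm{Des}}$, graded by length, product $[\pi]_{\mathrm{Des}} \cdot [\sigma]_{\mathrm{Des}} = \sum_{\tau \in \pi ⧢ \sigma} [\tau]_{\mathrm{Des}}$ for disjoint representatives $\pi,\sigma$,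 unit the class of the empty permutation, coproduct $\Delta([\pi]_{\mathrm{Des}}) = \sum_{i=0}^{n} [\pi_1 \cdots \pi_i]_{\mathrm{Des}} \otimes [\pi_{i+1} \cdots \pi_n]_{\mathrm{Des}}$, and counit sending the class of the empty permutation to $1$ and all other classes to $0$ (the antipode exists uniquely because the bialgebra is graded and connected). If $\mathrm{Des}(\pi) = \{d_1 < \cdots < d_k\}$ with $|\pi|=n\ge1$, then $\mathrm{Comp}(\pi) = (d_1, d_2 - d_1, \dots, d_k - d_{k-1}, n - d_k)$ (equal to $(n)$ if there are no descents); $\mathrm{Comp}$ of the empty permutation is the empty composition. $\mathrm{QSym}$ is the Hopf algebra of quasisymmetric functions over $\mathbb{Q}$ with its usual structure, and $\{F_\alpha\}$, indexed by integer compositions, is its fundamental basis: for $\alpha = (\alpha_1,\dots,\alpha_\ell)$ a composition of $n$, $F_\alpha = \sum x_{i_1} \cdots x_{i_n}$ over all $i_1 \le \cdots \le i_n$ with $i_j < i_{j+1}$ whenever $j \in \{\alpha_1, \alpha_1+\alpha_2, \dots, \alpha_1+\cdots+\alpha_{\ell-1}\}$; $F_\varnothing = 1$. *)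

theory Defs
  imports Complex_Main "HOL-Library.Poly_Mapping" "HOL-Library.Sublist"
begin

section \<open>Rational vector spaces\<close>

class rat_vector = ab_group_add +
  fixes scaleQ :: "rat \<Rightarrow> 'a \<Rightarrow> 'a" (infixr \<open>*\<^sub>Q\<close> 75)
  assumes scaleQ_add_right: "a *\<^sub>Q (x + y) = a *\<^sub>Q x + a *\<^sub>Q y"
    and scaleQ_add_left: "(a + b) *\<^sub>Q x = a *\<^sub>Q x + b *\<^sub>Q x"
    and scaleQ_scaleQ: "a *\<^sub>Q b *\<^sub>Q x = (a * b) *\<^sub>Q x"
    and scaleQ_one: "1 *\<^sub>Q x = x"

global_interpretation rat_vector: vector_space "scaleQ :: rat \<Rightarrow> 'a \<Rightarrow> 'a::rat_vector"
  by unfold_locales (fact scaleQ_add_right scaleQ_add_left scaleQ_scaleQ scaleQ_one)+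

abbreviation qlinear :: "('a::rat_vector \<Rightarrow> 'b::rat_vector) \<Rightarrow> bool"
  where "qlinear \<equiv> Vector_Spaces.linear scaleQ scaleQ"

definition qbilinear :: "('a::rat_vector \<Rightarrow> 'b::rat_vector \<Rightarrow> 'c::rat_vector) \<Rightarrow> bool"
  where "qbilinear b \<longleftrightarrow> (\<forall>x. qlinear (b x)) \<and> (\<forall>y. qlinear (\<lambda>x. b x y))"

lemma qlinear_iff:
  "qlinear f \<longleftrightarrow> (\<forall>x y. f (x + y) = f x + f y) \<and> (\<forall>c x. f (c *\<^sub>Q x) = c *\<^sub>Q f x)"
  by (auto simp: Vector_Spaces.linear_def module_hom_def module_hom_axioms_def
        rat_vector.vector_space_axioms rat_vector.module_axioms)

instantiation rat :: rat_vector
begin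
definition scaleQ_rat :: "rat \<Rightarrow> rat \<Rightarrow> rat" where "scaleQ_rat = (*)"
instance by standard (simp_all add: scaleQ_rat_def algebra_simps)
end

instantiation poly_mapping :: (type, rat_vector) rat_vector
begin
lift_definition scaleQ_poly_mapping :: "rat \<Rightarrow> ('a \<Rightarrow>\<^sub>0 'b) \<Rightarrow> 'a \<Rightarrow>\<^sub>0 'b"
  is "\<lambda>c f k. c *\<^sub>Q f k"
  by (erule rev_finite_subset) auto
instance
  by standard
    (transfer; simp add: fun_eq_iff scaleQ_add_right scaleQ_add_left scaleQ_scaleQ scaleQ_one)+
end

text \<open>The type \<open>'a \<Rightarrow>\<^sub>0 rat\<close> is the free vector space with basis \<open>Poly_Mapping.single k 1\<close>.\<close>

definition linear_extension :: "('k \<Rightarrow> 'a::rat_vector) \<Rightarrow> ('k \<Rightarrow>\<^sub>0 rat) \<Rightarrow> 'a"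
  where "linear_extension b v = (\<Sum>k\<in>Poly_Mapping.keys v. Poly_Mapping.lookup v k *\<^sub>Q b k)"

lemma lookup_scaleQ: "Poly_Mapping.lookup (c *\<^sub>Q v) k = c *\<^sub>Q Poly_Mapping.lookup v k"
  by transfer simp

lemma linear_extension_superset:
  assumes "finite K" "Poly_Mapping.keys v \<subseteq> K"
  shows "linear_extension b v = (\<Sum>k\<in>K. Poly_Mapping.lookup v k *\<^sub>Q b k)"
  unfolding linear_extension_def using assms
  by (intro sum.mono_neutral_left) (auto simp: in_keys_iff)

lemma qlinear_linear_extension: "qlinear (linear_extension b)"
  unfolding qlinear_iff
proof (intro conjI allI)
  fix v w :: "'a \<Rightarrow>\<^sub>0 rat" and c
  let ?K = "Poly_Mapping.keys v \<union> Poly_Mapping.keys w"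
  have "Poly_Mapping.keys (v + w) \<subseteq> ?K" by (rule keys_add)
  then have "linear_extension b (v + w) = (\<Sum>k\<in>?K. Poly_Mapping.lookup (v + w) k *\<^sub>Q b k)"
    by (intro linear_extension_superset) auto
  also have "\<dots> = linear_extension b v + linear_extension b w"
    by (simp add: linear_extension_superset[of ?K] lookup_add rat_vector.scale_left_distrib
        sum.distrib)
  finally show "linear_extension b (v + w) = linear_extension b v + linear_extension b w" .
  have "Poly_Mapping.keys (c *\<^sub>Q v) \<subseteq> Poly_Mapping.keys v"
    by (auto simp: in_keys_iff lookup_scaleQ)
  then have "linear_extension b (c *\<^sub>Q v)
      = (\<Sum>k\<in>Poly_Mapping.keys v. Poly_Mapping.lookup (c *\<^sub>Q v) k *\<^sub>Q b k)"
    by (intro linear_extension_superset) auto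
  then show "linear_extension b (c *\<^sub>Q v) = c *\<^sub>Q linear_extension b v"
    by (simp add: linear_extension_def lookup_scaleQ scaleQ_rat_def rat_vector.scale_sum_right)
qed

lemma qlinear_eq_linear_extension:
  assumes "qlinear f"
  shows "f v = linear_extension (\<lambda>k. f (Poly_Mapping.single k 1)) v"
proof -
  interpret f: Vector_Spaces.linear scaleQ scaleQ f by (fact assms)
  have "v = (\<Sum>k\<in>Poly_Mapping.keys v. Poly_Mapping.lookup v k *\<^sub>Q Poly_Mapping.single k 1)"
    by (rule poly_mapping_eqI)
      (auto simp: lookup_sum lookup_scaleQ lookup_single scaleQ_rat_def when_def in_keys_iff
        if_distrib[of "\<lambda>x. _ * x"] cong: if_cong)
  then have "f v
      = f (\<Sum>k\<in>Poly_Mapping.keys v. Poly_Mapping.lookup v k *\<^sub>Q Poly_Mapping.single k 1)"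
    by (rule arg_cong)
  then show ?thesis
    by (simp add: linear_extension_def f.sum f.scale)
qed

lemma linear_extension_single [simp]: "linear_extension b (Poly_Mapping.single k 1) = b k"
  by (simp add: linear_extension_def)

section \<open>Tensor products\<close>

definition tensor_relators :: "(('a::rat_vector \<times> 'b::rat_vector) \<Rightarrow>\<^sub>0 rat) set" where
  "tensor_relators =
     {Poly_Mapping.single (x + x', y) 1 - Poly_Mapping.single (x, y) 1
        - Poly_Mapping.single (x', y) 1 | x x' y. True}
   \<union> {Poly_Mapping.single (x, y + y') 1 - Poly_Mapping.single (x, y) 1
        - Poly_Mapping.single (x, y') 1 | x y y'. True}
   \<union> {Poly_Mapping.single (c *\<^sub>Q x, y) 1 - c *\<^sub>Q Poly_Mapping.single (x, y) 1 | c x y. True}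
   \<union> {Poly_Mapping.single (x, c *\<^sub>Q y) 1 - c *\<^sub>Q Poly_Mapping.single (x, y) 1 | c x y. True}"

definition tensor_equiv ::
    "(('a::rat_vector \<times> 'b::rat_vector) \<Rightarrow>\<^sub>0 rat) \<Rightarrow> (('a \<times> 'b) \<Rightarrow>\<^sub>0 rat) \<Rightarrow> bool"
  where "tensor_equiv s t \<longleftrightarrow> s - t \<in> rat_vector.span tensor_relators"

quotient_type (overloaded) ('a, 'b) tensor =
    "('a::rat_vector \<times> 'b::rat_vector) \<Rightarrow>\<^sub>0 rat" / tensor_equiv
proof (intro equivpI reflpI sympI transpI)
  show "tensor_equiv s s" for s :: "('a \<times> 'b) \<Rightarrow>\<^sub>0 rat"
    by (simp add: tensor_equiv_def rat_vector.span_zero)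
  show "tensor_equiv s t \<Longrightarrow> tensor_equiv t s" for s t :: "('a \<times> 'b) \<Rightarrow>\<^sub>0 rat"
    unfolding tensor_equiv_def by (drule rat_vector.span_neg) simp
  show "tensor_equiv s t \<Longrightarrow> tensor_equiv t u \<Longrightarrow> tensor_equiv s u"
    for s t u :: "('a \<times> 'b) \<Rightarrow>\<^sub>0 rat"
    unfolding tensor_equiv_def by (drule (1) rat_vector.span_add) simp
qed

instantiation tensor :: (rat_vector, rat_vector) rat_vector
begin

lift_definition zero_tensor :: "('a, 'b) tensor" is 0 .

lift_definition plus_tensor :: "('a, 'b) tensor \<Rightarrow> ('a, 'b) tensor \<Rightarrow> ('a, 'b) tensor" is "(+)"
  unfolding tensor_equiv_def by (drule (1) rat_vector.span_add) (simp add: algebra_simps)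

lift_definition uminus_tensor :: "('a, 'b) tensor \<Rightarrow> ('a, 'b) tensor" is uminus
  unfolding tensor_equiv_def by (drule rat_vector.span_neg) simp

lift_definition minus_tensor :: "('a, 'b) tensor \<Rightarrow> ('a, 'b) tensor \<Rightarrow> ('a, 'b) tensor" is "(-)"
  unfolding tensor_equiv_def by (drule (1) rat_vector.span_diff) (simp add: algebra_simps)

lift_definition scaleQ_tensor :: "rat \<Rightarrow> ('a, 'b) tensor \<Rightarrow> ('a, 'b) tensor" is scaleQ
  unfolding tensor_equiv_def
  by (simp flip: rat_vector.scale_right_diff_distrib add: rat_vector.span_scale)

instance
  by standard
    (transfer; simp add: tensor_equiv_def rat_vector.span_zero algebra_simps
      scaleQ_add_right scaleQ_add_left scaleQ_scaleQ scaleQ_one)+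

end

lift_definition pure_tensor :: "'a::rat_vector \<Rightarrow> 'b::rat_vector \<Rightarrow> ('a, 'b) tensor"
    (infixl \<open>\<otimes>\<close> 70)
  is "\<lambda>x y. Poly_Mapping.single (x, y) 1" .

definition tensor_lift ::
    "('a::rat_vector \<Rightarrow> 'b::rat_vector \<Rightarrow> 'c::rat_vector) \<Rightarrow> ('a, 'b) tensor \<Rightarrow> 'c"
  where "tensor_lift b = (THE g. qlinear g \<and> (\<forall>x y. g (x \<otimes> y) = b x y))"

text \<open>The universal property, which makes the description above a proper definition.\<close>

lemma tensor_ex1:
  assumes "qbilinear b"
  shows "\<exists>!g. qlinear g \<and> (\<forall>x y. g (x \<otimes> y) = b x y)"
proof
  define L where "L = linear_extension (\<lambda>(x, y). b x y)"
  have L: "qlinear L" unfolding L_def by (rule qlinear_linear_extension)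
  interpret L: Vector_Spaces.linear scaleQ scaleQ L by (fact L)
  have Ls: "L (Poly_Mapping.single (x, y) 1) = b x y" for x y
    by (simp add: L_def)
  have b: "b (x + x') y = b x y + b x' y" "b x (y + y') = b x y + b x y'"
    "b (c *\<^sub>Q x) y = c *\<^sub>Q b x y" "b x (c *\<^sub>Q y) = c *\<^sub>Q b x y" for x x' y y' c
    using assms unfolding qbilinear_def qlinear_iff by auto
  have ker: "L s = 0" if "s \<in> rat_vector.span tensor_relators" for s
    using that
  proof (induction rule: rat_vector.span_induct)
    case base
    show ?case by (auto simp: rat_vector.subspace_def L.add L.scale)
  next
    case (step s)
    then show ?case
      by (auto simp: tensor_relators_def L.diff L.scale Ls b)
  qed
  have resp: "tensor_equiv s t \<Longrightarrow> L s = L t" for s t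
    using ker[of "s - t"] by (simp add: tensor_equiv_def L.diff)
  define g where "g t = L (rep_tensor t)" for t
  have g_abs: "g (abs_tensor s) = L s" for s
    unfolding g_def
    by (rule resp) (rule Quotient3_rep_abs[OF Quotient3_tensor],
        simp add: tensor_equiv_def rat_vector.span_zero)
  show "qlinear g \<and> (\<forall>x y. g (x \<otimes> y) = b x y)"
  proof (intro conjI allI)
    show "qlinear g" unfolding qlinear_iff
    proof (intro conjI allI)
      fix s t :: "('a, 'b) tensor" and c
      obtain s' t' where st: "s = abs_tensor s'" "t = abs_tensor t'"
        by (metis Quotient3_abs_rep[OF Quotient3_tensor])
      show "g (s + t) = g s + g t" by (simp add: st plus_tensor.abs_eq g_abs L.add)
      show "g (c *\<^sub>Q s) = c *\<^sub>Q g s" by (simp add: st scaleQ_tensor.abs_eq g_abs L.scale)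
    qed
    show "g (x \<otimes> y) = b x y" for x y by (simp add: pure_tensor.abs_eq g_abs Ls)
  qed
  fix h assume h: "qlinear h \<and> (\<forall>x y. h (x \<otimes> y) = b x y)"
  interpret h: Vector_Spaces.linear scaleQ scaleQ h using h by blast
  have "qlinear (\<lambda>s. h (abs_tensor s))"
    unfolding qlinear_iff
    by (simp add: h.add h.scale flip: plus_tensor.abs_eq scaleQ_tensor.abs_eq)
  then have "h (abs_tensor s) = L s" for s
    using h by (subst qlinear_eq_linear_extension[of "\<lambda>s. h (abs_tensor s)"])
      (auto simp: L_def linear_extension_def simp flip: pure_tensor.abs_eq intro!: sum.cong)
  then show "h = g"
    by (metis (no_types) ext g_abs Quotient3_abs_rep[OF Quotient3_tensor])
qed

definition tensor_map ::
    "('a::rat_vector \<Rightarrow> 'c::rat_vector) \<Rightarrow> ('b::rat_vector \<Rightarrow> 'd::rat_vector)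
      \<Rightarrow> ('a, 'b) tensor \<Rightarrow> ('c, 'd) tensor"
  where "tensor_map f g = tensor_lift (\<lambda>x y. f x \<otimes> g y)"

definition tensor_assoc ::
    "(('a::rat_vector, 'b::rat_vector) tensor, 'c::rat_vector) tensor
      \<Rightarrow> ('a, ('b, 'c) tensor) tensor"
  where "tensor_assoc = tensor_lift (\<lambda>t z. tensor_lift (\<lambda>x y. x \<otimes> (y \<otimes> z)) t)"

section \<open>Hopf algebras over the rationals\<close>

record (overloaded) ('a::rat_vector) bialgebra_ops =
  mult :: "'a \<Rightarrow> 'a \<Rightarrow> 'a"
  unit :: 'a
  comult :: "'a \<Rightarrow> ('a, 'a) tensor"
  counit :: "'a \<Rightarrow> rat"

definition tensor_mult ::
    "'a::rat_vector bialgebra_ops \<Rightarrow> ('a, 'a) tensor \<Rightarrow> ('a, 'a) tensor \<Rightarrow> ('a, 'a) tensor"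
  where "tensor_mult A s t =
    tensor_lift (\<lambda>a b. tensor_lift (\<lambda>c d. mult A a c \<otimes> mult A b d) t) s"

locale bialgebra =
  fixes A :: "'a::rat_vector bialgebra_ops"
  assumes mult_bilinear: "qbilinear (mult A)"
    and mult_assoc: "mult A (mult A x y) z = mult A x (mult A y z)"
    and unit_left: "mult A (unit A) x = x"
    and unit_right: "mult A x (unit A) = x"
    and comult_linear: "qlinear (comult A)"
    and counit_linear: "qlinear (counit A)"
    and coassoc: "tensor_assoc (tensor_map (comult A) id (comult A x))
                  = tensor_map id (comult A) (comult A x)"
    and counit_left: "tensor_lift (\<lambda>a b. counit A a *\<^sub>Q b) (comult A x) = x"
    and counit_right: "tensor_lift (\<lambda>a b. counit A b *\<^sub>Q a) (comult A x) = x"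
    and comult_mult: "comult A (mult A x y) = tensor_mult A (comult A x) (comult A y)"
    and comult_unit: "comult A (unit A) = unit A \<otimes> unit A"
    and counit_mult: "counit A (mult A x y) = counit A x * counit A y"
    and counit_unit: "counit A (unit A) = 1"

definition is_antipode :: "'a::rat_vector bialgebra_ops \<Rightarrow> ('a \<Rightarrow> 'a) \<Rightarrow> bool"
  where "is_antipode A S \<longleftrightarrow> qlinear S
    \<and> (\<forall>x. tensor_lift (\<lambda>a b. mult A (S a) b) (comult A x) = counit A x *\<^sub>Q unit A)
    \<and> (\<forall>x. tensor_lift (\<lambda>a b. mult A a (S b)) (comult A x) = counit A x *\<^sub>Q unit A)"

locale hopf_algebra = bialgebra +
  assumes ex_antipode: "\<exists>S. is_antipode A S"

text \<open>In a bialgebra there is at most one antipode.\<close>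

definition antipode :: "'a::rat_vector bialgebra_ops \<Rightarrow> 'a \<Rightarrow> 'a"
  where "antipode A = (THE S. is_antipode A S)"

locale hopf_algebra_hom = A: hopf_algebra A + B: hopf_algebra B
  for A :: "'a::rat_vector bialgebra_ops" and B :: "'b::rat_vector bialgebra_ops" +
  fixes \<phi> :: "'a \<Rightarrow> 'b"
  assumes hom_linear: "qlinear \<phi>"
    and hom_mult: "\<phi> (mult A x y) = mult B (\<phi> x) (\<phi> y)"
    and hom_unit: "\<phi> (unit A) = unit B"
    and hom_comult: "comult B (\<phi> x) = tensor_map \<phi> \<phi> (comult A x)"
    and hom_counit: "counit B (\<phi> x) = counit A x"
    and hom_antipode: "\<phi> (antipode A x) = antipode B (\<phi> x)"

locale hopf_algebra_iso = hopf_algebra_hom +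
  assumes hom_bij: "bij \<phi>"

section \<open>Permutations and the Hopf algebra of descent classes\<close>

typedef permutation = "{xs :: nat list. distinct xs \<and> 0 \<notin> set xs}" morphisms letters Perm
  by (rule exI[of _ "[]"]) simp

setup_lifting type_definition_permutation

lift_definition len :: "permutation \<Rightarrow> nat" is length .

lift_definition empty_perm :: permutation is "[]" by simp

lift_definition prefix_perm :: "nat \<Rightarrow> permutation \<Rightarrow> permutation" is take
  by (auto dest: in_set_takeD)

lift_definition suffix_perm :: "nat \<Rightarrow> permutation \<Rightarrow> permutation" is drop
  by (auto dest: in_set_dropD)

text \<open>Positions are counted from 1, list indices from 0.\<close>

definition Des :: "permutation \<Rightarrow> nat set"
  where "Des \<pi> = {i. 1 \<le> i \<and> i < len \<pi> \<and> letters \<pi> ! (i - 1) > letters \<pi> ! i}"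

definition disjoint_perms :: "permutation \<Rightarrow> permutation \<Rightarrow> bool"
  where "disjoint_perms \<pi> \<sigma> \<longleftrightarrow> set (letters \<pi>) \<inter> set (letters \<sigma>) = {}"

definition shuffle_set :: "permutation \<Rightarrow> permutation \<Rightarrow> permutation set"
  where "shuffle_set \<pi> \<sigma> = {\<tau>. len \<tau> = len \<pi> + len \<sigma>
    \<and> subseq (letters \<pi>) (letters \<tau>) \<and> subseq (letters \<sigma>) (letters \<tau>)}"

definition Des_equiv :: "permutation \<Rightarrow> permutation \<Rightarrow> bool"
  where "Des_equiv \<pi> \<sigma> \<longleftrightarrow> len \<pi> = len \<sigma> \<and> Des \<pi> = Des \<sigma>"

quotient_type des_class = permutation / Des_equiv
  by (auto intro!: equivpI reflpI sympI transpI simp: Des_equiv_def)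

definition Des_basis :: "permutation \<Rightarrow> des_class \<Rightarrow>\<^sub>0 rat" (\<open>[_]\<^sub>D\<^sub>e\<^sub>s\<close>)
  where "[\<pi>]\<^sub>D\<^sub>e\<^sub>s = Poly_Mapping.single (abs_des_class \<pi>) 1"

text \<open>The description is proper because \<^const>\<open>Des\<close> is shuffle-compatible and any two classes
  have disjoint representatives.\<close>

definition des_class_mult :: "des_class \<Rightarrow> des_class \<Rightarrow> des_class \<Rightarrow>\<^sub>0 rat"
  where "des_class_mult c d = (THE v. \<forall>\<pi> \<sigma>. abs_des_class \<pi> = c \<longrightarrow> abs_des_class \<sigma> = d
    \<longrightarrow> disjoint_perms \<pi> \<sigma> \<longrightarrow> v = (\<Sum>\<tau>\<in>shuffle_set \<pi> \<sigma>. [\<tau>]\<^sub>D\<^sub>e\<^sub>s))"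

lemma letters_prefix_perm: "letters (prefix_perm i \<pi>) = take i (letters \<pi>)"
  by transfer simp

lemma letters_suffix_perm: "letters (suffix_perm i \<pi>) = drop i (letters \<pi>)"
  by transfer simp

lemma len_eq: "len \<pi> = length (letters \<pi>)"
  by transfer simp

lemma Des_prefix_perm: "i \<le> len \<pi> \<Longrightarrow> Des (prefix_perm i \<pi>) = {j \<in> Des \<pi>. j < i}"
  by (auto simp: Des_def letters_prefix_perm len_eq)

lemma Des_suffix_perm:
  "i \<le> len \<pi> \<Longrightarrow> Des (suffix_perm i \<pi>) = {j. 1 \<le> j \<and> i + j \<in> Des \<pi>}"
  by (auto simp: Des_def letters_suffix_perm len_eq)

lift_definition des_class_comult ::
    "des_class \<Rightarrow> (des_class \<Rightarrow>\<^sub>0 rat, des_class \<Rightarrow>\<^sub>0 rat) tensor"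
  is "\<lambda>\<pi>. \<Sum>i\<le>len \<pi>. [prefix_perm i \<pi>]\<^sub>D\<^sub>e\<^sub>s \<otimes> [suffix_perm i \<pi>]\<^sub>D\<^sub>e\<^sub>s"
proof -
  fix \<pi> \<sigma> assume eq: "Des_equiv \<pi> \<sigma>"
  have "Des_equiv (prefix_perm i \<pi>) (prefix_perm i \<sigma>)"
    "Des_equiv (suffix_perm i \<pi>) (suffix_perm i \<sigma>)" if "i \<le> len \<pi>" for i
    using eq that Des_prefix_perm[of i \<pi>] Des_prefix_perm[of i \<sigma>]
      Des_suffix_perm[of i \<pi>] Des_suffix_perm[of i \<sigma>]
    by (simp_all add: Des_equiv_def len_eq letters_prefix_perm letters_suffix_perm)
  then have "[prefix_perm i \<pi>]\<^sub>D\<^sub>e\<^sub>s = [prefix_perm i \<sigma>]\<^sub>D\<^sub>e\<^sub>s"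
    "[suffix_perm i \<pi>]\<^sub>D\<^sub>e\<^sub>s = [suffix_perm i \<sigma>]\<^sub>D\<^sub>e\<^sub>s" if "i \<le> len \<pi>" for i
    using that by (metis Des_basis_def des_class.abs_eq_iff)+
  then show "(\<Sum>i\<le>len \<pi>. [prefix_perm i \<pi>]\<^sub>D\<^sub>e\<^sub>s \<otimes> [suffix_perm i \<pi>]\<^sub>D\<^sub>e\<^sub>s)
      = (\<Sum>i\<le>len \<sigma>. [prefix_perm i \<sigma>]\<^sub>D\<^sub>e\<^sub>s \<otimes> [suffix_perm i \<sigma>]\<^sub>D\<^sub>e\<^sub>s)"
    using eq by (intro sum.cong) (simp_all add: Des_equiv_def)
qed

definition H_Des :: "(des_class \<Rightarrow>\<^sub>0 rat) bialgebra_ops"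
  where "H_Des =
    \<lparr> mult = (\<lambda>v w. linear_extension (\<lambda>c. linear_extension (\<lambda>d. des_class_mult c d) w) v),
      unit = [empty_perm]\<^sub>D\<^sub>e\<^sub>s,
      comult = linear_extension des_class_comult,
      counit = linear_extension (\<lambda>c. if c = abs_des_class empty_perm then 1 else 0) \<rparr>"

section \<open>Compositions\<close>

typedef composition = "{\<alpha> :: nat list. \<forall>a\<in>set \<alpha>. 0 < a}" morphisms parts Composition
  by (rule exI[of _ "[]"]) simp

setup_lifting type_definition_composition

lift_definition comp_append :: "composition \<Rightarrow> composition \<Rightarrow> composition" is "(@)"
  by auto

definition Comp_parts :: "permutation \<Rightarrow> nat list"
  where "Comp_parts \<pi> = (if len \<pi> = 0 then []
    else let ds = sorted_list_of_set (Des \<pi>) @ [len \<pi>] in map2 (-) ds (0 # ds))"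

lemma positive_differences:
  "sorted_wrt (<) (d # ds) \<Longrightarrow> a \<in> set (map2 (-) ds (d # ds)) \<Longrightarrow> 0 < (a::nat)"
  by (induction ds arbitrary: d) auto

lift_definition Comp :: "permutation \<Rightarrow> composition" is Comp_parts
proof -
  fix \<pi> a assume a: "a \<in> set (Comp_parts \<pi>)"
  have "Des \<pi> \<subseteq> {1..<len \<pi>}" by (auto simp: Des_def)
  moreover from this have "finite (Des \<pi>)" by (rule finite_subset) simp
  ultimately have "len \<pi> \<noteq> 0 \<Longrightarrow> sorted_wrt (<) (0 # sorted_list_of_set (Des \<pi>) @ [len \<pi>])"
    by (auto simp: sorted_wrt_append)
  moreover have "len \<pi> \<noteq> 0"
    "a \<in> set (map2 (-) (sorted_list_of_set (Des \<pi>) @ [len \<pi>])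
      (0 # sorted_list_of_set (Des \<pi>) @ [len \<pi>]))"
    using a by (simp_all add: Comp_parts_def Let_def del: set_map split: if_splits)
  ultimately show "0 < a" by (blast intro: positive_differences)
qed

section \<open>Quasisymmetric functions\<close>

text \<open>A monomial in the variables \<open>x\<^sub>1, x\<^sub>2, \<dots>\<close> is its exponent vector, of type
  \<open>nat \<Rightarrow>\<^sub>0 nat\<close>; index \<open>i\<close> stands for the variable \<open>x\<^bsub>i+1\<^esub>\<close>. A formal power series is the
  function giving the coefficient of each monomial.\<close>

type_synonym monomial = "nat \<Rightarrow>\<^sub>0 nat"

definition power_monomial :: "nat list \<Rightarrow> nat list \<Rightarrow> monomial"
  where "power_monomial is as = (\<Sum>(i, a)\<leftarrow>zip is as. Poly_Mapping.single i a)"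

definition word_monomial :: "nat list \<Rightarrow> monomial"
  where "word_monomial is = (\<Sum>i\<leftarrow>is. Poly_Mapping.single i 1)"

definition total_degree :: "monomial \<Rightarrow> nat"
  where "total_degree m = (\<Sum>i\<in>Poly_Mapping.keys m. Poly_Mapping.lookup m i)"

definition bounded_degree :: "(monomial \<Rightarrow> rat) \<Rightarrow> bool"
  where "bounded_degree f \<longleftrightarrow> (\<exists>d. \<forall>m. f m \<noteq> 0 \<longrightarrow> total_degree m \<le> d)"

definition quasisymmetric :: "(monomial \<Rightarrow> rat) \<Rightarrow> bool"
  where "quasisymmetric f \<longleftrightarrow> (\<forall>\<alpha> is js.
    sorted_wrt (<) is \<longrightarrow> sorted_wrt (<) js
    \<longrightarrow> length is = length (parts \<alpha>) \<longrightarrow> length js = length (parts \<alpha>)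
    \<longrightarrow> f (power_monomial is (parts \<alpha>)) = f (power_monomial js (parts \<alpha>)))"

lemma quasisymmetricI:
  assumes "\<And>\<alpha> is js. sorted_wrt (<) is \<Longrightarrow> sorted_wrt (<) js
    \<Longrightarrow> length is = length (parts \<alpha>) \<Longrightarrow> length js = length (parts \<alpha>)
    \<Longrightarrow> f (power_monomial is (parts \<alpha>)) = f (power_monomial js (parts \<alpha>))"
  shows "quasisymmetric f"
  unfolding quasisymmetric_def using assms by blast

lemma quasisymmetricD:
  assumes "quasisymmetric f" "sorted_wrt (<) is" "sorted_wrt (<) js"
    "length is = length (parts \<alpha>)" "length js = length (parts \<alpha>)"
  shows "f (power_monomial is (parts \<alpha>)) = f (power_monomial js (parts \<alpha>))"
  using assms unfolding quasisymmetric_def by blast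

typedef qsym = "{f. bounded_degree f \<and> quasisymmetric f}" morphisms coeff_of Abs_qsym
  by (rule exI[of _ "\<lambda>_. 0"]) (simp add: bounded_degree_def quasisymmetric_def)

setup_lifting type_definition_qsym

instantiation qsym :: rat_vector
begin

lift_definition zero_qsym :: qsym is "\<lambda>_. 0"
  by (simp add: bounded_degree_def quasisymmetric_def)

lift_definition plus_qsym :: "qsym \<Rightarrow> qsym \<Rightarrow> qsym" is "\<lambda>f g m. f m + g m"
proof -
  fix f g :: "monomial \<Rightarrow> rat"
  assume f: "bounded_degree f \<and> quasisymmetric f" and g: "bounded_degree g \<and> quasisymmetric g"
  from f g obtain d e where d: "\<And>m. f m \<noteq> 0 \<Longrightarrow> total_degree m \<le> d"
    and e: "\<And>m. g m \<noteq> 0 \<Longrightarrow> total_degree m \<le> e"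
    unfolding bounded_degree_def by blast
  have "total_degree m \<le> max d e" if "f m + g m \<noteq> 0" for m
    using that d[of m] e[of m] by (cases "f m = 0") auto
  then have "bounded_degree (\<lambda>m. f m + g m)"
    unfolding bounded_degree_def by blast
  moreover have "quasisymmetric (\<lambda>m. f m + g m)"
    using f g by (intro quasisymmetricI arg_cong2[where f = "(+)"]) (blast intro: quasisymmetricD)+
  ultimately show "bounded_degree (\<lambda>m. f m + g m) \<and> quasisymmetric (\<lambda>m. f m + g m)" ..
qed

lift_definition uminus_qsym :: "qsym \<Rightarrow> qsym" is "\<lambda>f m. - f m"
  by (auto simp: bounded_degree_def intro!: quasisymmetricI dest: quasisymmetricD)

definition minus_qsym :: "qsym \<Rightarrow> qsym \<Rightarrow> qsym" where "minus_qsym f g = f + (- g)"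

lift_definition scaleQ_qsym :: "rat \<Rightarrow> qsym \<Rightarrow> qsym" is "\<lambda>c f m. c * f m"
  by (auto simp: bounded_degree_def intro!: quasisymmetricI dest: quasisymmetricD)

instance
proof
  show "x - y = x + - y" for x y :: qsym by (rule minus_qsym_def)
qed (transfer; simp add: fun_eq_iff algebra_simps)+

end

definition relabel :: "(nat \<Rightarrow> nat) \<Rightarrow> monomial \<Rightarrow> monomial"
  where "relabel h m = (\<Sum>i\<in>Poly_Mapping.keys m. Poly_Mapping.single (h i) (Poly_Mapping.lookup m i))"

lemma relabel_superset:
  assumes "finite K" "Poly_Mapping.keys m \<subseteq> K"
  shows "relabel h m = (\<Sum>i\<in>K. Poly_Mapping.single (h i) (Poly_Mapping.lookup m i))"
  unfolding relabel_def using assms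
  by (intro sum.mono_neutral_left) (auto simp: in_keys_iff)

lemma keys_plus_monomial:
  "Poly_Mapping.keys (m + m' :: monomial) = Poly_Mapping.keys m \<union> Poly_Mapping.keys m'"
  by (auto simp: in_keys_iff lookup_add)

lemma relabel_zero [simp]: "relabel h 0 = 0"
  by (simp add: relabel_def)

lemma relabel_add: "relabel h (m + m') = relabel h m + relabel h m'"
  by (simp add: relabel_superset[of "Poly_Mapping.keys m \<union> Poly_Mapping.keys m'"]
      keys_plus_monomial lookup_add single_add sum.distrib)

lemma relabel_single [simp]: "relabel h (Poly_Mapping.single i a) = Poly_Mapping.single (h i) a"
  by (simp add: relabel_def)

lemma relabel_sum: "relabel h (\<Sum>x\<in>X. f x) = (\<Sum>x\<in>X. relabel h (f x))"
  by (induction X rule: infinite_finite_induct) (auto simp: relabel_add)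

lemma relabel_word: "relabel h (word_monomial is) = word_monomial (List.map h is)"
  by (induction "is") (auto simp: word_monomial_def relabel_add)

lemma power_monomial_simps [simp]:
  "power_monomial [] as = 0" "power_monomial is [] = 0"
  "power_monomial (i # is) (a # as) = Poly_Mapping.single i a + power_monomial is as"
  by (simp_all add: power_monomial_def)

lemma relabel_power: "relabel h (power_monomial is as) = power_monomial (List.map h is) as"
proof (induction "is" arbitrary: as)
  case (Cons i "is")
  then show ?case by (cases as) (auto simp: relabel_add)
qed simp

lemma sum_single_lookup:
  "(\<Sum>i\<in>Poly_Mapping.keys m. Poly_Mapping.single i (Poly_Mapping.lookup m i)) = (m :: monomial)"
  by (rule poly_mapping_eqI)
    (auto simp: lookup_sum lookup_single when_def in_keys_iff)

lemma relabel_relabel: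
  assumes "\<And>i. i \<in> Poly_Mapping.keys m \<Longrightarrow> g (h i) = i"
  shows "relabel g (relabel h m) = m"
  by (subst (2) relabel_def) (simp add: relabel_sum assms sum_single_lookup)

lemma keys_word_monomial: "Poly_Mapping.keys (word_monomial is) = set is"
  by (induction "is") (auto simp: word_monomial_def keys_plus_monomial)

lemma keys_power_monomial_subset: "Poly_Mapping.keys (power_monomial is as) \<subseteq> set is"
proof (induction "is" arbitrary: as)
  case (Cons i "is")
  then show ?case by (cases as) (fastforce simp: keys_plus_monomial split: if_splits)+
qed simp

lemma keys_power_monomial:
  "length is = length as \<Longrightarrow> \<forall>a\<in>set as. 0 < a \<Longrightarrow> Poly_Mapping.keys (power_monomial is as) = set is"
  by (induction "is" as rule: list_induct2) (auto simp: keys_plus_monomial)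

lemma keys_relabel: "Poly_Mapping.keys (relabel h m) \<subseteq> h ` Poly_Mapping.keys m"
proof
  fix k assume "k \<in> Poly_Mapping.keys (relabel h m)"
  then have "(\<Sum>i\<in>Poly_Mapping.keys m. Poly_Mapping.lookup
      (Poly_Mapping.single (h i) (Poly_Mapping.lookup m i)) k) \<noteq> 0"
    by (simp add: in_keys_iff relabel_def lookup_sum)
  then show "k \<in> h ` Poly_Mapping.keys m"
    by (auto simp: lookup_single when_def split: if_splits)
qed

lemma total_degree_superset:
  assumes "finite K" "Poly_Mapping.keys m \<subseteq> K"
  shows "total_degree m = (\<Sum>i\<in>K. Poly_Mapping.lookup m i)"
  unfolding total_degree_def using assms
  by (intro sum.mono_neutral_left) (auto simp: in_keys_iff)

lemma total_degree_add: "total_degree (m + m') = total_degree m + total_degree m'"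
  by (simp add: total_degree_superset[of "Poly_Mapping.keys m \<union> Poly_Mapping.keys m'"]
      keys_plus_monomial lookup_add sum.distrib)

lemma total_degree_single [simp]: "total_degree (Poly_Mapping.single i a) = a"
  by (simp add: total_degree_def)

lemma total_degree_zero [simp]: "total_degree 0 = 0"
  by (simp add: total_degree_def)

lemma total_degree_word: "total_degree (word_monomial is) = length is"
  by (induction "is") (auto simp: word_monomial_def total_degree_add)

lemma total_degree_power:
  "length is = length as \<Longrightarrow> total_degree (power_monomial is as) = sum_list as"
  by (induction "is" as rule: list_induct2) (auto simp: total_degree_add)

lemma ex_order_bij:
  assumes "sorted_wrt (<) is" "sorted_wrt (<) js" "length is = length js"
  obtains h :: "nat \<Rightarrow> nat" where "strict_mono_on (set is) h" "List.map h is = js"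
proof -
  define h where "h i = the (map_of (zip is js) i)" for i
  have "distinct is" using assms(1) strict_sorted_iff by blast
  then have h: "h (is ! k) = js ! k" if "k < length is" for k
    using that assms(3) by (simp add: h_def map_of_zip_nth)
  have "strict_mono_on (set is) h"
  proof (rule strict_mono_onI)
    fix x y assume "x \<in> set is" "y \<in> set is" "x < y"
    then obtain k l where kl: "k < length is" "l < length is" "is ! k = x" "is ! l = y"
      by (metis in_set_conv_nth)
    have "k < l"
      using kl \<open>x < y\<close> assms(1) by (metis linorder_neqE_nat not_less_iff_gr_or_eq sorted_wrt_nth_less)
    then show "h x < h y"
      using kl h assms by (metis sorted_wrt_nth_less)
  qed
  moreover have "List.map h is = js"
    using h assms(3) by (auto intro: nth_equalityI)
  ultimately show ?thesis using that by blast
qed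

lemma order_inverse:
  fixes h :: "nat \<Rightarrow> nat"
  assumes "strict_mono_on K h"
  obtains g where "strict_mono_on (h ` K) g" "\<And>i. i \<in> K \<Longrightarrow> g (h i) = i"
proof
  have inj: "inj_on h K" using assms by (rule strict_mono_on_imp_inj_on)
  then show g: "inv_into K h (h i) = i" if "i \<in> K" for i using that by simp
  show "strict_mono_on (h ` K) (inv_into K h)"
  proof (rule strict_mono_onI)
    fix x y assume "x \<in> h ` K" "y \<in> h ` K" "x < y"
    then obtain i j where "i \<in> K" "j \<in> K" "x = h i" "y = h j" "h i < h j" by auto
    then show "inv_into K h x < inv_into K h y"
      using assms g by (metis linorder_less_linear not_less_iff_gr_or_eq strict_mono_onD)
  qed
qed

lemma quasisymmetric_relabelI:
  assumes "\<And>m h. strict_mono_on (Poly_Mapping.keys m) h \<Longrightarrow> f m \<le> f (relabel h m)"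
  shows "quasisymmetric f"
proof (rule quasisymmetricI)
  have le: "f (power_monomial is (parts \<alpha>)) \<le> f (power_monomial js (parts \<alpha>))"
    if "sorted_wrt (<) is" "sorted_wrt (<) js"
      "length is = length (parts \<alpha>)" "length js = length (parts \<alpha>)" for \<alpha> "is" js
  proof -
    have "length is = length js" using that by simp
    with that obtain h where h: "strict_mono_on (set is) h" "List.map h is = js"
      by (blast intro: ex_order_bij)
    have "strict_mono_on (Poly_Mapping.keys (power_monomial is (parts \<alpha>))) h"
      using h(1) keys_power_monomial_subset by (rule monotone_on_subset)
    from assms[OF this] show ?thesis
      by (simp add: relabel_power h(2))
  qed
  show "f (power_monomial is (parts \<alpha>)) = f (power_monomial js (parts \<alpha>))"
    if "sorted_wrt (<) is" "sorted_wrt (<) js"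
      "length is = length (parts \<alpha>)" "length js = length (parts \<alpha>)" for \<alpha> "is" js
    using le[of "is" js \<alpha>] le[of js "is" \<alpha>] that by linarith
qed

lemma quasisymmetric_relabelD:
  assumes f: "quasisymmetric f" and h: "strict_mono_on (Poly_Mapping.keys m) h"
  shows "f (relabel h m) = f m"
proof -
  define ks where "ks = sorted_list_of_set (Poly_Mapping.keys m)"
  have ks: "sorted_wrt (<) ks" "set ks = Poly_Mapping.keys m" "distinct ks"
    by (simp_all add: ks_def)
  define \<alpha> where "\<alpha> = Composition (List.map (Poly_Mapping.lookup m) ks)"
  have \<alpha>: "parts \<alpha> = List.map (Poly_Mapping.lookup m) ks"
    unfolding \<alpha>_def by (rule Composition_inverse) (auto simp: ks in_keys_iff)
  have "power_monomial xs (List.map (Poly_Mapping.lookup m) xs)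
      = (\<Sum>i\<leftarrow>xs. Poly_Mapping.single i (Poly_Mapping.lookup m i))" for xs
    by (induction xs) auto
  then have m: "m = power_monomial ks (parts \<alpha>)"
    using ks by (simp add: \<alpha> sum_list_distinct_conv_sum_set sum_single_lookup)
  have "sorted_wrt (<) (List.map h ks)"
    using ks h by (auto simp: sorted_wrt_map strict_mono_on_def intro: sorted_wrt_mono_rel[rotated])
  then show ?thesis
    using quasisymmetricD[OF f, of ks "List.map h ks" \<alpha>] ks
    by (simp add: m relabel_power) (simp add: \<alpha>)
qed

lift_definition qsym_mult :: "qsym \<Rightarrow> qsym \<Rightarrow> qsym"
  is "\<lambda>f g m. \<Sum>(a, b) | a + b = m. f a * g b"
proof -
  fix f g :: "monomial \<Rightarrow> rat"
  assume f: "bounded_degree f \<and> quasisymmetric f" and g: "bounded_degree g \<and> quasisymmetric g"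
  let ?p = "\<lambda>m. \<Sum>(a, b) | a + b = m. f a * g b"
  from f g obtain d e where d: "\<And>m. f m \<noteq> 0 \<Longrightarrow> total_degree m \<le> d"
    and e: "\<And>m. g m \<noteq> 0 \<Longrightarrow> total_degree m \<le> e"
    unfolding bounded_degree_def by blast
  have "total_degree m \<le> d + e" if "?p m \<noteq> 0" for m
  proof -
    from that obtain a b where "a + b = m" "f a * g b \<noteq> 0"
      by (rule sum.not_neutral_contains_not_neutral) auto
    then show ?thesis
      using d[of a] e[of b] by (auto simp: total_degree_add)
  qed
  then have "bounded_degree ?p"
    unfolding bounded_degree_def by blast
  moreover have "quasisymmetric ?p"
  proof (rule quasisymmetric_relabelI)
    fix m :: monomial and h :: "nat \<Rightarrow> nat"
    assume h: "strict_mono_on (Poly_Mapping.keys m) h"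
    then obtain k where k: "\<And>i. i \<in> Poly_Mapping.keys m \<Longrightarrow> k (h i) = i"
      by (blast elim: order_inverse)
    have hk: "h (k j) = j" if "j \<in> Poly_Mapping.keys (relabel h m)" for j
      using that k keys_relabel by fastforce
    have kh: "relabel k (relabel h m) = m"
      by (rule relabel_relabel) (rule k)
    have "?p m = ?p (relabel h m)"
    proof (rule sum.reindex_bij_witness[where i = "map_prod (relabel k) (relabel k)"
            and j = "map_prod (relabel h) (relabel h)"])
      fix x assume "x \<in> {(a, b). a + b = m}"
      then obtain a b where x: "x = (a, b)" "a + b = m" by auto
      then have sub: "Poly_Mapping.keys a \<subseteq> Poly_Mapping.keys m"
        "Poly_Mapping.keys b \<subseteq> Poly_Mapping.keys m"
        by (auto simp: keys_plus_monomial)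
      then show "map_prod (relabel k) (relabel k) (map_prod (relabel h) (relabel h) x) = x"
        using k by (auto simp: x intro!: relabel_relabel)
      show "map_prod (relabel h) (relabel h) x \<in> {(a, b). a + b = relabel h m}"
        using x by (auto simp: relabel_add)
      have "f (relabel h a) = f a" "g (relabel h b) = g b"
        using f g by (auto intro: quasisymmetric_relabelD monotone_on_subset[OF h sub(1)]
            monotone_on_subset[OF h sub(2)])
      then show "(case map_prod (relabel h) (relabel h) x of (a, b) \<Rightarrow> f a * g b)
          = (case x of (a, b) \<Rightarrow> f a * g b)"
        by (simp add: x)
    next
      fix x assume "x \<in> {(a, b). a + b = relabel h m}"
      then obtain a b where x: "x = (a, b)" "a + b = relabel h m" by auto
      then have "Poly_Mapping.keys a \<subseteq> Poly_Mapping.keys (relabel h m)"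
        "Poly_Mapping.keys b \<subseteq> Poly_Mapping.keys (relabel h m)"
        by (auto simp: keys_plus_monomial simp flip: x(2))
      then show "map_prod (relabel h) (relabel h) (map_prod (relabel k) (relabel k) x) = x"
        using hk by (auto simp: x intro!: relabel_relabel)
      show "map_prod (relabel k) (relabel k) x \<in> {(a, b). a + b = m}"
        using kh by (auto simp: x(1) simp flip: relabel_add x(2))
    qed
    then show "?p m \<le> ?p (relabel h m)" by simp
  qed
  ultimately show "bounded_degree ?p \<and> quasisymmetric ?p" ..
qed

lift_definition qsym_one :: qsym is "\<lambda>m. if m = 0 then 1 else 0"
  by (auto simp: bounded_degree_def intro!: quasisymmetric_relabelI)

lift_definition M_qsym :: "composition \<Rightarrow> qsym"
  is "\<lambda>\<alpha> m. if \<exists>is. sorted_wrt (<) is \<and> length is = length (parts \<alpha>)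
        \<and> power_monomial is (parts \<alpha>) = m then 1 else 0"
proof -
  fix \<alpha>
  let ?P = "\<lambda>m is. sorted_wrt (<) is \<and> length is = length (parts \<alpha>)
      \<and> power_monomial is (parts \<alpha>) = m"
  let ?f = "\<lambda>m. if \<exists>is. ?P m is then 1 else 0 :: rat"
  have pos: "\<forall>a\<in>set (parts \<alpha>). 0 < a" using parts by auto
  have "bounded_degree ?f"
    unfolding bounded_degree_def by (auto simp: total_degree_power)
  moreover have "quasisymmetric ?f"
  proof (rule quasisymmetric_relabelI)
    fix m :: monomial and h :: "nat \<Rightarrow> nat"
    assume h: "strict_mono_on (Poly_Mapping.keys m) h"
    have "?P (relabel h m) (List.map h is)" if "?P m is" for "is"
    proof -
      have "Poly_Mapping.keys m = set is" using that pos keys_power_monomial by blast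
      then show ?thesis
        using that h by (auto simp: sorted_wrt_map relabel_power strict_mono_on_def
            intro: sorted_wrt_mono_rel[rotated])
    qed
    then have imp: "(\<exists>is. ?P m is) \<longrightarrow> (\<exists>is. ?P (relabel h m) is)" by blast
    have "(P \<longrightarrow> Q) \<Longrightarrow> (if P then 1 else 0) \<le> (if Q then 1 else 0 :: rat)" for P Q
      by simp
    from this[OF imp] show "?f m \<le> ?f (relabel h m)" .
  qed
  ultimately show "bounded_degree ?f \<and> quasisymmetric ?f" ..
qed

lift_definition F_qsym :: "composition \<Rightarrow> qsym"
  is "\<lambda>\<alpha> m. of_nat (card {is. length is = sum_list (parts \<alpha>) \<and> sorted is
        \<and> (\<forall>j \<in> {sum_list (take k (parts \<alpha>)) | k. 1 \<le> k \<and> k < length (parts \<alpha>)}.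
              is ! (j - 1) < is ! j)
        \<and> word_monomial is = m})"
proof -
  fix \<alpha>
  let ?n = "sum_list (parts \<alpha>)"
  let ?D = "{sum_list (take k (parts \<alpha>)) | k. 1 \<le> k \<and> k < length (parts \<alpha>)}"
  let ?W = "\<lambda>m. {is. length is = ?n \<and> sorted is \<and> (\<forall>j\<in>?D. is ! (j - 1) < is ! j)
      \<and> word_monomial is = m}"
  let ?f = "\<lambda>m. of_nat (card (?W m)) :: rat"
  have D: "j < ?n" if "j \<in> ?D" for j
  proof -
    from that obtain k where k: "k < length (parts \<alpha>)" "j = sum_list (take k (parts \<alpha>))" by auto
    have "0 < parts \<alpha> ! k" using parts[of \<alpha>] k by auto
    moreover have "?n = j + parts \<alpha> ! k + sum_list (drop (Suc k) (parts \<alpha>))"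
      using k by (metis append.assoc id_take_nth_drop sum_list.Cons sum_list.append add.assoc)
    ultimately show ?thesis by simp
  qed
  have fin: "finite (?W m)" for m
    by (rule finite_subset[OF _ finite_lists_length_eq[of "Poly_Mapping.keys m" ?n]])
      (auto simp: keys_word_monomial)
  have "total_degree m \<le> ?n" if "?f m \<noteq> 0" for m
  proof -
    from that have "?W m \<noteq> {}" by (metis card.empty of_nat_0)
    then show ?thesis by (auto simp: total_degree_word)
  qed
  then have "bounded_degree ?f"
    unfolding bounded_degree_def by blast
  moreover have "quasisymmetric ?f"
  proof (rule quasisymmetric_relabelI)
    fix m :: monomial and h :: "nat \<Rightarrow> nat"
    assume h: "strict_mono_on (Poly_Mapping.keys m) h"
    have "List.map h is \<in> ?W (relabel h m)" if "is \<in> ?W m" for "is"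
    proof -
      have m: "Poly_Mapping.keys m = set is" using that keys_word_monomial by blast
      have "sorted (List.map h is)"
        using that h strict_mono_on_imp_mono_on[OF h] unfolding sorted_map m
        by (auto simp: mono_on_def intro: sorted_wrt_mono_rel[rotated])
      moreover have "List.map h is ! (j - 1) < List.map h is ! j" if j: "j \<in> ?D" for j
      proof -
        have "is ! (j - 1) < is ! j" "j < length is" 
          using j D[OF j] \<open>is \<in> ?W m\<close> by (blast, simp)
        then show ?thesis by (simp add: strict_mono_onD[OF h] m)
      qed
      ultimately show ?thesis using that by (simp add: relabel_word[symmetric])
    qed
    moreover have "inj_on (List.map h) (?W m)"
    proof (rule inj_on_subset[OF inj_on_mapI])
      show "inj_on h (\<Union> (set ` ?W m))"
        using strict_mono_on_imp_inj_on[OF h] by (rule inj_on_subset) (auto simp: keys_word_monomial)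
    qed auto
    ultimately have "card (?W m) \<le> card (?W (relabel h m))"
      using fin by (intro card_inj_on_le) auto
    then show "?f m \<le> ?f (relabel h m)" by simp
  qed
  ultimately show "bounded_degree ?f \<and> quasisymmetric ?f" ..
qed

text \<open>On the monomial basis the coproduct \<open>f(x) \<mapsto> f(x, y)\<close> is deconcatenation of compositions; it is
  determined by this, since the monomial quasisymmetric functions form a basis.\<close>

definition qsym_comult :: "qsym \<Rightarrow> (qsym, qsym) tensor"
  where "qsym_comult = (THE \<Delta>. qlinear \<Delta>
    \<and> (\<forall>\<alpha>. \<Delta> (M_qsym \<alpha>) = (\<Sum>(\<beta>, \<gamma>) | comp_append \<beta> \<gamma> = \<alpha>. M_qsym \<beta> \<otimes> M_qsym \<gamma>)))"

definition QSym :: "qsym bialgebra_ops"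
  where "QSym =
    \<lparr> mult = qsym_mult, unit = qsym_one, comult = qsym_comult, counit = (\<lambda>f. coeff_of f 0) \<rparr>"

lift_definition des_class_Comp :: "des_class \<Rightarrow> composition" is Comp
  by (simp add: Des_equiv_def Comp_def Comp_parts_def)

definition Des_to_QSym :: "(des_class \<Rightarrow>\<^sub>0 rat) \<Rightarrow> qsym"
  where "Des_to_QSym = linear_extension (\<lambda>c. F_qsym (des_class_Comp c))"

end

theory Submission
  imports "HOL-Library.Multiset" "HOL-Library.Product_Lexorder" Defs
begin

text \<open>
  In the coefficients of its monomials, the coproduct of \<open>QSym\<close> is the substitution
  \<open>f(x) \<mapsto> f(x, y)\<close>, hence multiplicative. Recursion along deconcatenation of the monomial basis
  gives every linear map \<open>f\<close> on \<open>QSym\<close> with \<open>f(1) = 1\<close> a left inverse under convolution. The left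
  inverse \<open>S\<close> of the identity has a left inverse itself, which must be the identity, so \<open>S\<close> is an
  antipode. The Hopf algebra structure of \<open>QSym\<close> then pulls back along any linear bijection that
  respects all operations.

  The linear map \<open>[\<pi>] \<mapsto> F\<^bsub>Comp(\<pi>)\<^esub>\<close> is bijective because the fundamental basis is
  unitriangular over the monomial one. It is multiplicative because \<open>F\<^bsub>Comp(\<pi>)\<^esub>\<close> enumerates the
  lexicographically increasing sequences of pairs with second components \<open>\<pi>\<^sub>1, \<dots>, \<pi>\<^sub>n\<close>, and
  merging two such sequences over disjoint permutations shuffles these permutations. Together with
  injectivity this also yields the shuffle-compatibility of \<open>Des\<close>, on which the product of \<open>H_Des\<close>
  relies.
\<close>

section \<open>Linear and bilinear maps\<close>

named_theorems linear_intros

lemma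
  assumes "qlinear f"
  shows qlinear_add: "f (x + y) = f x + f y"
    and qlinear_diff: "f (x - y) = f x - f y"
    and qlinear_scaleQ: "f (c *\<^sub>Q x) = c *\<^sub>Q f x"
    and qlinear_zero: "f 0 = 0"
    and qlinear_sum: "f (\<Sum>i\<in>I. g i) = (\<Sum>i\<in>I. f (g i))"
proof -
  interpret f: Vector_Spaces.linear scaleQ scaleQ f by (fact assms)
  show "f (x + y) = f x + f y" "f (x - y) = f x - f y" "f (c *\<^sub>Q x) = c *\<^sub>Q f x" "f 0 = 0"
    "f (\<Sum>i\<in>I. g i) = (\<Sum>i\<in>I. f (g i))"
    by (fact f.add f.diff f.scale f.zero f.sum)+
qed

lemma qlinear_ident [linear_intros]: "qlinear (\<lambda>x. x)" and qlinear_id [linear_intros]: "qlinear id"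
  by (simp_all add: qlinear_iff)

lemma qlinear_compose: "qlinear f \<Longrightarrow> qlinear g \<Longrightarrow> qlinear (\<lambda>x. f (g x))"
  by (simp add: qlinear_iff)

lemma qlinear_fun_add [linear_intros]: "qlinear f \<Longrightarrow> qlinear g \<Longrightarrow> qlinear (\<lambda>x. f x + g x)"
  by (simp add: qlinear_iff scaleQ_add_right)

lemma qlinear_fun_scaleQ [linear_intros]: "qlinear f \<Longrightarrow> qlinear (\<lambda>x. c *\<^sub>Q f x)"
  by (simp add: qlinear_iff scaleQ_add_right scaleQ_scaleQ mult.commute)

lemmas [linear_intros] = qlinear_compose[OF qlinear_linear_extension]

lemma qlinear_linear_extension_param [linear_intros]:
  assumes "\<And>k. qlinear (\<lambda>x. b x k)"
  shows "qlinear (\<lambda>x. linear_extension (b x) v)"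
  using qlinear_add[OF assms] qlinear_scaleQ[OF assms]
  by (simp add: qlinear_iff linear_extension_def scaleQ_add_right sum.distrib
      rat_vector.scale_sum_right scaleQ_scaleQ mult.commute)

lemma qlinear_lookup [linear_intros]: "qlinear f \<Longrightarrow> qlinear (\<lambda>x. Poly_Mapping.lookup (f x) k)"
  by (simp add: qlinear_iff lookup_add lookup_scaleQ)

lemma linear_linear_extension:
  "qlinear f \<Longrightarrow> f (linear_extension b v) = linear_extension (\<lambda>k. f (b k)) v"
  by (simp add: linear_extension_def qlinear_scaleQ qlinear_sum)

lemma linear_extension_ident [simp]: "linear_extension (\<lambda>k. Poly_Mapping.single k 1) v = v"
  using qlinear_eq_linear_extension[OF qlinear_ident] by (rule sym)

lemma linear_extension_const_zero [simp]: "linear_extension (\<lambda>k. 0) v = 0"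
  by (simp add: linear_extension_def)

lemma linear_extension_delta:
  "linear_extension (\<lambda>j. if j = k then a else 0) v = Poly_Mapping.lookup v k *\<^sub>Q a"
  by (simp add: linear_extension_def if_distrib[of "scaleQ _"] in_keys_iff cong: if_cong)

lemma qlinear_inv:
  assumes "qlinear f" "bij f"
  shows "qlinear (inv f)"
  unfolding qlinear_iff using assms
  by (auto simp: qlinear_add qlinear_scaleQ bij_is_surj surj_f_inv_f
      intro!: inv_f_eq[OF bij_is_inj])

lemma qbilinearI [linear_intros]:
  "(\<And>y. qlinear (\<lambda>x. b x y)) \<Longrightarrow> (\<And>x. qlinear (\<lambda>y. b x y)) \<Longrightarrow> qbilinear b"
  by (simp add: qbilinear_def)

lemma
  assumes "qbilinear b"
  shows qbilinear_left: "qlinear f \<Longrightarrow> qlinear (\<lambda>z. b (f z) y)"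
    and qbilinear_right: "qlinear g \<Longrightarrow> qlinear (\<lambda>z. b x (g z))"
  using assms qlinear_compose[of "\<lambda>x. b x y"] qlinear_compose[of "b x"]
  by (simp_all add: qbilinear_def)

lemma
  assumes "qbilinear b"
  shows qbilinear_add_left: "b (x + x') y = b x y + b x' y"
    and qbilinear_add_right: "b x (y + y') = b x y + b x y'"
    and qbilinear_scaleQ_left: "b (c *\<^sub>Q x) y = c *\<^sub>Q b x y"
    and qbilinear_scaleQ_right: "b x (c *\<^sub>Q y) = c *\<^sub>Q b x y"
    and qbilinear_sum_left: "b (\<Sum>i\<in>I. g i) y = (\<Sum>i\<in>I. b (g i) y)"
    and qbilinear_sum_right: "b x (\<Sum>i\<in>I. h i) = (\<Sum>i\<in>I. b x (h i))"
  using qlinear_add qlinear_scaleQ qlinear_sum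
    qbilinear_left[OF assms qlinear_ident, of y] qbilinear_right[OF assms qlinear_ident, of x]
  by blast+

lemma qbilinear_scaleQ: "qbilinear (scaleQ :: rat \<Rightarrow> 'a \<Rightarrow> 'a::rat_vector)"
  by (simp add: qbilinear_def qlinear_iff scaleQ_rat_def scaleQ_add_left scaleQ_add_right
      scaleQ_scaleQ mult.commute)

lemmas [linear_intros] = qbilinear_left[OF qbilinear_scaleQ]

lemma [linear_intros]:
  fixes f :: "'a::rat_vector \<Rightarrow> rat"
  assumes "qlinear f"
  shows "qlinear (\<lambda>x. f x * c)" and "qlinear (\<lambda>x. c * f x)"
  using qlinear_fun_scaleQ[OF assms, of c] by (simp_all add: scaleQ_rat_def mult.commute)

section \<open>Tensor products\<close>

lemma qlinear_abs_tensor: "qlinear abs_tensor"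
  by (simp add: qlinear_iff plus_tensor.abs_eq scaleQ_tensor.abs_eq)

lemma qbilinear_pure_tensor: "qbilinear (\<otimes>)"
proof -
  have abs_eqI: "abs_tensor s = abs_tensor t"
    if "s - t \<in> tensor_relators" for s t :: "('a \<times> 'b) \<Rightarrow>\<^sub>0 rat"
    using that by (simp add: tensor.abs_eq_iff tensor_equiv_def rat_vector.span_base)
  have "abs_tensor (Poly_Mapping.single (x + x', y) 1)
      = abs_tensor (Poly_Mapping.single (x, y) 1 + Poly_Mapping.single (x', y) 1)"
    "abs_tensor (Poly_Mapping.single (x, y + y') 1)
      = abs_tensor (Poly_Mapping.single (x, y) 1 + Poly_Mapping.single (x, y') 1)"
    "abs_tensor (Poly_Mapping.single (c *\<^sub>Q x, y) 1)
      = abs_tensor (c *\<^sub>Q Poly_Mapping.single (x, y) 1)"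
    "abs_tensor (Poly_Mapping.single (x, c *\<^sub>Q y) 1)
      = abs_tensor (c *\<^sub>Q Poly_Mapping.single (x, y) 1)"
    for x x' :: 'a and y y' :: 'b and c
    by (rule abs_eqI; unfold tensor_relators_def diff_diff_eq[symmetric]; blast)+
  then show ?thesis
    by (simp add: qbilinear_def qlinear_iff pure_tensor.abs_eq plus_tensor.abs_eq
        scaleQ_tensor.abs_eq)
qed

lemmas pure_tensor_add_left = qbilinear_add_left[OF qbilinear_pure_tensor]
  and pure_tensor_scaleQ_left = qbilinear_scaleQ_left[OF qbilinear_pure_tensor]
  and pure_tensor_scaleQ_right = qbilinear_scaleQ_right[OF qbilinear_pure_tensor]
  and pure_tensor_sum_left = qbilinear_sum_left[OF qbilinear_pure_tensor]
  and pure_tensor_sum_right = qbilinear_sum_right[OF qbilinear_pure_tensor]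

lemmas [linear_intros] =
  qbilinear_left[OF qbilinear_pure_tensor] qbilinear_right[OF qbilinear_pure_tensor]

lemma
  shows linear_extension_pure_tensor_left:
      "linear_extension (\<lambda>k. b k \<otimes> y) v = linear_extension b v \<otimes> y"
    and linear_extension_pure_tensor_right:
      "linear_extension (\<lambda>k. x \<otimes> c k) v = x \<otimes> linear_extension c v"
  by (simp_all add: linear_extension_def pure_tensor_sum_left pure_tensor_sum_right
      pure_tensor_scaleQ_left pure_tensor_scaleQ_right)

lemma tensor_induct [case_names pure add, induct type: tensor]:
  assumes pure: "\<And>x y. P (x \<otimes> y)" and add: "\<And>s t. P s \<Longrightarrow> P t \<Longrightarrow> P (s + t)"
  shows "P t"
proof -
  obtain v where t: "t = abs_tensor v"
    by (metis Quotient3_abs_rep[OF Quotient3_tensor])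
  have "abs_tensor (Poly_Mapping.single k 1) = fst k \<otimes> snd k" for k :: "'a \<times> 'b"
    by (simp add: pure_tensor.abs_eq)
  then have t_sum: "t = (\<Sum>k\<in>Poly_Mapping.keys v. (Poly_Mapping.lookup v k *\<^sub>Q fst k) \<otimes> snd k)"
    unfolding t by (subst qlinear_eq_linear_extension[OF qlinear_abs_tensor])
      (simp add: linear_extension_def pure_tensor_scaleQ_left)
  have "0 = 0 \<otimes> (0 :: 'b)"
    using pure_tensor_scaleQ_left[of 0 0 "0::'b"] by simp
  then have "P 0" by (metis pure)
  then have "P (\<Sum>k\<in>K. (Poly_Mapping.lookup v k *\<^sub>Q fst k) \<otimes> snd k)" for K
    by (induction K rule: infinite_finite_induct) (simp_all add: pure add)
  then show ?thesis unfolding t_sum .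
qed

lemma
  assumes "qbilinear b"
  shows qlinear_tensor_lift: "qlinear (tensor_lift b)"
    and tensor_lift_pure: "tensor_lift b (x \<otimes> y) = b x y"
proof -
  have "qlinear (tensor_lift b) \<and> (\<forall>x y. tensor_lift b (x \<otimes> y) = b x y)"
    unfolding tensor_lift_def by (rule theI'[OF tensor_ex1[OF assms]])
  then show "qlinear (tensor_lift b)" "tensor_lift b (x \<otimes> y) = b x y" by simp_all
qed

lemmas tensor_lift_add = qlinear_add[OF qlinear_tensor_lift]
  and tensor_lift_sum = qlinear_sum[OF qlinear_tensor_lift]

lemmas [linear_intros] = qlinear_compose[OF qlinear_tensor_lift]

lemma linear_tensor_lift:
  assumes "qlinear f" "qbilinear b"
  shows "f (tensor_lift b t) = tensor_lift (\<lambda>x y. f (b x y)) t"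
proof -
  have "qbilinear (\<lambda>x y. f (b x y))"
    using assms by (simp add: qbilinear_def qlinear_iff)
  then show ?thesis
    by (induction t) (simp_all add: assms tensor_lift_pure tensor_lift_add qlinear_add)
qed

lemma qlinear_tensor_lift_param [linear_intros]:
  assumes "\<And>z. qbilinear (b z)" "\<And>x y. qlinear (\<lambda>z. b z x y)"
  shows "qlinear (\<lambda>z. tensor_lift (b z) t)"
  by (induction t) (simp_all add: tensor_lift_pure tensor_lift_add assms qlinear_fun_add)

lemma
  assumes "qlinear f" "qlinear g"
  shows qlinear_tensor_map: "qlinear (tensor_map f g)"
    and tensor_map_pure: "tensor_map f g (x \<otimes> y) = f x \<otimes> g y"
proof -
  have "qbilinear (\<lambda>x y. f x \<otimes> g y)"
    by (intro linear_intros assms)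
  then show "qlinear (tensor_map f g)" "tensor_map f g (x \<otimes> y) = f x \<otimes> g y"
    unfolding tensor_map_def by (simp_all add: qlinear_tensor_lift tensor_lift_pure)
qed

lemmas tensor_map_add = qlinear_add[OF qlinear_tensor_map]
  and tensor_map_sum = qlinear_sum[OF qlinear_tensor_map]

lemmas [linear_intros] = qlinear_compose[OF qlinear_tensor_map]

lemma tensor_map_tensor_map:
  assumes "qlinear f" "qlinear g" "qlinear f'" "qlinear g'"
  shows "tensor_map f' g' (tensor_map f g t) = tensor_map (\<lambda>x. f' (f x)) (\<lambda>x. g' (g x)) t"
  by (induction t)
    (simp_all add: tensor_map_pure tensor_map_add assms qlinear_compose[OF assms(3) assms(1)]
      qlinear_compose[OF assms(4) assms(2)])

lemma tensor_map_ident [simp]: "tensor_map (\<lambda>x. x) (\<lambda>x. x) t = t"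
  by (induction t) (simp_all add: tensor_map_pure tensor_map_add linear_intros)

lemma tensor_lift_tensor_map:
  assumes "qbilinear b" "qlinear f" "qlinear g"
  shows "tensor_lift b (tensor_map f g t) = tensor_lift (\<lambda>x y. b (f x) (g y)) t"
proof -
  have "qbilinear (\<lambda>x y. b (f x) (g y))"
    using assms by (intro qbilinearI qbilinear_left[OF assms(1)] qbilinear_right[OF assms(1)])
  then show ?thesis
    by (induction t)
      (simp_all add: tensor_lift_pure tensor_lift_add tensor_map_pure tensor_map_add assms)
qed

lemma bij_tensor_map:
  assumes "qlinear f" "bij f" "qlinear g" "bij g"
  shows "bij (tensor_map f g)"
proof (rule o_bij[where g = "tensor_map (inv f) (inv g)"])
  show "tensor_map (inv f) (inv g) \<circ> tensor_map f g = id"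
    "tensor_map f g \<circ> tensor_map (inv f) (inv g) = id"
    using assms by (simp_all add: fun_eq_iff tensor_map_tensor_map qlinear_inv bij_is_inj
        bij_is_surj surj_f_inv_f)
qed

lemma
  fixes x :: "'a::rat_vector" and y :: "'b::rat_vector" and z :: "'c::rat_vector"
  shows qlinear_tensor_assoc: "qlinear (tensor_assoc :: (('a, 'b) tensor, 'c) tensor \<Rightarrow> _)"
    and tensor_assoc_pure: "tensor_assoc ((x \<otimes> y) \<otimes> z) = x \<otimes> (y \<otimes> z)"
proof -
  have bilinear: "qbilinear (\<lambda>(x::'a) (y::'b). x \<otimes> (y \<otimes> z))" for z :: 'c
    by (intro linear_intros)
  have "qbilinear (\<lambda>t (z::'c). tensor_lift (\<lambda>(x::'a) (y::'b). x \<otimes> (y \<otimes> z)) t)"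
    by (intro linear_intros)
  then show "qlinear (tensor_assoc :: (('a, 'b) tensor, 'c) tensor \<Rightarrow> _)"
      "tensor_assoc ((x \<otimes> y) \<otimes> z) = x \<otimes> (y \<otimes> z)"
    unfolding tensor_assoc_def by (simp_all add: qlinear_tensor_lift tensor_lift_pure bilinear)
qed

lemmas tensor_assoc_add = qlinear_add[OF qlinear_tensor_assoc]
  and tensor_assoc_sum = qlinear_sum[OF qlinear_tensor_assoc]

lemmas [linear_intros] = qlinear_compose[OF qlinear_tensor_assoc]

lemma tensor_induct3 [case_names pure add]:
  assumes pure: "\<And>x y z. P ((x \<otimes> y) \<otimes> z)" and add: "\<And>s t. P s \<Longrightarrow> P t \<Longrightarrow> P (s + t)"
  shows "P t"
proof (induction t)
  case (pure s z)
  show ?case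
    by (induction s) (simp_all add: assms pure_tensor_add_left)
qed (fact add)

lemma tensor_assoc_natural:
  assumes "qlinear f" "qlinear g" "qlinear h"
  shows "tensor_assoc (tensor_map (tensor_map f g) h t)
    = tensor_map f (tensor_map g h) (tensor_assoc t)"
  by (induction t rule: tensor_induct3)
    (simp_all add: tensor_map_pure tensor_map_add tensor_assoc_pure tensor_assoc_add
      qlinear_tensor_map assms)

lemma
  assumes "qbilinear (mult A)"
  shows qbilinear_tensor_mult: "qbilinear (tensor_mult A)"
    and tensor_mult_pure: "tensor_mult A (a \<otimes> b) (c \<otimes> d) = mult A a c \<otimes> mult A b d"
proof -
  note [linear_intros] = qbilinear_left[OF assms] qbilinear_right[OF assms]
  have inner: "qbilinear (\<lambda>c d. mult A a c \<otimes> mult A b d)" for a b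
    by (intro linear_intros)
  have outer: "qbilinear (\<lambda>a b. tensor_lift (\<lambda>c d. mult A a c \<otimes> mult A b d) t)" for t
    by (intro linear_intros)
  show "qbilinear (tensor_mult A)"
    unfolding tensor_mult_def[abs_def] by (intro linear_intros)
  have "tensor_mult A (a \<otimes> b) (c \<otimes> d) = tensor_lift (\<lambda>c d. mult A a c \<otimes> mult A b d) (c \<otimes> d)"
    unfolding tensor_mult_def by (rule tensor_lift_pure[OF outer])
  also have "\<dots> = mult A a c \<otimes> mult A b d"
    by (rule tensor_lift_pure[OF inner])
  finally show "tensor_mult A (a \<otimes> b) (c \<otimes> d) = mult A a c \<otimes> mult A b d" .
qed

section \<open>Bases\<close>

locale qbasis =
  fixes b :: "'k \<Rightarrow> 'a::rat_vector"
  assumes bij_linear_extension: "bij (linear_extension b)"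
begin

definition coords :: "'a \<Rightarrow> 'k \<Rightarrow>\<^sub>0 rat"
  where "coords = inv (linear_extension b)"

lemma qlinear_coords: "qlinear coords"
  unfolding coords_def using qlinear_linear_extension bij_linear_extension by (rule qlinear_inv)

lemmas [linear_intros] = qlinear_compose[OF qlinear_coords]

lemma linear_extension_coords [simp]: "linear_extension b (coords x) = x"
  by (simp add: coords_def bij_linear_extension bij_is_surj surj_f_inv_f)

lemma coords_linear_extension [simp]: "coords (linear_extension b v) = v"
  by (simp add: coords_def bij_linear_extension bij_is_inj)

lemma coords_basis [simp]: "coords (b k) = Poly_Mapping.single k 1"
  using coords_linear_extension[of "Poly_Mapping.single k 1"] by simp

lemma linear_eqI:
  assumes "qlinear f" "qlinear g" "\<And>k. f (b k) = g (b k)"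
  shows "f x = g x"
proof -
  have "f (linear_extension b (coords x)) = g (linear_extension b (coords x))"
    using assms by (simp only: linear_linear_extension)
  then show ?thesis by simp
qed

lemma ex1_linear: "\<exists>!f. qlinear f \<and> (\<forall>k. f (b k) = h k)"
proof (rule ex1I)
  show "qlinear (\<lambda>x. linear_extension h (coords x)) \<and> (\<forall>k. linear_extension h (coords (b k)) = h k)"
    by (simp add: linear_intros)
  show "f = (\<lambda>x. linear_extension h (coords x))" if "qlinear f \<and> (\<forall>k. f (b k) = h k)" for f
    by (rule ext, rule linear_eqI) (use that in \<open>simp_all add: linear_intros\<close>)
qed

lemma qbasis_comp_bij:
  assumes "bij h"
  shows "qbasis (\<lambda>k. b (h k))"
proof
  let ?reindex = "\<lambda>h. linear_extension (\<lambda>k. Poly_Mapping.single (h k) (1::rat))"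
  have bij_reindex: "bij (?reindex h)"
    by (rule o_bij[where g = "?reindex (inv h)"])
      (simp_all add: fun_eq_iff linear_linear_extension[OF qlinear_linear_extension] assms
        bij_is_inj bij_is_surj surj_f_inv_f)
  have comp: "linear_extension (\<lambda>k. b (h k)) = linear_extension b \<circ> ?reindex h"
    by (simp add: fun_eq_iff linear_linear_extension[OF qlinear_linear_extension])
  show "bij (linear_extension (\<lambda>k. b (h k)))"
    unfolding comp using bij_reindex bij_linear_extension by (rule bij_comp)
qed

lemma lookup_coords_unitriangular:
  assumes c: "\<And>k. c k = b k + (\<Sum>l\<in>U k. b l)" and "\<And>l. l \<in> Poly_Mapping.keys v \<Longrightarrow> k \<notin> U l"
  shows "Poly_Mapping.lookup (coords (linear_extension c v)) k = Poly_Mapping.lookup v k"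
proof -
  have "Poly_Mapping.lookup (coords (c l)) k = (if l = k then 1 else 0)"
    if "l \<in> Poly_Mapping.keys v" for l
  proof -
    have "Poly_Mapping.lookup (coords (c l)) k
        = Poly_Mapping.lookup (Poly_Mapping.single l 1) k
          + (\<Sum>j\<in>U l. Poly_Mapping.lookup (Poly_Mapping.single j 1) k)"
      by (simp add: c qlinear_add[OF qlinear_coords] qlinear_sum[OF qlinear_coords]
          lookup_add lookup_sum)
    also have "(\<Sum>j\<in>U l. Poly_Mapping.lookup (Poly_Mapping.single j (1::rat)) k) = 0"
      using assms(2)[OF that] by (intro sum.neutral) (auto simp: lookup_single when_def)
    finally show ?thesis by (simp add: lookup_single when_def)
  qed
  then have "(\<Sum>l\<in>Poly_Mapping.keys v.
        Poly_Mapping.lookup v l * Poly_Mapping.lookup (coords (c l)) k)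
      = (\<Sum>l\<in>Poly_Mapping.keys v. if l = k then Poly_Mapping.lookup v l else 0)"
    by (intro sum.cong) auto
  then show ?thesis
    by (simp add: linear_extension_def qlinear_sum[OF qlinear_coords]
        qlinear_scaleQ[OF qlinear_coords] lookup_sum lookup_scaleQ scaleQ_rat_def in_keys_iff)
qed

lemma linear_extension_unitriangular_eq_0:
  fixes rank :: "'k \<Rightarrow> nat"
  assumes c: "\<And>k. c k = b k + (\<Sum>l\<in>U k. b l)"
    and rank: "\<And>k l. l \<in> U k \<Longrightarrow> rank l < rank k"
    and v: "linear_extension c v = 0"
  shows "v = 0"
proof (rule ccontr)
  assume "v \<noteq> 0"
  then have "Max (rank ` Poly_Mapping.keys v) \<in> rank ` Poly_Mapping.keys v"
    by (intro Max_in) simp_all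
  then obtain k where k: "k \<in> Poly_Mapping.keys v" "rank k = Max (rank ` Poly_Mapping.keys v)"
    by auto
  have "rank l \<le> rank k" if "l \<in> Poly_Mapping.keys v" for l
    unfolding k(2) using that by (intro Max_ge) simp_all
  then have "k \<notin> U l" if "l \<in> Poly_Mapping.keys v" for l
    using that rank[of k l] by fastforce
  with c have "Poly_Mapping.lookup (coords (linear_extension c v)) k = Poly_Mapping.lookup v k"
    by (rule lookup_coords_unitriangular)
  with v k(1) show False
    by (simp add: qlinear_zero[OF qlinear_coords] in_keys_iff)
qed

lemma basis_in_range_unitriangular:
  fixes rank :: "'k \<Rightarrow> nat"
  assumes c: "\<And>k. c k = b k + (\<Sum>l\<in>U k. b l)"
    and rank: "\<And>k l. l \<in> U k \<Longrightarrow> rank l < rank k"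
  shows "\<exists>v. b k = linear_extension c v"
proof (induction "rank k" arbitrary: k rule: less_induct)
  case less
  note linear = qlinear_linear_extension[of c]
  have "\<exists>v. b l = linear_extension c v" if "l \<in> U k" for l
    using rank[OF that] by (rule less)
  then obtain v where v: "\<And>l. l \<in> U k \<Longrightarrow> b l = linear_extension c (v l)"
    by metis
  have "b k = c k - (\<Sum>l\<in>U k. b l)" unfolding c by simp
  also have "\<dots> = linear_extension c (Poly_Mapping.single k 1 - (\<Sum>l\<in>U k. v l))"
    by (simp add: qlinear_diff[OF linear] qlinear_sum[OF linear] v)
  finally show ?case by blast
qed

lemma qbasis_unitriangular:
  fixes rank :: "'k \<Rightarrow> nat"
  assumes c: "\<And>k. c k = b k + (\<Sum>l\<in>U k. b l)"
    and rank: "\<And>k l. l \<in> U k \<Longrightarrow> rank l < rank k"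
  shows "qbasis c"
proof
  have linear: "qlinear (linear_extension c)" by (rule qlinear_linear_extension)
  have "v = w" if "linear_extension c v = linear_extension c w" for v w
  proof -
    have "linear_extension c (v - w) = 0" using that by (simp add: qlinear_diff[OF linear])
    with c rank have "v - w = 0" by (rule linear_extension_unitriangular_eq_0)
    then show ?thesis by simp
  qed
  then have "inj (linear_extension c)" by (rule injI)
  moreover have "surj (linear_extension c)"
  proof -
    have "\<exists>v. b k = linear_extension c v" for k
      using c rank by (rule basis_in_range_unitriangular)
    then obtain v where v: "\<And>k. b k = linear_extension c (v k)" by metis
    have "linear_extension c (linear_extension v (coords x)) = x" for x
      by (simp add: linear_linear_extension[OF linear] flip: v)
    then show ?thesis by (rule surjI)
  qed
  ultimately show "bij (linear_extension c)" by (rule bijI)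
qed

end

global_interpretation free_basis: qbasis "\<lambda>k. Poly_Mapping.single k (1::rat)"
  by unfold_locales (simp add: bij_iff)

locale qbasis_pair = b: qbasis b + c: qbasis c
  for b :: "'k \<Rightarrow> 'a::rat_vector" and c :: "'l \<Rightarrow> 'b::rat_vector"
begin

definition tensor_coords :: "('a, 'b) tensor \<Rightarrow> 'k \<times> 'l \<Rightarrow>\<^sub>0 rat"
  where "tensor_coords = tensor_lift (\<lambda>x y. linear_extension
    (\<lambda>k. linear_extension (\<lambda>l. Poly_Mapping.single (k, l) 1) (c.coords y)) (b.coords x))"

lemma
  shows qlinear_tensor_coords: "qlinear tensor_coords"
    and tensor_coords_pure: "tensor_coords (x \<otimes> y) = linear_extension
      (\<lambda>k. linear_extension (\<lambda>l. Poly_Mapping.single (k, l) 1) (c.coords y)) (b.coords x)"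
proof -
  have "qbilinear (\<lambda>x y. linear_extension
      (\<lambda>k. linear_extension (\<lambda>l. Poly_Mapping.single (k, l) (1::rat)) (c.coords y)) (b.coords x))"
    by (intro linear_intros)
  then show "qlinear tensor_coords" "tensor_coords (x \<otimes> y) = linear_extension
      (\<lambda>k. linear_extension (\<lambda>l. Poly_Mapping.single (k, l) 1) (c.coords y)) (b.coords x)"
    unfolding tensor_coords_def by (simp_all add: qlinear_tensor_lift tensor_lift_pure)
qed

lemma linear_extension_tensor_coords:
  "linear_extension (\<lambda>(k, l). b k \<otimes> c l) (tensor_coords t) = t"
proof (induction t)
  case (pure x y)
  have "linear_extension (\<lambda>(k, l). b k \<otimes> c l) (tensor_coords (x \<otimes> y))
      = linear_extension (\<lambda>k. linear_extension (\<lambda>l. b k \<otimes> c l) (c.coords y)) (b.coords x)"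
    by (simp add: tensor_coords_pure linear_linear_extension[OF qlinear_linear_extension])
  also have "\<dots> = x \<otimes> y"
    by (simp add: linear_extension_pure_tensor_left linear_extension_pure_tensor_right)
  finally show ?case .
qed (simp add: qlinear_add[OF qlinear_tensor_coords] qlinear_add[OF qlinear_linear_extension])

lemma lookup_tensor_coords:
  "Poly_Mapping.lookup (tensor_coords t) (k, l) = tensor_lift
    (\<lambda>x y. Poly_Mapping.lookup (b.coords x) k * Poly_Mapping.lookup (c.coords y) l) t"
proof -
  have bilinear: "qbilinear (\<lambda>x y.
      Poly_Mapping.lookup (b.coords x) k * Poly_Mapping.lookup (c.coords y) l)"
    by (intro linear_intros)
  show ?thesis
  proof (induction t)
    case (pure x y)
    have "Poly_Mapping.lookup
          (linear_extension (\<lambda>l. Poly_Mapping.single (k', l) 1) (c.coords y)) (k, l)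
        = (if k' = k then Poly_Mapping.lookup (c.coords y) l else 0)" for k'
      by (cases "k' = k")
        (simp_all add: linear_linear_extension[OF qlinear_lookup[OF qlinear_ident]]
          lookup_single when_def linear_extension_delta scaleQ_rat_def)
    then show ?case
      by (simp add: tensor_coords_pure linear_linear_extension[OF qlinear_lookup[OF qlinear_ident]]
          linear_extension_delta scaleQ_rat_def tensor_lift_pure[OF bilinear])
  qed (simp add: qlinear_add[OF qlinear_tensor_coords] lookup_add tensor_lift_add[OF bilinear])
qed

lemma tensor_eqI:
  assumes "\<And>k l.
    tensor_lift (\<lambda>x y. Poly_Mapping.lookup (b.coords x) k * Poly_Mapping.lookup (c.coords y) l) s
    = tensor_lift (\<lambda>x y. Poly_Mapping.lookup (b.coords x) k * Poly_Mapping.lookup (c.coords y) l) t"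
  shows "s = t"
proof -
  have "tensor_coords s = tensor_coords t"
    using assms by (intro poly_mapping_eqI) (auto simp: lookup_tensor_coords)
  then have "linear_extension (\<lambda>(k, l). b k \<otimes> c l) (tensor_coords s)
      = linear_extension (\<lambda>(k, l). b k \<otimes> c l) (tensor_coords t)"
    by (rule arg_cong)
  then show ?thesis by (simp only: linear_extension_tensor_coords)
qed

end

section \<open>Convolution and antipodes\<close>

definition convolution ::
    "'c::rat_vector bialgebra_ops \<Rightarrow> 'a::rat_vector bialgebra_ops \<Rightarrow> ('c \<Rightarrow> 'a) \<Rightarrow> ('c \<Rightarrow> 'a) \<Rightarrow> 'c \<Rightarrow> 'a"
  where "convolution C A f g x = tensor_lift (mult A) (tensor_map f g (comult C x))"

definition convolution_unit ::
    "'c::rat_vector bialgebra_ops \<Rightarrow> 'a::rat_vector bialgebra_ops \<Rightarrow> 'c \<Rightarrow> 'a"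
  where "convolution_unit C A x = counit C x *\<^sub>Q unit A"

lemma tensor_lift_mult_assoc:
  assumes bilinear: "qbilinear (mult A)"
    and assoc: "\<And>x y z. mult A (mult A x y) z = mult A x (mult A y z)"
  shows "tensor_lift (mult A) (tensor_map (tensor_lift (mult A)) id t)
    = tensor_lift (mult A) (tensor_map id (tensor_lift (mult A)) (tensor_assoc t))"
  by (induction t rule: tensor_induct3)
    (simp_all add: bilinear assoc qlinear_tensor_lift qlinear_ident tensor_map_pure tensor_map_add
      tensor_lift_pure tensor_lift_add tensor_assoc_pure tensor_assoc_add)

lemma (in bialgebra)
  assumes f: "qlinear f"
  shows linear_counit_left: "tensor_lift (\<lambda>a b. counit A a *\<^sub>Q f b) (comult A x) = f x"
    and linear_counit_right: "tensor_lift (\<lambda>a b. counit A b *\<^sub>Q f a) (comult A x) = f x"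
proof -
  have bilinear: "qbilinear (\<lambda>a b. counit A a *\<^sub>Q b)" "qbilinear (\<lambda>a b. counit A b *\<^sub>Q a)"
    by (intro linear_intros counit_linear)+
  show "tensor_lift (\<lambda>a b. counit A a *\<^sub>Q f b) (comult A x) = f x"
    using linear_tensor_lift[OF f bilinear(1), of "comult A x"]
    by (simp add: counit_left qlinear_scaleQ[OF f])
  show "tensor_lift (\<lambda>a b. counit A b *\<^sub>Q f a) (comult A x) = f x"
    using linear_tensor_lift[OF f bilinear(2), of "comult A x"]
    by (simp add: counit_right qlinear_scaleQ[OF f])
qed

locale bialgebra_pair = C: bialgebra C + A: bialgebra A
  for C :: "'c::rat_vector bialgebra_ops" and A :: "'a::rat_vector bialgebra_ops"
begin

abbreviation convolve :: "('c \<Rightarrow> 'a) \<Rightarrow> ('c \<Rightarrow> 'a) \<Rightarrow> 'c \<Rightarrow> 'a"  (infixl \<open>\<star>\<close> 70)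
  where "f \<star> g \<equiv> convolution C A f g"

lemma qlinear_convolution:
  assumes "qlinear f" "qlinear g"
  shows "qlinear (f \<star> g)"
  unfolding convolution_def[abs_def]
  by (intro linear_intros A.mult_bilinear C.comult_linear assms)

lemma qlinear_convolution_unit: "qlinear (convolution_unit C A)"
  unfolding convolution_unit_def[abs_def] by (intro linear_intros C.counit_linear)

lemma convolution_assoc:
  assumes f: "qlinear f" and g: "qlinear g" and h: "qlinear h"
  shows "(f \<star> g) \<star> h = f \<star> (g \<star> h)"
proof
  fix x
  let ?m = "tensor_lift (mult A)"
  have lin: "qlinear ?m" "qlinear (tensor_map f g)" "qlinear (tensor_map g h)"
    by (intro linear_intros A.mult_bilinear assms)+
  have "((f \<star> g) \<star> h) x
      = ?m (tensor_map ?m id (tensor_map (tensor_map f g) h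
          (tensor_map (comult C) id (comult C x))))"
    by (simp add: convolution_def[abs_def] tensor_map_tensor_map lin C.comult_linear linear_intros
        assms)
  also have "\<dots> = ?m (tensor_map id ?m (tensor_map f (tensor_map g h)
      (tensor_assoc (tensor_map (comult C) id (comult C x)))))"
    by (simp add: tensor_lift_mult_assoc A.mult_bilinear A.mult_assoc tensor_assoc_natural assms)
  also have "\<dots> = ?m (tensor_map id ?m (tensor_map f (tensor_map g h)
      (tensor_map id (comult C) (comult C x))))"
    by (simp only: C.coassoc)
  also have "\<dots> = (f \<star> (g \<star> h)) x"
    by (simp add: convolution_def[abs_def] tensor_map_tensor_map lin C.comult_linear linear_intros
        assms)
  finally show "((f \<star> g) \<star> h) x = (f \<star> (g \<star> h)) x" .
qed

lemma convolution_unit_left: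
  assumes f: "qlinear f"
  shows "convolution_unit C A \<star> f = f"
proof
  fix x
  have "(convolution_unit C A \<star> f) x
      = tensor_lift (\<lambda>a b. mult A (counit C a *\<^sub>Q unit A) (f b)) (comult C x)"
    unfolding convolution_def convolution_unit_def[abs_def]
    by (intro tensor_lift_tensor_map linear_intros A.mult_bilinear C.counit_linear f)
  also have "\<dots> = f x"
    by (simp add: qbilinear_scaleQ_left[OF A.mult_bilinear] A.unit_left C.linear_counit_left f)
  finally show "(convolution_unit C A \<star> f) x = f x" .
qed

lemma convolution_unit_right:
  assumes f: "qlinear f"
  shows "f \<star> convolution_unit C A = f"
proof
  fix x
  have "(f \<star> convolution_unit C A) x
      = tensor_lift (\<lambda>a b. mult A (f a) (counit C b *\<^sub>Q unit A)) (comult C x)"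
    unfolding convolution_def convolution_unit_def[abs_def]
    by (intro tensor_lift_tensor_map linear_intros A.mult_bilinear C.counit_linear f)
  also have "\<dots> = f x"
    by (simp add: qbilinear_scaleQ_right[OF A.mult_bilinear] A.unit_right C.linear_counit_right f)
  finally show "(f \<star> convolution_unit C A) x = f x" .
qed

lemma convolution_inverse_unique:
  assumes "qlinear g" "qlinear f" "qlinear h"
    and "g \<star> f = convolution_unit C A" and "f \<star> h = convolution_unit C A"
  shows "g = h"
proof -
  have "g = g \<star> (f \<star> h)" unfolding assms by (simp add: convolution_unit_right assms(1))
  also have "\<dots> = (g \<star> f) \<star> h" by (rule convolution_assoc[OF assms(1-3), symmetric])
  also have "\<dots> = h" unfolding assms by (rule convolution_unit_left[OF assms(3)])
  finally show ?thesis .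
qed

end

context bialgebra
begin

sublocale endomorphisms: bialgebra_pair A A ..

lemma is_antipode_iff:
  "is_antipode A S \<longleftrightarrow> qlinear S
    \<and> convolution A A S id = convolution_unit A A \<and> convolution A A id S = convolution_unit A A"
proof (cases "qlinear S")
  case True
  then have "convolution A A S id = (\<lambda>x. tensor_lift (\<lambda>a b. mult A (S a) b) (comult A x))"
    "convolution A A id S = (\<lambda>x. tensor_lift (\<lambda>a b. mult A a (S b)) (comult A x))"
    by (simp_all add: convolution_def[abs_def] tensor_lift_tensor_map[OF mult_bilinear] qlinear_id)
  then show ?thesis
    by (simp add: is_antipode_def convolution_unit_def fun_eq_iff)
qed (simp add: is_antipode_def)

lemma antipode_eqI:
  assumes "is_antipode A S"
  shows "antipode A = S"
  unfolding antipode_def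
proof (rule the_equality)
  show "T = S" if "is_antipode A T" for T
    using that assms unfolding is_antipode_iff
    by (intro endomorphisms.convolution_inverse_unique[OF _ qlinear_id, of T S]) simp_all
qed (fact assms)

end

lemma (in hopf_algebra) is_antipode_antipode: "is_antipode A (antipode A)"
  using ex_antipode antipode_eqI by metis

section \<open>Homomorphisms of bialgebras\<close>

locale bialgebra_ops_hom =
  fixes A :: "'a::rat_vector bialgebra_ops" and B :: "'b::rat_vector bialgebra_ops"
    and \<phi> :: "'a \<Rightarrow> 'b"
  assumes hom_linear: "qlinear \<phi>"
    and hom_mult: "\<phi> (mult A x y) = mult B (\<phi> x) (\<phi> y)"
    and hom_unit: "\<phi> (unit A) = unit B"
    and hom_comult: "comult B (\<phi> x) = tensor_map \<phi> \<phi> (comult A x)"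
    and hom_counit: "counit B (\<phi> x) = counit A x"
begin

lemma hom_tensor_lift_mult:
  assumes "qbilinear (mult A)" "qbilinear (mult B)"
  shows "\<phi> (tensor_lift (mult A) t) = tensor_lift (mult B) (tensor_map \<phi> \<phi> t)"
  by (simp add: linear_tensor_lift[OF hom_linear] tensor_lift_tensor_map assms hom_linear hom_mult)

lemma hom_convolution:
  assumes "qbilinear (mult A)" "qbilinear (mult B)" "qlinear f" "qlinear g"
  shows "\<phi> (convolution C A f g x) = convolution C B (\<lambda>x. \<phi> (f x)) (\<lambda>x. \<phi> (g x)) x"
  by (simp add: convolution_def hom_tensor_lift_mult tensor_map_tensor_map assms hom_linear)

lemma convolution_hom:
  assumes "qlinear f" "qlinear g"
  shows "convolution B C f g (\<phi> x) = convolution A C (\<lambda>x. f (\<phi> x)) (\<lambda>x. g (\<phi> x)) x"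
  by (simp add: convolution_def hom_comult tensor_map_tensor_map assms hom_linear)

lemma
  shows hom_convolution_unit: "\<phi> (convolution_unit A A x) = convolution_unit A B x"
    and convolution_unit_hom: "convolution_unit B B (\<phi> x) = convolution_unit A B x"
  by (simp_all add: convolution_unit_def qlinear_scaleQ[OF hom_linear] hom_unit hom_counit)

lemma hom_antipode:
  assumes "hopf_algebra A" "hopf_algebra B"
  shows "\<phi> (antipode A x) = antipode B (\<phi> x)"
proof -
  interpret A: hopf_algebra A by fact
  interpret B: hopf_algebra B by fact
  interpret AB: bialgebra_pair A B ..
  have linear_A: "qlinear (antipode A)"
    and left_A: "convolution A A (antipode A) id = convolution_unit A A"
    using A.is_antipode_antipode by (simp_all add: A.is_antipode_iff)
  have linear_B: "qlinear (antipode B)"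
    and right_B: "convolution B B id (antipode B) = convolution_unit B B"
    using B.is_antipode_antipode by (simp_all add: B.is_antipode_iff)
  have "convolution A B (\<lambda>x. \<phi> (antipode A x)) \<phi> = convolution_unit A B"
    using hom_convolution[OF A.mult_bilinear B.mult_bilinear linear_A qlinear_id, of A]
    by (simp add: fun_eq_iff left_A hom_convolution_unit)
  moreover have "convolution A B \<phi> (\<lambda>x. antipode B (\<phi> x)) = convolution_unit A B"
    using convolution_hom[OF qlinear_id linear_B, of B]
    by (simp add: fun_eq_iff right_B convolution_unit_hom)
  ultimately have "(\<lambda>x. \<phi> (antipode A x)) = (\<lambda>x. antipode B (\<phi> x))"
    by (rule AB.convolution_inverse_unique[OF qlinear_compose[OF hom_linear linear_A] hom_linear
          qlinear_compose[OF linear_B hom_linear]])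
  then show ?thesis by (rule fun_cong)
qed

end

locale bialgebra_pullback = bialgebra_ops_hom A B \<phi> + B: bialgebra B
  for A :: "'a::rat_vector bialgebra_ops" and B :: "'b::rat_vector bialgebra_ops"
    and \<phi> :: "'a \<Rightarrow> 'b" +
  assumes hom_bij: "bij \<phi>"
begin

lemma hom_eq_iff: "\<phi> x = \<phi> y \<longleftrightarrow> x = y"
  using hom_bij by (simp add: bij_is_inj inj_eq)

lemma tensor_hom_linear: "qlinear (tensor_map \<phi> \<phi>)"
  by (intro linear_intros hom_linear)

lemma tensor_hom_bij: "bij (tensor_map \<phi> \<phi>)"
  using hom_linear hom_bij hom_linear hom_bij by (rule bij_tensor_map)

lemma tensor_hom_eq_iff: "tensor_map \<phi> \<phi> s = tensor_map \<phi> \<phi> t \<longleftrightarrow> s = t"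
  using tensor_hom_bij by (simp add: bij_is_inj inj_eq)

lemma mult_bilinear: "qbilinear (mult A)"
  by (simp add: qbilinear_def qlinear_iff hom_mult
      qlinear_add[OF hom_linear] qlinear_scaleQ[OF hom_linear]
      qbilinear_add_left[OF B.mult_bilinear] qbilinear_add_right[OF B.mult_bilinear]
      qbilinear_scaleQ_left[OF B.mult_bilinear] qbilinear_scaleQ_right[OF B.mult_bilinear]
      flip: hom_eq_iff)

lemma comult_linear: "qlinear (comult A)"
  by (simp add: qlinear_iff qlinear_add[OF hom_linear] qlinear_scaleQ[OF hom_linear]
      qlinear_add[OF tensor_hom_linear] qlinear_scaleQ[OF tensor_hom_linear]
      qlinear_add[OF B.comult_linear] qlinear_scaleQ[OF B.comult_linear]
      flip: tensor_hom_eq_iff hom_comult)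

lemma counit_linear: "qlinear (counit A)"
  using qlinear_compose[OF B.counit_linear hom_linear] by (simp add: hom_counit)

lemma coassoc:
  "tensor_assoc (tensor_map (comult A) id (comult A x)) = tensor_map id (comult A) (comult A x)"
proof -
  let ?\<phi>2 = "tensor_map \<phi> \<phi>"
  note lin = hom_linear tensor_hom_linear comult_linear B.comult_linear qlinear_id
  have "tensor_map \<phi> ?\<phi>2 (tensor_assoc (tensor_map (comult A) id (comult A x)))
      = tensor_assoc (tensor_map (\<lambda>x. comult B (\<phi> x)) \<phi> (comult A x))"
    by (simp add: tensor_assoc_natural[symmetric] tensor_map_tensor_map lin hom_comult)
  also have "\<dots> = tensor_assoc (tensor_map (comult B) id (comult B (\<phi> x)))"
    by (simp add: hom_comult[of x] tensor_map_tensor_map lin)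
  also have "\<dots> = tensor_map id (comult B) (comult B (\<phi> x))"
    by (rule B.coassoc)
  also have "\<dots> = tensor_map \<phi> (\<lambda>x. comult B (\<phi> x)) (comult A x)"
    by (simp add: hom_comult[of x] tensor_map_tensor_map lin)
  also have "\<dots> = tensor_map \<phi> ?\<phi>2 (tensor_map id (comult A) (comult A x))"
    by (simp add: tensor_map_tensor_map lin hom_comult)
  finally have "tensor_map \<phi> ?\<phi>2 (tensor_assoc (tensor_map (comult A) id (comult A x)))
      = tensor_map \<phi> ?\<phi>2 (tensor_map id (comult A) (comult A x))" .
  moreover have "inj (tensor_map \<phi> ?\<phi>2)"
    by (intro bij_is_inj bij_tensor_map hom_linear hom_bij tensor_hom_linear tensor_hom_bij)
  ultimately show ?thesis by (simp add: inj_eq)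
qed

lemma
  shows counit_left: "tensor_lift (\<lambda>a b. counit A a *\<^sub>Q b) (comult A x) = x"
    and counit_right: "tensor_lift (\<lambda>a b. counit A b *\<^sub>Q a) (comult A x) = x"
proof -
  have bilinear: "qbilinear (\<lambda>a b. counit C a *\<^sub>Q b)" "qbilinear (\<lambda>a b. counit C b *\<^sub>Q a)"
    if "qlinear (counit C)" for C :: "'c::rat_vector bialgebra_ops"
    by (intro linear_intros that)+
  have "\<phi> (tensor_lift (\<lambda>a b. counit A a *\<^sub>Q b) (comult A x))
      = tensor_lift (\<lambda>a b. counit B a *\<^sub>Q b) (comult B (\<phi> x))"
    by (simp add: linear_tensor_lift[OF hom_linear bilinear(1)[OF counit_linear]]
        hom_comult hom_counit
        tensor_lift_tensor_map[OF bilinear(1)[OF B.counit_linear] hom_linear hom_linear]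
        qlinear_scaleQ[OF hom_linear])
  then show "tensor_lift (\<lambda>a b. counit A a *\<^sub>Q b) (comult A x) = x"
    by (simp add: B.counit_left hom_eq_iff)
  have "\<phi> (tensor_lift (\<lambda>a b. counit A b *\<^sub>Q a) (comult A x))
      = tensor_lift (\<lambda>a b. counit B b *\<^sub>Q a) (comult B (\<phi> x))"
    by (simp add: linear_tensor_lift[OF hom_linear bilinear(2)[OF counit_linear]]
        hom_comult hom_counit
        tensor_lift_tensor_map[OF bilinear(2)[OF B.counit_linear] hom_linear hom_linear]
        qlinear_scaleQ[OF hom_linear])
  then show "tensor_lift (\<lambda>a b. counit A b *\<^sub>Q a) (comult A x) = x"
    by (simp add: B.counit_right hom_eq_iff)
qed

lemma hom_tensor_mult:
  "tensor_map \<phi> \<phi> (tensor_mult A s t) = tensor_mult B (tensor_map \<phi> \<phi> s) (tensor_map \<phi> \<phi> t)"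
proof (induction s)
  case (pure x y)
  show ?case
    by (induction t) (simp_all add: tensor_mult_pure mult_bilinear B.mult_bilinear tensor_map_pure
        hom_linear hom_mult qbilinear_add_right[OF qbilinear_tensor_mult] tensor_map_add)
qed (simp add: mult_bilinear B.mult_bilinear hom_linear tensor_map_add
    qbilinear_add_left[OF qbilinear_tensor_mult])

sublocale A: bialgebra A
proof (rule bialgebra.intro)
  fix x y z
  show "mult A (mult A x y) z = mult A x (mult A y z)"
    by (simp add: hom_mult B.mult_assoc flip: hom_eq_iff)
  show "mult A (unit A) x = x" "mult A x (unit A) = x"
    by (simp_all add: hom_mult hom_unit B.unit_left B.unit_right flip: hom_eq_iff)
  show "comult A (mult A x y) = tensor_mult A (comult A x) (comult A y)"
    by (simp add: hom_tensor_mult hom_mult B.comult_mult flip: tensor_hom_eq_iff hom_comult)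
  show "comult A (unit A) = unit A \<otimes> unit A"
    by (simp add: hom_unit B.comult_unit tensor_map_pure hom_linear
        flip: tensor_hom_eq_iff hom_comult)
  show "counit A (mult A x y) = counit A x * counit A y"
    by (simp add: hom_mult B.counit_mult flip: hom_counit)
  show "counit A (unit A) = 1"
    by (simp add: hom_unit B.counit_unit flip: hom_counit)
qed (fact mult_bilinear comult_linear counit_linear coassoc counit_left counit_right)+

lemma is_antipode_pullback:
  assumes "is_antipode B S"
  shows "is_antipode A (\<lambda>x. inv \<phi> (S (\<phi> x)))"
proof -
  let ?S = "\<lambda>x. inv \<phi> (S (\<phi> x))"
  have S: "qlinear S" "convolution B B S id = convolution_unit B B"
    "convolution B B id S = convolution_unit B B"
    using assms by (simp_all add: B.is_antipode_iff)
  have linear: "qlinear ?S"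
    by (rule qlinear_compose[OF qlinear_inv[OF hom_linear hom_bij]
          qlinear_compose[OF S(1) hom_linear]])
  have \<phi>_S: "\<phi> (?S x) = S (\<phi> x)" for x
    using hom_bij by (simp add: bij_is_surj surj_f_inv_f)
  have "\<phi> (convolution A A ?S id x) = \<phi> (convolution_unit A A x)"
    "\<phi> (convolution A A id ?S x) = \<phi> (convolution_unit A A x)" for x
    using convolution_hom[OF S(1) qlinear_id, of B x] convolution_hom[OF qlinear_id S(1), of B x]
    by (simp_all add: hom_convolution[OF mult_bilinear B.mult_bilinear] linear linear_intros
        \<phi>_S S(2,3) hom_convolution_unit convolution_unit_hom)
  then show ?thesis
    using linear by (simp add: A.is_antipode_iff hom_eq_iff fun_eq_iff)
qed

lemma hopf_algebra_iso:
  assumes "hopf_algebra B"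
  shows "hopf_algebra_iso A B \<phi>"
proof -
  interpret B: hopf_algebra B by fact
  have A: "hopf_algebra A"
    using is_antipode_pullback B.is_antipode_antipode by unfold_locales blast
  show ?thesis
    by (intro hopf_algebra_iso.intro hopf_algebra_hom.intro hopf_algebra_hom_axioms.intro
        hopf_algebra_iso_axioms.intro A assms hom_linear hom_mult hom_unit hom_comult hom_counit
        hom_antipode hom_bij)
qed

end

section \<open>Monomials, words and compositions\<close>

definition support :: "monomial \<Rightarrow> nat list"
  where "support m = sorted_list_of_set (Poly_Mapping.keys m)"

definition word_of :: "monomial \<Rightarrow> nat list"
  where "word_of m = concat (List.map (\<lambda>i. replicate (Poly_Mapping.lookup m i) i) (support m))"

lemma set_support [simp]: "set (support m) = Poly_Mapping.keys m"
  and strict_sorted_support: "sorted_wrt (<) (support m)"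
  and distinct_support: "distinct (support m)"
  by (simp_all add: support_def)

lemma word_monomial_append: "word_monomial (xs @ ys) = word_monomial xs + word_monomial ys"
  by (simp add: word_monomial_def)

lemma word_monomial_replicate: "word_monomial (replicate a i) = Poly_Mapping.single i a"
  by (induction a) (simp_all add: word_monomial_def flip: single_add)

lemma lookup_word_monomial: "Poly_Mapping.lookup (word_monomial xs) i = count (mset xs) i"
  by (induction xs) (simp_all add: word_monomial_def lookup_add lookup_single when_def)

lemma word_monomial_eq_iff: "word_monomial xs = word_monomial ys \<longleftrightarrow> mset xs = mset ys"
  by (simp add: poly_mapping_eq_iff fun_eq_iff lookup_word_monomial multiset_eq_iff)

lemma word_monomial_word_of [simp]: "word_monomial (word_of m) = m"
proof -
  have "word_monomial (concat (List.map (\<lambda>i. replicate (f i) i) xs))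
      = (\<Sum>i\<leftarrow>xs. Poly_Mapping.single i (f i))" for f xs
    by (induction xs)
      (simp_all add: word_monomial_append word_monomial_replicate, simp add: word_monomial_def)
  then show ?thesis
    by (simp add: word_of_def sum_list_distinct_conv_sum_set distinct_support sum_single_lookup)
qed

lemma set_word_of [simp]: "set (word_of m) = Poly_Mapping.keys m"
  using keys_word_monomial[of "word_of m"] by simp

lemma length_word_of [simp]: "length (word_of m) = total_degree m"
  using total_degree_word[of "word_of m"] by simp

lemma sorted_concat_replicate: "sorted xs \<Longrightarrow> sorted (concat (List.map (\<lambda>i. replicate (f i) i) xs))"
  by (induction xs) (auto simp: sorted_append)

lemma sorted_word_of: "sorted (word_of m)"
  unfolding word_of_def using strict_sorted_support strict_sorted_imp_sorted
  by (blast intro: sorted_concat_replicate)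

lemma eq_word_of_iff: "xs = word_of m \<longleftrightarrow> sorted xs \<and> word_monomial xs = m"
proof
  assume "sorted xs \<and> word_monomial xs = m"
  then have "sorted xs" "mset xs = mset (word_of m)" by (auto simp flip: word_monomial_eq_iff)
  then show "xs = word_of m"
    using sorted_word_of by (metis properties_for_sort)
qed (simp add: sorted_word_of)

lemma total_degree_eq_0_iff: "total_degree m = 0 \<longleftrightarrow> m = 0"
  using eq_word_of_iff[of "[]" m] by (auto simp: word_monomial_def simp flip: length_word_of)

lemma finite_monomial_sums: "finite {(a, b). a + b = (m :: monomial)}"
proof (rule finite_subset)
  let ?A = "word_monomial ` {xs. set xs \<subseteq> Poly_Mapping.keys m \<and> length xs \<le> total_degree m}"
  show "finite (?A \<times> ?A)"
    by (intro finite_cartesian_product finite_imageI finite_lists_length_le) simp_all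
  have "a \<in> ?A"
    if "Poly_Mapping.keys a \<subseteq> Poly_Mapping.keys m" "total_degree a \<le> total_degree m" for a
    using that by (intro image_eqI[of _ _ "word_of a"]) simp_all
  then show "{(a, b). a + b = m} \<subseteq> ?A \<times> ?A"
    by (auto simp: keys_plus_monomial total_degree_add)
qed

definition comp_of :: "monomial \<Rightarrow> composition"
  where "comp_of m = Composition (List.map (Poly_Mapping.lookup m) (support m))"

lemma parts_comp_of: "parts (comp_of m) = List.map (Poly_Mapping.lookup m) (support m)"
  unfolding comp_of_def by (rule Composition_inverse) (auto simp: in_keys_iff)

lemma length_support: "length (support m) = length (parts (comp_of m))"
  by (simp add: parts_comp_of)

lemma parts_pos: "a \<in> set (parts \<alpha>) \<Longrightarrow> 0 < a"
  using parts[of \<alpha>] by auto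

lemma power_monomial_comp_of: "power_monomial (support m) (parts (comp_of m)) = m"
proof -
  have "power_monomial xs (List.map (Poly_Mapping.lookup m) xs)
      = (\<Sum>i\<leftarrow>xs. Poly_Mapping.single i (Poly_Mapping.lookup m i))" for xs
    by (induction xs) auto
  then show ?thesis
    by (simp add: parts_comp_of sum_list_distinct_conv_sum_set distinct_support sum_single_lookup)
qed

lemma power_monomial_append:
  "length is = length as
    \<Longrightarrow> power_monomial (is @ js) (as @ bs) = power_monomial is as + power_monomial js bs"
  by (simp add: power_monomial_def)

lemma lookup_power_monomial:
  assumes "length is = length as" "distinct is"
  shows "List.map (Poly_Mapping.lookup (power_monomial is as)) is = as"
  using assms
proof (induction "is" as rule: list_induct2)
  case (Cons i "is" a as)
  have "Poly_Mapping.lookup (power_monomial is as) i = 0"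
    using Cons.prems keys_power_monomial_subset[of "is" as] by (auto simp: in_keys_iff)
  moreover have "List.map (Poly_Mapping.lookup (power_monomial (i # is) (a # as))) is
      = List.map (Poly_Mapping.lookup (power_monomial is as)) is"
    using Cons.prems by (auto simp: lookup_add lookup_single when_def)
  ultimately show ?case using Cons by (simp add: lookup_add[of _ _ i] del: map_eq_conv)
qed simp

lemma comp_of_power_monomial:
  assumes "sorted_wrt (<) is" "length is = length (parts \<alpha>)"
  shows "comp_of (power_monomial is (parts \<alpha>)) = \<alpha>"
proof -
  have "sorted is" "distinct is" using assms(1) by (simp_all add: strict_sorted_iff)
  moreover have "Poly_Mapping.keys (power_monomial is (parts \<alpha>)) = set is"
    using assms(2) parts_pos by (simp add: keys_power_monomial)
  ultimately show ?thesis
    using assms(2) by (simp add: comp_of_def support_def sorted_list_of_set.idem_if_sorted_distinct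
        lookup_power_monomial parts_inverse)
qed

lemma total_degree_comp_of: "total_degree m = sum_list (parts (comp_of m))"
  using total_degree_power[OF length_support] by (simp add: power_monomial_comp_of)

definition std_monomial :: "composition \<Rightarrow> monomial"
  where "std_monomial \<alpha> = power_monomial [0..<length (parts \<alpha>)] (parts \<alpha>)"

lemma comp_of_std_monomial [simp]: "comp_of (std_monomial \<alpha>) = \<alpha>"
  unfolding std_monomial_def by (rule comp_of_power_monomial) simp_all

lift_definition comp_empty :: composition is "[]" by simp

lift_definition comp_take :: "nat \<Rightarrow> composition \<Rightarrow> composition" is take
  by (auto dest: in_set_takeD)

lift_definition comp_drop :: "nat \<Rightarrow> composition \<Rightarrow> composition" is drop
  by (auto dest: in_set_dropD)

lemma comp_take_0 [simp]: "comp_take 0 \<alpha> = comp_empty"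
  and comp_drop_0 [simp]: "comp_drop 0 \<alpha> = \<alpha>"
  by (transfer; simp)+

lemma comp_take_all [simp]: "length (parts \<alpha>) \<le> i \<Longrightarrow> comp_take i \<alpha> = \<alpha>"
  and comp_drop_all [simp]: "length (parts \<alpha>) \<le> i \<Longrightarrow> comp_drop i \<alpha> = comp_empty"
  by (transfer; simp)+

lemma parts_eq_Nil_iff: "parts \<alpha> = [] \<longleftrightarrow> \<alpha> = comp_empty"
  by transfer simp

lemma comp_of_eq_empty_iff: "comp_of m = comp_empty \<longleftrightarrow> m = 0"
  using total_degree_eq_0_iff[of m]
  by (auto simp: parts_comp_of support_def simp flip: parts_eq_Nil_iff)

lemma comp_append_assoc: "comp_append (comp_append \<alpha> \<beta>) \<gamma> = comp_append \<alpha> (comp_append \<beta> \<gamma>)"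
  by transfer simp

lemma bij_betw_comp_append:
  "bij_betw (\<lambda>i. (comp_take i \<alpha>, comp_drop i \<alpha>)) {..length (parts \<alpha>)} {(\<beta>, \<gamma>). comp_append \<beta> \<gamma> = \<alpha>}"
proof (rule bij_betw_byWitness[where f' = "\<lambda>(\<beta>, \<gamma>). length (parts \<beta>)"])
  show "\<forall>i\<in>{..length (parts \<alpha>)}.
      (case (comp_take i \<alpha>, comp_drop i \<alpha>) of (\<beta>, \<gamma>) \<Rightarrow> length (parts \<beta>)) = i"
    by (simp add: comp_take.rep_eq)
  show "\<forall>p\<in>{(\<beta>, \<gamma>). comp_append \<beta> \<gamma> = \<alpha>}.
      (comp_take (case p of (\<beta>, \<gamma>) \<Rightarrow> length (parts \<beta>)) \<alpha>,
       comp_drop (case p of (\<beta>, \<gamma>) \<Rightarrow> length (parts \<beta>)) \<alpha>) = p"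
    by (auto simp: comp_take.rep_eq comp_drop.rep_eq comp_append.rep_eq
        simp flip: parts_inject dest: sym)
  show "(\<lambda>i. (comp_take i \<alpha>, comp_drop i \<alpha>)) ` {..length (parts \<alpha>)} \<subseteq> {(\<beta>, \<gamma>). comp_append \<beta> \<gamma> = \<alpha>}"
    by (auto simp: comp_take.rep_eq comp_drop.rep_eq comp_append.rep_eq simp flip: parts_inject)
  show "(\<lambda>(\<beta>, \<gamma>). length (parts \<beta>)) ` {(\<beta>, \<gamma>). comp_append \<beta> \<gamma> = \<alpha>} \<subseteq> {..length (parts \<alpha>)}"
    by (auto simp: comp_append.rep_eq)
qed

lemma finite_comp_append: "finite {(\<beta>, \<gamma>). comp_append \<beta> \<gamma> = \<alpha>}"
  using bij_betw_finite[OF bij_betw_comp_append[of \<alpha>]] by simp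

lemma sum_comp_append:
  "(\<Sum>(\<beta>, \<gamma>) | comp_append \<beta> \<gamma> = \<alpha>. h \<beta> \<gamma>)
    = (\<Sum>i\<le>length (parts \<alpha>). h (comp_take i \<alpha>) (comp_drop i \<alpha>))"
  using sum.reindex_bij_betw[OF bij_betw_comp_append[of \<alpha>], of "\<lambda>(\<beta>, \<gamma>). h \<beta> \<gamma>"] by simp

lemma finite_compositions_le: "finite {\<alpha>. sum_list (parts \<alpha>) \<le> d}"
proof (rule finite_subset)
  show "finite (Composition ` {as. set as \<subseteq> {..d} \<and> length as \<le> d})"
    by (intro finite_imageI finite_lists_length_le) simp
  have length: "length as \<le> sum_list as" if "\<forall>a\<in>set as. 0 < a" for as :: "nat list"
    using that by (induction as) auto
  show "{\<alpha>. sum_list (parts \<alpha>) \<le> d} \<subseteq> Composition ` {as. set as \<subseteq> {..d} \<and> length as \<le> d}"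
  proof
    fix \<alpha> assume "\<alpha> \<in> {\<alpha>. sum_list (parts \<alpha>) \<le> d}"
    then have "set (parts \<alpha>) \<subseteq> {..d}" "length (parts \<alpha>) \<le> d"
      using member_le_sum_list[of _ "parts \<alpha>"] length[of "parts \<alpha>"] parts_pos[of _ \<alpha>]
      by (auto intro: order_trans)
    then show "\<alpha> \<in> Composition ` {as. set as \<subseteq> {..d} \<and> length as \<le> d}"
      by (intro image_eqI[of _ _ "parts \<alpha>"]) (auto simp: parts_inverse)
  qed
qed

section \<open>The monomial basis\<close>

lemma qsym_eqI: "(\<And>m. coeff_of f m = coeff_of g m) \<Longrightarrow> f = g"
  by (simp add: coeff_of_inject[symmetric] fun_eq_iff)

lemma qlinear_coeff_of: "qlinear (\<lambda>f. coeff_of f m)"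
  unfolding qlinear_iff by (simp add: plus_qsym.rep_eq scaleQ_qsym.rep_eq scaleQ_rat_def)

lemmas [linear_intros] = qlinear_compose[OF qlinear_coeff_of]

lemmas coeff_of_add = qlinear_add[OF qlinear_coeff_of]
  and coeff_of_sum = qlinear_sum[OF qlinear_coeff_of]
  and coeff_of_linear_extension = linear_linear_extension[OF qlinear_coeff_of]

lemma coeff_of_scaleQ: "coeff_of (c *\<^sub>Q f) m = c * coeff_of f m"
  by (rule scaleQ_qsym.rep_eq[THEN fun_cong])

lemma coeff_of_comp_of: "coeff_of f m = coeff_of f (std_monomial (comp_of m))"
proof -
  have "coeff_of f (power_monomial (support m) (parts (comp_of m)))
      = coeff_of f (std_monomial (comp_of m))"
    unfolding std_monomial_def using coeff_of[of f] strict_sorted_support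
    by (intro quasisymmetricD) (auto simp: length_support)
  then show ?thesis by (simp add: power_monomial_comp_of)
qed

lemma coeff_of_M_qsym: "coeff_of (M_qsym \<alpha>) m = (if \<alpha> = comp_of m then 1 else 0)"
proof -
  have "(\<exists>is. sorted_wrt (<) is \<and> length is = length (parts \<alpha>) \<and> power_monomial is (parts \<alpha>) = m)
      \<longleftrightarrow> \<alpha> = comp_of m"
    using comp_of_power_monomial power_monomial_comp_of[of m] strict_sorted_support length_support
    by metis
  then show ?thesis by (simp add: M_qsym.rep_eq)
qed

lift_definition std_coeffs :: "qsym \<Rightarrow> composition \<Rightarrow>\<^sub>0 rat" is "\<lambda>f \<alpha>. f (std_monomial \<alpha>)"
proof -
  fix f :: "monomial \<Rightarrow> rat" assume "bounded_degree f \<and> quasisymmetric f"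
  then obtain d where "\<And>m. f m \<noteq> 0 \<Longrightarrow> total_degree m \<le> d" unfolding bounded_degree_def by blast
  then have "{\<alpha>. f (std_monomial \<alpha>) \<noteq> 0} \<subseteq> {\<alpha>. sum_list (parts \<alpha>) \<le> d}"
    by (force simp: total_degree_comp_of)
  then show "finite {\<alpha>. f (std_monomial \<alpha>) \<noteq> 0}"
    using finite_compositions_le by (rule finite_subset)
qed

lemma coeff_of_linear_extension_M:
  "coeff_of (linear_extension M_qsym v) m = Poly_Mapping.lookup v (comp_of m)"
  by (simp add: coeff_of_linear_extension coeff_of_M_qsym linear_extension_delta scaleQ_rat_def)

global_interpretation M: qbasis M_qsym
proof
  show "bij (linear_extension M_qsym)"
  proof (rule o_bij[where g = std_coeffs])
    show "std_coeffs \<circ> linear_extension M_qsym = id"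
      by (auto intro!: poly_mapping_eqI simp: std_coeffs.rep_eq coeff_of_linear_extension_M)
    show "linear_extension M_qsym \<circ> std_coeffs = id"
      by (auto intro!: qsym_eqI simp: coeff_of_linear_extension_M std_coeffs.rep_eq
          simp flip: coeff_of_comp_of)
  qed
qed

lemma lookup_M_coords: "Poly_Mapping.lookup (M.coords f) \<alpha> = coeff_of f (std_monomial \<alpha>)"
  using coeff_of_linear_extension_M[of "M.coords f" "std_monomial \<alpha>"] by simp

interpretation M_pair: qbasis_pair M_qsym M_qsym ..

definition tensor_coeff :: "monomial \<Rightarrow> monomial \<Rightarrow> (qsym, qsym) tensor \<Rightarrow> rat"
  where "tensor_coeff a b = tensor_lift (\<lambda>f g. coeff_of f a * coeff_of g b)"

lemma
  shows qlinear_tensor_coeff: "qlinear (tensor_coeff a b)"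
    and tensor_coeff_pure: "tensor_coeff a b (f \<otimes> g) = coeff_of f a * coeff_of g b"
proof -
  have "qbilinear (\<lambda>f g. coeff_of f a * coeff_of g b)"
    by (intro linear_intros)
  then show "qlinear (tensor_coeff a b)" "tensor_coeff a b (f \<otimes> g) = coeff_of f a * coeff_of g b"
    unfolding tensor_coeff_def by (simp_all add: qlinear_tensor_lift tensor_lift_pure)
qed

lemmas [linear_intros] = qlinear_compose[OF qlinear_tensor_coeff]

lemma tensor_qsym_eqI:
  assumes "\<And>a b. tensor_coeff a b s = tensor_coeff a b t"
  shows "s = t"
  using assms by (intro M_pair.tensor_eqI) (simp add: lookup_M_coords tensor_coeff_def)

section \<open>The Hopf algebra of quasisymmetric functions\<close>

lemma QSym_simps [simp]:
  "mult QSym = qsym_mult" "unit QSym = qsym_one" "comult QSym = qsym_comult"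
  "counit QSym = (\<lambda>f. coeff_of f 0)"
  by (simp_all add: QSym_def)

lemma sum_factor_assoc:
  assumes fin: "\<And>x. finite {(a, b). f a b = x}" and assoc: "\<And>a b c. f (f a b) c = f a (f b c)"
  shows "(\<Sum>(d, c) | f d c = x. \<Sum>(a, b) | f a b = d. h a b c)
    = (\<Sum>(a, d) | f a d = x. \<Sum>(b, c) | f b c = d. h a b c)"
proof -
  have finite_fibre: "finite {p. f (fst p) (snd p) = x}" for x
    using fin[of x] by (simp add: case_prod_unfold)
  show ?thesis
    unfolding case_prod_unfold
    by (subst (1 2) sum.Sigma, simp_all add: finite_fibre,
        rule sum.reindex_bij_witness[where i = "\<lambda>((a, d), (b, c)). ((f a b, c), (a, b))"
          and j = "\<lambda>((d, c), (a, b)). ((a, f b c), (b, c))"])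
      (auto simp: assoc)
qed

lemma qbilinear_qsym_mult: "qbilinear qsym_mult"
  unfolding qbilinear_def qlinear_iff
  by (auto intro!: qsym_eqI simp: qsym_mult.rep_eq coeff_of_add coeff_of_scaleQ algebra_simps
      case_prod_unfold sum.distrib sum_distrib_left)

lemmas [linear_intros] =
  qbilinear_left[OF qbilinear_qsym_mult] qbilinear_right[OF qbilinear_qsym_mult]

lemma qsym_mult_assoc: "qsym_mult (qsym_mult f g) h = qsym_mult f (qsym_mult g h)"
proof (rule qsym_eqI)
  fix m
  let ?t = "\<lambda>a b c. coeff_of f a * coeff_of g b * coeff_of h c"
  have "coeff_of (qsym_mult (qsym_mult f g) h) m
      = (\<Sum>(d, c) | d + c = m. \<Sum>(a, b) | a + b = d. ?t a b c)"
    by (simp add: qsym_mult.rep_eq sum_distrib_right case_prod_unfold)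
  also have "\<dots> = (\<Sum>(a, d) | a + d = m. \<Sum>(b, c) | b + c = d. ?t a b c)"
    by (rule sum_factor_assoc[OF finite_monomial_sums add.assoc])
  also have "\<dots> = coeff_of (qsym_mult f (qsym_mult g h)) m"
    by (simp add: qsym_mult.rep_eq sum_distrib_left case_prod_unfold mult.assoc)
  finally show "coeff_of (qsym_mult (qsym_mult f g) h) m
      = coeff_of (qsym_mult f (qsym_mult g h)) m" .
qed

lemma qsym_mult_commute: "qsym_mult f g = qsym_mult g f"
  by (rule qsym_eqI, unfold qsym_mult.rep_eq,
      rule sum.reindex_bij_witness[where i = "\<lambda>(a, b). (b, a)" and j = "\<lambda>(a, b). (b, a)"])
    (auto simp: add.commute)

lemma qsym_mult_one_left: "qsym_mult qsym_one f = f"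
proof (rule qsym_eqI)
  fix m
  have "coeff_of (qsym_mult qsym_one f) m
      = (\<Sum>p | fst p + snd p = m. if p = (0, m) then coeff_of f m else 0)"
    by (auto simp: qsym_mult.rep_eq qsym_one.rep_eq intro!: sum.cong)
  then show "coeff_of (qsym_mult qsym_one f) m = coeff_of f m"
    using finite_monomial_sums[of m] by (simp add: case_prod_unfold)
qed

lemma qsym_mult_one_right: "qsym_mult f qsym_one = f"
  using qsym_mult_one_left qsym_mult_commute by metis

lemma qsym_one_eq_M_empty: "qsym_one = M_qsym comp_empty"
proof (rule qsym_eqI)
  show "coeff_of qsym_one m = coeff_of (M_qsym comp_empty) m" for m
    using comp_of_eq_empty_iff[of m] by (auto simp: qsym_one.rep_eq coeff_of_M_qsym)
qed

lemma
  shows qlinear_qsym_comult: "qlinear qsym_comult"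
    and qsym_comult_M: "qsym_comult (M_qsym \<alpha>)
      = (\<Sum>(\<beta>, \<gamma>) | comp_append \<beta> \<gamma> = \<alpha>. M_qsym \<beta> \<otimes> M_qsym \<gamma>)"
proof -
  have "qlinear qsym_comult \<and> (\<forall>\<alpha>. qsym_comult (M_qsym \<alpha>)
      = (\<Sum>(\<beta>, \<gamma>) | comp_append \<beta> \<gamma> = \<alpha>. M_qsym \<beta> \<otimes> M_qsym \<gamma>))"
    unfolding qsym_comult_def by (rule theI'[OF M.ex1_linear])
  then show "qlinear qsym_comult" "qsym_comult (M_qsym \<alpha>)
      = (\<Sum>(\<beta>, \<gamma>) | comp_append \<beta> \<gamma> = \<alpha>. M_qsym \<beta> \<otimes> M_qsym \<gamma>)"
    by simp_all
qed

lemmas [linear_intros] = qlinear_compose[OF qlinear_qsym_comult]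

definition glue :: "nat \<Rightarrow> monomial \<Rightarrow> monomial \<Rightarrow> monomial"
  where "glue N a b = a + relabel (\<lambda>i. i + N) b"

lemma glue_add: "glue N (a + a') (b + b') = glue N a b + glue N a' b'"
  by (simp add: glue_def relabel_add add_ac)

lemma word_of_glue:
  assumes "Poly_Mapping.keys a \<subseteq> {..<N}"
  shows "word_of (glue N a b) = word_of a @ List.map (\<lambda>i. i + N) (word_of b)"
proof (rule sym, unfold eq_word_of_iff, intro conjI)
  show "sorted (word_of a @ List.map (\<lambda>i. i + N) (word_of b))"
    using assms sorted_word_of[of a] sorted_word_of[of b]
    by (auto simp: sorted_append sorted_map trans_le_add2 less_imp_le)
  show "word_monomial (word_of a @ List.map (\<lambda>i. i + N) (word_of b)) = glue N a b"
    by (simp add: word_monomial_append glue_def flip: relabel_word)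
qed

lemma glue_eq_iff:
  assumes "Poly_Mapping.keys a \<subseteq> {..<N}" "Poly_Mapping.keys a' \<subseteq> {..<N}"
  shows "glue N a b = glue N a' b' \<longleftrightarrow> a = a' \<and> b = b'"
proof
  assume "glue N a b = glue N a' b'"
  then have words: "word_of a @ List.map (\<lambda>i. i + N) (word_of b)
      = word_of a' @ List.map (\<lambda>i. i + N) (word_of b')"
    by (metis assms word_of_glue)
  have low: "filter (\<lambda>i. i < N) (word_of c @ List.map (\<lambda>i. i + N) w) = word_of c"
    if "Poly_Mapping.keys c \<subseteq> {..<N}" for c w
    using that by (auto simp: filter_id_conv filter_empty_conv)
  have "word_of a = word_of a'"
    using arg_cong[OF words, of "filter (\<lambda>i. i < N)"] by (simp only: low assms)
  moreover from this words have "word_of b = word_of b'"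
    by (simp add: inj_map_eq_map inj_def)
  ultimately show "a = a' \<and> b = b'" by (metis word_monomial_word_of)
qed simp

lemma ex_glue: "\<exists>a b. Poly_Mapping.keys a \<subseteq> {..<N} \<and> m = glue N a b"
proof -
  have "\<exists>a b. Poly_Mapping.keys a \<subseteq> {..<N} \<and> word_monomial xs = glue N a b" for xs
  proof (induction xs)
    case Nil
    show ?case by (intro exI[of _ 0]) (simp add: word_monomial_def glue_def)
  next
    case (Cons i xs)
    then obtain a b where ab: "Poly_Mapping.keys a \<subseteq> {..<N}" "word_monomial xs = glue N a b"
      by blast
    show ?case
    proof (cases "i < N")
      case True
      then have "Poly_Mapping.keys (Poly_Mapping.single i 1 + a) \<subseteq> {..<N}"
        "word_monomial (i # xs) = glue N (Poly_Mapping.single i 1 + a) b"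
        using ab by (simp_all add: keys_plus_monomial word_monomial_def glue_def add_ac)
      then show ?thesis by blast
    next
      case False
      then have "word_monomial (i # xs) = glue N a (Poly_Mapping.single (i - N) 1 + b)"
        using ab by (simp add: word_monomial_def glue_def relabel_add add_ac)
      with ab(1) show ?thesis by blast
    qed
  qed
  from this[of "word_of m"] show ?thesis by simp
qed

lemma comp_of_glue:
  assumes "Poly_Mapping.keys a \<subseteq> {..<N}"
  shows "comp_of (glue N a b) = comp_append (comp_of a) (comp_of b)"
proof -
  let ?is = "support a @ List.map (\<lambda>i. i + N) (support b)"
  let ?\<alpha> = "comp_append (comp_of a) (comp_of b)"
  have "glue N a b = power_monomial ?is (parts ?\<alpha>)"
    by (simp add: glue_def comp_append.rep_eq power_monomial_append length_support
        power_monomial_comp_of flip: relabel_power)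
  moreover have "sorted_wrt (<) ?is"
    using assms strict_sorted_support[of a] strict_sorted_support[of b]
    by (auto simp: sorted_wrt_append sorted_wrt_map trans_less_add2)
  then have "comp_of (power_monomial ?is (parts ?\<alpha>)) = ?\<alpha>"
    by (rule comp_of_power_monomial) (simp add: comp_append.rep_eq length_support)
  ultimately show ?thesis by simp
qed

lemma ex_keys_bound: "\<exists>N. Poly_Mapping.keys (m :: monomial) \<subseteq> {..<N}"
  using finite_keys[of m] by (auto simp: finite_nat_set_iff_bounded)

text \<open>The coproduct is the substitution \<open>f(x) \<mapsto> f(x, y)\<close>: its coefficient at \<open>x\<^sup>a y\<^sup>b\<close> is read off
  after placing the variables \<open>y\<close> behind all the variables that occur in \<open>x\<^sup>a\<close>.\<close>

lemma tensor_coeff_qsym_comult: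
  assumes "Poly_Mapping.keys a \<subseteq> {..<N}"
  shows "tensor_coeff a b (qsym_comult f) = coeff_of f (glue N a b)"
proof (rule M.linear_eqI[where x = f])
  fix \<alpha>
  have "tensor_coeff a b (qsym_comult (M_qsym \<alpha>))
      = (\<Sum>p | comp_append (fst p) (snd p) = \<alpha>. if p = (comp_of a, comp_of b) then 1 else 0)"
    by (auto simp: qsym_comult_M qlinear_sum[OF qlinear_tensor_coeff] case_prod_unfold
        tensor_coeff_pure coeff_of_M_qsym prod_eq_iff intro!: sum.cong)
  also have "\<dots> = coeff_of (M_qsym \<alpha>) (glue N a b)"
    using finite_comp_append[of \<alpha>]
    by (auto simp: case_prod_unfold coeff_of_M_qsym comp_of_glue[OF assms])
  finally show "tensor_coeff a b (qsym_comult (M_qsym \<alpha>)) = coeff_of (M_qsym \<alpha>) (glue N a b)" .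
qed (intro linear_intros)+

lemma sum_glue:
  assumes "Poly_Mapping.keys a \<subseteq> {..<N}"
  shows "(\<Sum>(m, m') | m + m' = glue N a b. h m m')
    = (\<Sum>(a1, a2) | a1 + a2 = a. \<Sum>(b1, b2) | b1 + b2 = b. h (glue N a1 b1) (glue N a2 b2))"
proof -
  let ?glue2 = "\<lambda>((a1, a2), (b1, b2)). (glue N a1 b1, glue N a2 b2)"
  let ?AB = "{(a1, a2). a1 + a2 = a} \<times> {(b1, b2). b1 + b2 = b}"
  have keys: "Poly_Mapping.keys a1 \<subseteq> {..<N}" "Poly_Mapping.keys a2 \<subseteq> {..<N}"
    if "a1 + a2 = a" for a1 a2
    using assms by (auto simp: keys_plus_monomial simp flip: that)
  have "bij_betw ?glue2 ?AB {(m, m'). m + m' = glue N a b}"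
  proof (rule bij_betw_imageI)
    show "inj_on ?glue2 ?AB"
      by (rule inj_onI) (auto simp: glue_eq_iff keys)
    have "(m, m') \<in> ?glue2 ` ?AB" if "m + m' = glue N a b" for m m'
    proof -
      obtain a1 b1 a2 b2 where glue: "m = glue N a1 b1" "m' = glue N a2 b2"
        and "Poly_Mapping.keys a1 \<subseteq> {..<N}" "Poly_Mapping.keys a2 \<subseteq> {..<N}"
        using ex_glue by metis
      then have "a1 + a2 = a" "b1 + b2 = b"
        using that assms glue_eq_iff[of "a1 + a2" N a]
        by (auto simp: keys_plus_monomial simp flip: glue_add)
      then show ?thesis unfolding glue by force
    qed
    then show "?glue2 ` ?AB = {(m, m'). m + m' = glue N a b}"
      by (auto simp flip: glue_add)
  qed
  from sum.reindex_bij_betw[OF this, of "\<lambda>(m, m'). h m m'"] show ?thesis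
    by (simp add: sum.cartesian_product case_prod_unfold)
qed

lemma tensor_coeff_tensor_mult:
  "tensor_coeff a b (tensor_mult QSym s t)
    = (\<Sum>(a1, a2) | a1 + a2 = a. \<Sum>(b1, b2) | b1 + b2 = b.
        tensor_coeff a1 b1 s * tensor_coeff a2 b2 t)"
proof -
  have bilinear: "qbilinear (mult QSym)" by (simp add: qbilinear_qsym_mult)
  note additive = qlinear_add[OF qlinear_tensor_coeff]
    qbilinear_add_left[OF qbilinear_tensor_mult[OF bilinear]]
    qbilinear_add_right[OF qbilinear_tensor_mult[OF bilinear]]
  show ?thesis
  proof (induction s)
    case (pure f g)
    show ?case
    proof (induction t)
      case (pure f' g')
      show ?case
        unfolding tensor_mult_pure[OF bilinear] tensor_coeff_pure
        by (simp add: qsym_mult.rep_eq sum_product case_prod_unfold mult_ac)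
    qed (simp add: additive case_prod_unfold algebra_simps sum.distrib)
  qed (simp add: additive case_prod_unfold algebra_simps sum.distrib)
qed

lemma qsym_comult_mult:
  "qsym_comult (qsym_mult f g) = tensor_mult QSym (qsym_comult f) (qsym_comult g)"
proof (rule tensor_qsym_eqI)
  fix a b :: monomial
  obtain N where N: "Poly_Mapping.keys a \<subseteq> {..<N}" using ex_keys_bound by blast
  have "tensor_coeff a b (qsym_comult (qsym_mult f g))
      = (\<Sum>(m, m') | m + m' = glue N a b. coeff_of f m * coeff_of g m')"
    by (simp add: tensor_coeff_qsym_comult[OF N] qsym_mult.rep_eq)
  also have "\<dots> = (\<Sum>(a1, a2) | a1 + a2 = a. \<Sum>(b1, b2) | b1 + b2 = b.
      coeff_of f (glue N a1 b1) * coeff_of g (glue N a2 b2))"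
    by (rule sum_glue[OF N])
  also have "\<dots> = (\<Sum>(a1, a2) | a1 + a2 = a. \<Sum>(b1, b2) | b1 + b2 = b.
      tensor_coeff a1 b1 (qsym_comult f) * tensor_coeff a2 b2 (qsym_comult g))"
    using N by (auto intro!: sum.cong simp: keys_plus_monomial tensor_coeff_qsym_comult[of _ N])
  also have "\<dots> = tensor_coeff a b (tensor_mult QSym (qsym_comult f) (qsym_comult g))"
    by (rule tensor_coeff_tensor_mult[symmetric])
  finally show "tensor_coeff a b (qsym_comult (qsym_mult f g))
      = tensor_coeff a b (tensor_mult QSym (qsym_comult f) (qsym_comult g))" .
qed

lemma qsym_coassoc:
  "tensor_assoc (tensor_map qsym_comult id (qsym_comult f))
    = tensor_map id qsym_comult (qsym_comult f)"
proof (rule M.linear_eqI[where x = f])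
  fix \<alpha>
  let ?M = "\<lambda>\<alpha> \<beta> \<gamma>. M_qsym \<alpha> \<otimes> (M_qsym \<beta> \<otimes> M_qsym \<gamma>)"
  note linear = qlinear_qsym_comult qlinear_id tensor_map_sum tensor_map_pure tensor_assoc_sum
    tensor_assoc_pure pure_tensor_sum_left pure_tensor_sum_right
  have "tensor_assoc (tensor_map qsym_comult id (qsym_comult (M_qsym \<alpha>)))
      = (\<Sum>(\<delta>, \<gamma>) | comp_append \<delta> \<gamma> = \<alpha>. \<Sum>(\<beta>, \<beta>') | comp_append \<beta> \<beta>' = \<delta>. ?M \<beta> \<beta>' \<gamma>)"
    by (simp add: qsym_comult_M case_prod_unfold linear)
  also have "\<dots> = (\<Sum>(\<beta>, \<delta>) | comp_append \<beta> \<delta> = \<alpha>. \<Sum>(\<beta>', \<gamma>) | comp_append \<beta>' \<gamma> = \<delta>. ?M \<beta> \<beta>' \<gamma>)"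
    by (rule sum_factor_assoc[OF finite_comp_append comp_append_assoc])
  also have "\<dots> = tensor_map id qsym_comult (qsym_comult (M_qsym \<alpha>))"
    by (simp add: qsym_comult_M case_prod_unfold linear)
  finally show "tensor_assoc (tensor_map qsym_comult id (qsym_comult (M_qsym \<alpha>)))
      = tensor_map id qsym_comult (qsym_comult (M_qsym \<alpha>))" .
qed (intro linear_intros)+

lemma tensor_lift_qsym_comult_M:
  assumes "qbilinear b"
  shows "tensor_lift b (qsym_comult (M_qsym \<alpha>))
    = (\<Sum>i\<le>length (parts \<alpha>). b (M_qsym (comp_take i \<alpha>)) (M_qsym (comp_drop i \<alpha>)))"
  by (simp add: qsym_comult_M sum_comp_append tensor_lift_sum assms tensor_lift_pure)

lemma coeff_of_M_qsym_zero: "coeff_of (M_qsym \<alpha>) 0 = (if parts \<alpha> = [] then 1 else 0)"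
  using comp_of_eq_empty_iff[of 0] by (simp add: coeff_of_M_qsym parts_eq_Nil_iff)

lemma
  shows qsym_counit_left: "tensor_lift (\<lambda>f g. coeff_of f 0 *\<^sub>Q g) (qsym_comult h) = h"
    and qsym_counit_right: "tensor_lift (\<lambda>f g. coeff_of g 0 *\<^sub>Q f) (qsym_comult h) = h"
proof -
  have bilinear: "qbilinear (\<lambda>f (g :: qsym). coeff_of f 0 *\<^sub>Q g)"
    "qbilinear (\<lambda>(f :: qsym) g. coeff_of g 0 *\<^sub>Q f)"
    by (intro linear_intros)+
  show "tensor_lift (\<lambda>f g. coeff_of f 0 *\<^sub>Q g) (qsym_comult h) = h"
  proof (rule M.linear_eqI[where x = h])
    fix \<alpha>
    have "tensor_lift (\<lambda>f g. coeff_of f 0 *\<^sub>Q g) (qsym_comult (M_qsym \<alpha>))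
        = (\<Sum>i\<le>length (parts \<alpha>). if i = 0 then M_qsym \<alpha> else 0)"
      unfolding tensor_lift_qsym_comult_M[OF bilinear(1)]
      by (intro sum.cong) (auto simp: coeff_of_M_qsym_zero comp_take.rep_eq scaleQ_one)
    then show "tensor_lift (\<lambda>f g. coeff_of f 0 *\<^sub>Q g) (qsym_comult (M_qsym \<alpha>)) = M_qsym \<alpha>" by simp
  qed (intro linear_intros)+
  show "tensor_lift (\<lambda>f g. coeff_of g 0 *\<^sub>Q f) (qsym_comult h) = h"
  proof (rule M.linear_eqI[where x = h])
    fix \<alpha>
    have "tensor_lift (\<lambda>f g. coeff_of g 0 *\<^sub>Q f) (qsym_comult (M_qsym \<alpha>))
        = (\<Sum>i\<le>length (parts \<alpha>). if i = length (parts \<alpha>) then M_qsym \<alpha> else 0)"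
      unfolding tensor_lift_qsym_comult_M[OF bilinear(2)]
      by (intro sum.cong) (auto simp: coeff_of_M_qsym_zero comp_drop.rep_eq scaleQ_one)
    then show "tensor_lift (\<lambda>f g. coeff_of g 0 *\<^sub>Q f) (qsym_comult (M_qsym \<alpha>)) = M_qsym \<alpha>" by simp
  qed (intro linear_intros)+
qed

lemma qsym_comult_one: "qsym_comult qsym_one = qsym_one \<otimes> qsym_one"
  using parts_eq_Nil_iff[of comp_empty]
  by (simp add: qsym_one_eq_M_empty qsym_comult_M sum_comp_append)

lemma coeff_of_mult_zero: "coeff_of (qsym_mult f g) 0 = coeff_of f 0 * coeff_of g 0"
proof -
  have "{(a, b). a + b = (0 :: monomial)} = {(0, 0)}"
    by (auto simp: poly_mapping_eq_iff plus_poly_mapping.rep_eq fun_eq_iff)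
  then show ?thesis by (simp add: qsym_mult.rep_eq)
qed

global_interpretation QSym: bialgebra QSym
  by (rule bialgebra.intro)
    (simp_all add: qbilinear_qsym_mult qsym_mult_assoc qsym_mult_one_left qsym_mult_one_right
      qlinear_qsym_comult qlinear_coeff_of qsym_coassoc qsym_counit_left qsym_counit_right
      qsym_comult_mult qsym_comult_one coeff_of_mult_zero qsym_one.rep_eq)

text \<open>The value of a convolution inverse of \<open>f\<close> at \<open>M_qsym \<alpha>\<close>: the term \<open>i = length (parts \<alpha>)\<close> of
  the deconcatenation contributes \<open>f(1) = 1\<close> times this value, which is solved for.\<close>

function convolution_inverse_M ::
    "'a::rat_vector bialgebra_ops \<Rightarrow> (qsym \<Rightarrow> 'a) \<Rightarrow> composition \<Rightarrow> 'a" where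
  "convolution_inverse_M A f \<alpha> = (if parts \<alpha> = [] then unit A
    else - (\<Sum>i<length (parts \<alpha>).
      mult A (convolution_inverse_M A f (comp_take i \<alpha>)) (f (M_qsym (comp_drop i \<alpha>)))))"
  by auto
termination
  by (relation "measure (\<lambda>(A, f, \<alpha>). length (parts \<alpha>))") (auto simp: comp_take.rep_eq)

declare convolution_inverse_M.simps [simp del]

lemma ex_convolution_left_inverse:
  assumes "bialgebra A" and f: "qlinear f" "f qsym_one = unit A"
  shows "\<exists>g. qlinear g \<and> g qsym_one = unit A \<and> convolution QSym A g f = convolution_unit QSym A"
proof -
  interpret A: bialgebra A by fact
  interpret QSym_A: bialgebra_pair QSym A ..
  obtain g where g: "qlinear g" "\<And>\<alpha>. g (M_qsym \<alpha>) = convolution_inverse_M A f \<alpha>"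
    using M.ex1_linear by metis
  have g_one: "g qsym_one = unit A"
    using parts_eq_Nil_iff by (simp add: qsym_one_eq_M_empty g convolution_inverse_M.simps)
  have bilinear: "qbilinear (\<lambda>x y. mult A (g x) (f y))"
    by (intro linear_intros qbilinear_left[OF A.mult_bilinear] qbilinear_right[OF A.mult_bilinear]
        f(1) g(1))
  have "convolution QSym A g f x = convolution_unit QSym A x" for x
  proof (rule M.linear_eqI[where x = x])
    show "qlinear (convolution QSym A g f)" using g(1) f(1) by (rule QSym_A.qlinear_convolution)
    show "qlinear (convolution_unit QSym A)" by (rule QSym_A.qlinear_convolution_unit)
    fix \<alpha>
    let ?t = "\<lambda>i. mult A (g (M_qsym (comp_take i \<alpha>))) (f (M_qsym (comp_drop i \<alpha>)))"
    have "convolution QSym A g f (M_qsym \<alpha>) = (\<Sum>i\<le>length (parts \<alpha>). ?t i)"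
      by (simp add: convolution_def tensor_lift_tensor_map A.mult_bilinear f(1) g(1)
          tensor_lift_qsym_comult_M[OF bilinear])
    also have "\<dots> = (\<Sum>i<length (parts \<alpha>). ?t i) + g (M_qsym \<alpha>)"
      using f(2) by (simp add: A.unit_right qsym_one_eq_M_empty flip: lessThan_Suc_atMost)
    also have "\<dots> = convolution_unit QSym A (M_qsym \<alpha>)"
      by (simp add: convolution_unit_def coeff_of_M_qsym_zero scaleQ_one g(2)
          convolution_inverse_M.simps[of A f \<alpha>])
    finally show "convolution QSym A g f (M_qsym \<alpha>) = convolution_unit QSym A (M_qsym \<alpha>)" .
  qed
  with g(1) g_one show ?thesis by blast
qed

lemma hopf_algebra_QSym: "hopf_algebra QSym"
proof -
  have id: "qlinear (id :: qsym \<Rightarrow> qsym)" "id qsym_one = unit QSym"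
    by (simp_all add: qlinear_id)
  obtain S where S: "qlinear S" "S qsym_one = unit QSym"
      "convolution QSym QSym S id = convolution_unit QSym QSym"
    using ex_convolution_left_inverse[OF QSym.bialgebra_axioms id] by blast
  obtain T where T: "qlinear T" "convolution QSym QSym T S = convolution_unit QSym QSym"
    using ex_convolution_left_inverse[OF QSym.bialgebra_axioms S(1,2)] by blast
  have "T = id"
    using T(1) S(1) id(1) T(2) S(3) by (rule QSym.endomorphisms.convolution_inverse_unique)
  with S T have "is_antipode QSym S" by (simp only: QSym.is_antipode_iff)
  then show ?thesis by unfold_locales blast
qed

section \<open>Ascents, descents and fundamental quasisymmetric functions\<close>

definition step_set :: "('a \<Rightarrow> 'a \<Rightarrow> bool) \<Rightarrow> 'a list \<Rightarrow> nat set"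
  where "step_set R xs = {j. 1 \<le> j \<and> j < length xs \<and> R (xs ! (j - 1)) (xs ! j)}"

abbreviation ascents :: "'a::linorder list \<Rightarrow> nat set"
  where "ascents \<equiv> step_set (<)"

abbreviation descents :: "'a::linorder list \<Rightarrow> nat set"
  where "descents \<equiv> step_set (>)"

lemma Des_eq_descents: "Des \<pi> = descents (letters \<pi>)"
  by (simp add: Des_def step_set_def len_eq)

lemma Suc_in_step_set_iff: "Suc i \<in> step_set R xs \<longleftrightarrow> Suc i < length xs \<and> R (xs ! i) (xs ! Suc i)"
  by (simp add: step_set_def)

lemma step_set_bounds: "step_set R xs \<subseteq> {1..<length xs}"
  by (auto simp: step_set_def)

lemma step_set_Nil [simp]: "step_set R [] = {}"
  by (simp add: step_set_def)

lemma step_set_single [simp]: "step_set R [x] = {}"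
  by (simp add: step_set_def)

lemma step_set_map: "step_set R (List.map f xs) = step_set (\<lambda>x y. R (f x) (f y)) xs"
  by (auto simp: step_set_def)

lemma step_set_append:
  "step_set R (xs @ ys) = step_set R xs
    \<union> (if xs \<noteq> [] \<and> ys \<noteq> [] \<and> R (last xs) (hd ys) then {length xs} else {})
    \<union> (+) (length xs) ` step_set R ys" (is "_ = ?steps")
proof (cases "xs = []")
  case False
  show ?thesis
  proof (rule set_eqI)
    fix j
    consider "j < length xs" | "j = length xs" | k where "j = length xs + Suc k"
      by (metis add_Suc_right less_iff_Suc_add linorder_neqE_nat)
    then show "j \<in> step_set R (xs @ ys) \<longleftrightarrow> j \<in> ?steps"
      by cases (use False in \<open>auto simp: step_set_def nth_append last_conv_nth hd_conv_nth
          image_iff Suc_le_eq\<close>)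
  qed
qed (auto simp: image_iff)

lemma step_set_subset_iff:
  assumes "length xs = length ys"
  shows "step_set R xs \<subseteq> step_set S ys
    \<longleftrightarrow> (\<forall>i. Suc i < length xs \<longrightarrow> R (xs ! i) (xs ! Suc i) \<longrightarrow> S (ys ! i) (ys ! Suc i))"
proof
  assume "step_set R xs \<subseteq> step_set S ys"
  then show "\<forall>i. Suc i < length xs \<longrightarrow> R (xs ! i) (xs ! Suc i) \<longrightarrow> S (ys ! i) (ys ! Suc i)"
    by (metis Suc_in_step_set_iff subsetD)
next
  assume steps: "\<forall>i. Suc i < length xs \<longrightarrow> R (xs ! i) (xs ! Suc i) \<longrightarrow> S (ys ! i) (ys ! Suc i)"
  show "step_set R xs \<subseteq> step_set S ys"
  proof
    show "j \<in> step_set S ys" if "j \<in> step_set R xs" for j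
      using that steps assms by (cases j) (auto simp: step_set_def)
  qed
qed

lemma ex_list_descents:
  "\<exists>xs. length xs = n \<and> distinct xs \<and> (0 :: nat) \<notin> set xs \<and> descents xs = S \<inter> {1..<n}"
proof (induction n)
  case (Suc n)
  then obtain xs :: "nat list"
    where xs: "length xs = n" "distinct xs" "0 \<notin> set xs" "descents xs = S \<inter> {1..<n}" by blast
  show ?case
  proof (cases "n \<in> S")
    case True
    have "last (List.map Suc xs) > 1" if "xs \<noteq> []"
      using that xs(3) last_in_set[OF that] by (metis One_nat_def Suc_less_eq gr0I last_map)
    then have "descents (List.map Suc xs @ [1]) = descents xs \<union> (if xs = [] then {} else {n})"
      by (simp add: step_set_append step_set_map xs(1))
    also have "\<dots> = S \<inter> {1..<Suc n}"
      using True xs(1) unfolding xs(4) by (auto simp: less_Suc_eq Suc_le_eq)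
    finally show ?thesis
      using xs(1-3) by (intro exI[of _ "List.map Suc xs @ [1]"]) (auto simp: distinct_map)
  next
    case False
    have le: "x \<le> sum_list xs" if "x \<in> set xs" for x
      using that by (simp add: member_le_sum_list)
    have "descents (xs @ [Suc (sum_list xs)]) = descents xs"
      using le[OF last_in_set] by (fastforce simp: step_set_append)
    also have "\<dots> = S \<inter> {1..<Suc n}"
      using False unfolding xs(4) by (auto simp: less_Suc_eq)
    finally show ?thesis
      using xs(1-3) le by (intro exI[of _ "xs @ [Suc (sum_list xs)]"]) fastforce
  qed
qed (rule exI[of _ "[]"], simp)

lemma ex_permutation_Des:
  assumes "S \<subseteq> {1..<n}"
  shows "\<exists>\<pi>. len \<pi> = n \<and> Des \<pi> = S"
proof -
  obtain xs :: "nat list"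
    where xs: "length xs = n" "distinct xs" "0 \<notin> set xs" "descents xs = S \<inter> {1..<n}"
    using ex_list_descents by blast
  then have "letters (Perm xs) = xs" by (intro Perm_inverse) simp
  with xs assms show ?thesis
    by (intro exI[of _ "Perm xs"]) (auto simp: len_eq Des_eq_descents)
qed

definition partial_sums :: "nat list \<Rightarrow> nat set"
  where "partial_sums as = {sum_list (take k as) | k. 1 \<le> k \<and> k < length as}"

fun running_sums :: "nat \<Rightarrow> nat list \<Rightarrow> nat list" where
  "running_sums c [] = []"
| "running_sums c (a # as) = (c + a) # running_sums (c + a) as"

lemma length_running_sums [simp]: "length (running_sums c as) = length as"
  by (induction as arbitrary: c) simp_all

lemma nth_running_sums: "k < length as \<Longrightarrow> running_sums c as ! k = c + sum_list (take (Suc k) as)"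
  by (induction as arbitrary: c k) (auto simp: nth_Cons' less_Suc_eq_0_disj add.assoc)

lemma differences_running_sums: "map2 (-) (running_sums c as) (c # running_sums c as) = as"
  by (induction as arbitrary: c) simp_all

lemma running_sums_differences:
  "sorted_wrt (<) (c # ds) \<Longrightarrow> running_sums c (map2 (-) ds (c # ds)) = ds"
proof (induction ds arbitrary: c)
  case (Cons d ds)
  then have "c \<le> d" by simp
  with Cons show ?case by simp
qed simp

lemma strict_sorted_running_sums:
  "\<forall>a\<in>set as. 0 < a \<Longrightarrow> sorted_wrt (<) (c # running_sums c as)"
proof (induction as arbitrary: c)
  case (Cons a as)
  then show ?case using Cons.IH[of "c + a"] by fastforce
qed simp

lemma last_running_sums: "last (c # running_sums c as) = c + sum_list as"
  by (induction as arbitrary: c) (simp_all add: add.assoc)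

lemma partial_sums_eq_running_sums: "partial_sums as = set (butlast (running_sums 0 as))"
proof -
  have "partial_sums as = (\<lambda>k. sum_list (take (Suc k) as)) ` {0..<length as - 1}"
  proof (intro equalityI subsetI)
    fix d assume "d \<in> partial_sums as"
    then obtain k where "1 \<le> k" "k < length as" "d = sum_list (take k as)"
      by (auto simp: partial_sums_def)
    then show "d \<in> (\<lambda>k. sum_list (take (Suc k) as)) ` {0..<length as - 1}"
      by (intro image_eqI[of _ _ "k - 1"]) simp_all
  qed (force simp: partial_sums_def)
  also have "\<dots> = (!) (running_sums 0 as) ` {0..<length as - 1}"
    by (rule image_cong) (simp_all add: nth_running_sums)
  also have "\<dots> = set (butlast (running_sums 0 as))"
    by (simp add: nth_image butlast_conv_take)
  finally show ?thesis .
qed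

lemma partial_sums_Cons:
  assumes "as \<noteq> []"
  shows "partial_sums (a # as) = insert a ((+) a ` partial_sums as)"
proof -
  have "running_sums a as = List.map ((+) a) (running_sums 0 as)"
    by (rule nth_equalityI) (simp_all add: nth_running_sums)
  moreover have "running_sums 0 as \<noteq> []" using assms by (cases as) simp_all
  ultimately show ?thesis
    by (simp add: partial_sums_eq_running_sums map_butlast[symmetric])
qed

lemma
  assumes "\<forall>a\<in>set as. 0 < a" "as \<noteq> []"
  shows strict_sorted_running_sums_snoc:
      "sorted_wrt (<) (0 # butlast (running_sums 0 as) @ [sum_list as])"
    and running_sums_snoc: "running_sums 0 as = butlast (running_sums 0 as) @ [sum_list as]"
proof -
  have nonempty: "running_sums 0 as \<noteq> []"
    using assms(2) by (simp flip: length_greater_0_conv)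
  then show snoc: "running_sums 0 as = butlast (running_sums 0 as) @ [sum_list as]"
    using last_running_sums[of 0 as] append_butlast_last_id[OF nonempty] by simp
  show "sorted_wrt (<) (0 # butlast (running_sums 0 as) @ [sum_list as])"
    using strict_sorted_running_sums[OF assms(1), of 0] by (subst snoc[symmetric])
qed

lemma partial_sums_bounds:
  assumes "\<forall>a\<in>set as. 0 < a"
  shows "partial_sums as \<subseteq> {1..<sum_list as}"
proof (cases "as = []")
  case False
  then show ?thesis
    using strict_sorted_running_sums_snoc[OF assms]
    by (auto simp: partial_sums_eq_running_sums sorted_wrt_append)
qed (simp add: partial_sums_def)

lemma running_sums_eq:
  assumes "\<forall>a\<in>set as. 0 < a" "as \<noteq> []"
  shows "running_sums 0 as = sorted_list_of_set (partial_sums as) @ [sum_list as]"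
proof -
  have "sorted_wrt (<) (butlast (running_sums 0 as))"
    using strict_sorted_running_sums_snoc[OF assms] by (simp add: sorted_wrt_append)
  then have "sorted_list_of_set (partial_sums as) = butlast (running_sums 0 as)"
    by (simp add: partial_sums_eq_running_sums strict_sorted_iff
        sorted_list_of_set.idem_if_sorted_distinct)
  with running_sums_snoc[OF assms] show ?thesis by simp
qed

lemma composition_eqI:
  assumes "sum_list (parts \<alpha>) = sum_list (parts \<beta>)"
    and "partial_sums (parts \<alpha>) = partial_sums (parts \<beta>)"
  shows "\<alpha> = \<beta>"
proof -
  have pos: "\<forall>a\<in>set (parts \<gamma>). 0 < a" for \<gamma> by (simp add: parts_pos)
  have empty: "parts \<gamma> = [] \<longleftrightarrow> sum_list (parts \<gamma>) = 0" for \<gamma>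
    using pos[of \<gamma>] by (cases "parts \<gamma>") auto
  have "running_sums 0 (parts \<alpha>) = running_sums 0 (parts \<beta>)"
  proof (cases "parts \<alpha> = []")
    case True
    then show ?thesis using assms(1) empty[of \<alpha>] empty[of \<beta>] by simp
  next
    case False
    then have "parts \<beta> \<noteq> []" using assms(1) empty[of \<alpha>] empty[of \<beta>] by simp
    with False show ?thesis by (simp add: running_sums_eq pos assms)
  qed
  then have "parts \<alpha> = parts \<beta>" by (metis differences_running_sums)
  then show ?thesis by (simp add: parts_inject)
qed

lemma finite_Des: "finite (Des \<pi>)"
  unfolding Des_eq_descents by (rule finite_subset[OF step_set_bounds]) simp

lemma
  shows sum_list_Comp: "sum_list (parts (Comp \<pi>)) = len \<pi>"
    and partial_sums_Comp: "partial_sums (parts (Comp \<pi>)) = Des \<pi>"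
proof -
  let ?ds = "sorted_list_of_set (Des \<pi>) @ [len \<pi>]"
  have bounds: "Des \<pi> \<subseteq> {1..<len \<pi>}"
    using step_set_bounds by (simp add: Des_eq_descents len_eq)
  have "sum_list (parts (Comp \<pi>)) = len \<pi> \<and> partial_sums (parts (Comp \<pi>)) = Des \<pi>"
  proof (cases "len \<pi> = 0")
    case True
    then show ?thesis using bounds by (auto simp: Comp.rep_eq Comp_parts_def partial_sums_def)
  next
    case False
    then have "sorted_wrt (<) (0 # ?ds)"
      using bounds finite_Des[of \<pi>] by (auto simp: sorted_wrt_append)
    then have "running_sums 0 (parts (Comp \<pi>)) = ?ds"
      unfolding Comp.rep_eq Comp_parts_def Let_def if_not_P[OF False]
      by (rule running_sums_differences)
    then show ?thesis
      using last_running_sums[of 0 "parts (Comp \<pi>)"] finite_Des[of \<pi>]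
      by (simp add: partial_sums_eq_running_sums)
  qed
  then show "sum_list (parts (Comp \<pi>)) = len \<pi>" "partial_sums (parts (Comp \<pi>)) = Des \<pi>" by simp_all
qed

lemma surj_Comp: "\<exists>\<pi>. Comp \<pi> = \<alpha>"
proof -
  have "partial_sums (parts \<alpha>) \<subseteq> {1..<sum_list (parts \<alpha>)}"
    by (rule partial_sums_bounds) (simp add: parts_pos)
  then obtain \<pi> where "len \<pi> = sum_list (parts \<alpha>)" "Des \<pi> = partial_sums (parts \<alpha>)"
    using ex_permutation_Des by blast
  then have "Comp \<pi> = \<alpha>" by (intro composition_eqI) (simp_all add: sum_list_Comp partial_sums_Comp)
  then show ?thesis ..
qed

lemma des_class_cases [cases type: des_class]:
  obtains \<pi> where "c = abs_des_class \<pi>"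
  by (metis Quotient3_abs_rep[OF Quotient3_des_class])

lemma bij_des_class_Comp: "bij des_class_Comp"
proof (rule bijI)
  show "inj des_class_Comp"
  proof (rule injI)
    fix c d :: des_class assume eq: "des_class_Comp c = des_class_Comp d"
    obtain \<pi> where c: "c = abs_des_class \<pi>" by (rule des_class_cases)
    obtain \<sigma> where d: "d = abs_des_class \<sigma>" by (rule des_class_cases)
    have "Comp \<pi> = Comp \<sigma>" using eq by (simp add: c d des_class_Comp.abs_eq)
    then have "len \<pi> = len \<sigma>" "Des \<pi> = Des \<sigma>"
      by (metis sum_list_Comp) (metis \<open>Comp \<pi> = Comp \<sigma>\<close> partial_sums_Comp)
    then show "c = d" by (simp add: c d des_class.abs_eq_iff Des_equiv_def)
  qed
  have "\<alpha> \<in> range des_class_Comp" for \<alpha>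
  proof -
    obtain \<pi> where "\<alpha> = Comp \<pi>" using surj_Comp by metis
    then have "\<alpha> = des_class_Comp (abs_des_class \<pi>)" by (simp add: des_class_Comp.abs_eq)
    then show ?thesis by (rule range_eqI)
  qed
  then show "surj des_class_Comp" by blast
qed

lemma ascents_concat_replicate:
  assumes "sorted_wrt (<) xs" "\<forall>x\<in>set xs. 0 < f x"
  shows "ascents (concat (List.map (\<lambda>x. replicate (f x) x) xs)) = partial_sums (List.map f xs)"
  using assms
proof (induction xs)
  case (Cons x xs)
  let ?rest = "concat (List.map (\<lambda>x. replicate (f x) x) xs)"
  have ascents_block: "ascents (replicate (f x) x) = {}"
    by (auto simp: step_set_def)
  show ?case
  proof (cases "xs = []")
    case True
    then show ?thesis by (simp add: ascents_block partial_sums_def)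
  next
    case False
    have set_rest: "set ?rest = set xs" using Cons.prems(2) by auto
    with False have rest: "?rest \<noteq> []" by (metis set_empty)
    then have "x < hd ?rest" using Cons.prems(1) hd_in_set[OF rest] set_rest by simp
    with rest have "ascents (replicate (f x) x @ ?rest) = insert (f x) ((+) (f x) ` ascents ?rest)"
      using Cons.prems(2) by (simp add: step_set_append ascents_block)
    with Cons False show ?thesis by (simp add: partial_sums_Cons)
  qed
qed (simp add: partial_sums_def)

lemma ascents_word_of: "ascents (word_of m) = partial_sums (parts (comp_of m))"
  unfolding word_of_def parts_comp_of
  by (rule ascents_concat_replicate) (auto simp: strict_sorted_support in_keys_iff)

definition compatible_words :: "composition \<Rightarrow> nat list set"
  where "compatible_words \<alpha>
    = {xs. length xs = sum_list (parts \<alpha>) \<and> sorted xs \<and> partial_sums (parts \<alpha>) \<subseteq> ascents xs}"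

lemma coeff_of_F_qsym_eq_card:
  "coeff_of (F_qsym \<alpha>) m = of_nat (card {xs \<in> compatible_words \<alpha>. word_monomial xs = m})"
proof -
  have "(\<forall>j\<in>partial_sums (parts \<alpha>). xs ! (j - 1) < xs ! j) \<longleftrightarrow> partial_sums (parts \<alpha>) \<subseteq> ascents xs"
    if "length xs = sum_list (parts \<alpha>)" for xs
    using that partial_sums_bounds[of "parts \<alpha>"] parts_pos by (fastforce simp: step_set_def)
  then show ?thesis
    unfolding F_qsym.rep_eq compatible_words_def partial_sums_def[symmetric]
    by (intro arg_cong[where f = "\<lambda>A. of_nat (card A)"]) auto
qed

lemma compatible_words_with_monomial:
  "{xs \<in> compatible_words \<alpha>. word_monomial xs = m}
    = (if total_degree m = sum_list (parts \<alpha>) \<and> partial_sums (parts \<alpha>) \<subseteq> ascents (word_of m)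
       then {word_of m} else {})"
proof -
  have "{xs \<in> compatible_words \<alpha>. word_monomial xs = m}
      = {xs \<in> {word_of m}. length xs = sum_list (parts \<alpha>) \<and> partial_sums (parts \<alpha>) \<subseteq> ascents xs}"
    using eq_word_of_iff[of _ m] by (auto simp: compatible_words_def)
  then show ?thesis by auto
qed

lemma coeff_of_F_qsym:
  "coeff_of (F_qsym \<alpha>) m
    = (if total_degree m = sum_list (parts \<alpha>) \<and> partial_sums (parts \<alpha>) \<subseteq> ascents (word_of m)
       then 1 else 0)"
  by (simp add: coeff_of_F_qsym_eq_card compatible_words_with_monomial)

definition refines :: "composition \<Rightarrow> composition \<Rightarrow> bool"
  where "refines \<beta> \<alpha> \<longleftrightarrow> sum_list (parts \<beta>) = sum_list (parts \<alpha>)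
    \<and> partial_sums (parts \<alpha>) \<subseteq> partial_sums (parts \<beta>)"

lemma finite_refinements: "finite {\<beta>. refines \<beta> \<alpha>}"
  by (rule finite_subset[OF _ finite_compositions_le[of "sum_list (parts \<alpha>)"]])
    (auto simp: refines_def)

lemma card_partial_sums_less:
  assumes "refines \<beta> \<alpha>" "\<beta> \<noteq> \<alpha>"
  shows "sum_list (parts \<beta>) - card (partial_sums (parts \<beta>))
    < sum_list (parts \<alpha>) - card (partial_sums (parts \<alpha>))"
proof -
  have "partial_sums (parts \<alpha>) \<subset> partial_sums (parts \<beta>)"
    using assms composition_eqI[of \<beta> \<alpha>] by (auto simp: refines_def)
  moreover have bounds: "partial_sums (parts \<beta>) \<subseteq> {1..<sum_list (parts \<beta>)}"
    by (rule partial_sums_bounds) (simp add: parts_pos)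
  ultimately have "card (partial_sums (parts \<alpha>)) < card (partial_sums (parts \<beta>))"
    using finite_subset[OF bounds] by (intro psubset_card_mono) simp_all
  moreover have "card (partial_sums (parts \<beta>)) \<le> sum_list (parts \<beta>)"
    using card_mono[OF _ bounds] by simp
  ultimately show ?thesis using assms(1) by (simp add: refines_def)
qed

lemma F_qsym_eq_sum_M: "F_qsym \<alpha> = (\<Sum>\<beta> | refines \<beta> \<alpha>. M_qsym \<beta>)"
proof (rule qsym_eqI)
  show "coeff_of (F_qsym \<alpha>) m = coeff_of (\<Sum>\<beta> | refines \<beta> \<alpha>. M_qsym \<beta>) m" for m
    using finite_refinements[of \<alpha>]
    by (auto simp: coeff_of_sum coeff_of_F_qsym coeff_of_M_qsym total_degree_comp_of
        ascents_word_of refines_def)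
qed

global_interpretation F: qbasis F_qsym
proof (rule M.qbasis_unitriangular)
  show "F_qsym \<alpha> = M_qsym \<alpha> + (\<Sum>\<beta>\<in>{\<beta>. refines \<beta> \<alpha>} - {\<alpha>}. M_qsym \<beta>)" for \<alpha>
    unfolding F_qsym_eq_sum_M
    by (rule sum.remove) (simp_all add: finite_refinements, simp add: refines_def)
  show "sum_list (parts \<beta>) - card (partial_sums (parts \<beta>))
      < sum_list (parts \<alpha>) - card (partial_sums (parts \<alpha>))" if "\<beta> \<in> {\<beta>. refines \<beta> \<alpha>} - {\<alpha>}" for \<alpha> \<beta>
    using that by (simp add: card_partial_sums_less)
qed

section \<open>Products of fundamental quasisymmetric functions\<close>

lemma distinct_letters: "distinct (letters \<pi>)" and zero_notin_letters: "0 \<notin> set (letters \<pi>)"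
  using letters[of \<pi>] by auto

lemma in_shuffles_iff_subseq:
  assumes disjoint: "set xs \<inter> set ys = {}"
  shows "zs \<in> shuffles xs ys \<longleftrightarrow> length zs = length xs + length ys \<and> subseq xs zs \<and> subseq ys zs"
proof
  assume zs: "zs \<in> shuffles xs ys"
  then have "xs = filter (\<lambda>z. z \<in> set xs) zs" "ys = filter (\<lambda>z. z \<notin> set xs) zs"
    using filter_shuffles_disjoint1[OF disjoint] by simp_all
  then show "length zs = length xs + length ys \<and> subseq xs zs \<and> subseq ys zs"
    using length_shuffles[OF zs] by (metis subseq_filter_left)
next
  let ?xs = "filter (\<lambda>z. z \<in> set xs) zs" and ?ys = "filter (\<lambda>z. z \<notin> set xs) zs"
  assume zs: "length zs = length xs + length ys \<and> subseq xs zs \<and> subseq ys zs"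
  have "filter (\<lambda>z. z \<in> set xs) xs = xs" "filter (\<lambda>z. z \<notin> set xs) ys = ys"
    using disjoint by (auto simp: filter_id_conv)
  then have sub: "subseq xs ?xs" "subseq ys ?ys"
    using zs by (metis subseq_filter)+
  moreover have "length ?xs + length ?ys = length xs + length ys"
    using zs by (simp add: sum_length_filter_compl)
  ultimately have "xs = ?xs" "ys = ?ys"
    using list_emb_length[OF sub(1)] list_emb_length[OF sub(2)] by (auto intro!: subseq_same_length)
  then show "zs \<in> shuffles xs ys" by (metis partition_in_shuffles)
qed

lemma bij_betw_letters_shuffle_set:
  assumes "disjoint_perms \<pi> \<sigma>"
  shows "bij_betw letters (shuffle_set \<pi> \<sigma>) (shuffles (letters \<pi>) (letters \<sigma>))"
proof (rule bij_betw_imageI)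
  have disjoint: "set (letters \<pi>) \<inter> set (letters \<sigma>) = {}"
    using assms by (simp add: disjoint_perms_def)
  note iff = in_shuffles_iff_subseq[OF disjoint]
  show "inj_on letters (shuffle_set \<pi> \<sigma>)"
    by (simp add: inj_on_def letters_inject)
  show "letters ` shuffle_set \<pi> \<sigma> = shuffles (letters \<pi>) (letters \<sigma>)"
  proof (intro equalityI subsetI)
    fix zs assume zs: "zs \<in> shuffles (letters \<pi>) (letters \<sigma>)"
    then have "distinct zs" "0 \<notin> set zs"
      using distinct_disjoint_shuffles[OF distinct_letters distinct_letters disjoint]
        set_shuffles[OF zs]
      by (simp_all add: zero_notin_letters)
    then have "letters (Perm zs) = zs" by (simp add: Perm_inverse)
    with zs show "zs \<in> letters ` shuffle_set \<pi> \<sigma>"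
      by (intro image_eqI[of _ _ "Perm zs"]) (simp_all add: shuffle_set_def iff len_eq)
  qed (auto simp: shuffle_set_def iff len_eq)
qed

text \<open>A lexicographically increasing sequence of pairs is represented by the set of its entries.\<close>

definition reading :: "('a::linorder \<times> 'b::linorder) set \<Rightarrow> 'b list"
  where "reading Z = List.map snd (sorted_list_of_set Z)"

definition biwords :: "'b::linorder list \<Rightarrow> ('a::linorder \<times> 'b) set set"
  where "biwords ys = {Z. finite Z \<and> reading Z = ys}"

definition biword_monomial :: "(nat \<times> 'b) set \<Rightarrow> monomial"
  where "biword_monomial Z = (\<Sum>p\<in>Z. Poly_Mapping.single (fst p) 1)"

lemma set_reading: "finite Z \<Longrightarrow> set (reading Z) = snd ` Z"
  by (simp add: reading_def)

lemma reading_filter: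
  assumes "finite Z"
  shows "reading {p \<in> Z. P (snd p)} = filter P (reading Z)"
proof -
  have "sorted_list_of_set {p \<in> Z. P (snd p)} = filter (\<lambda>p. P (snd p)) (sorted_list_of_set Z)"
    by (rule strict_sorted_equal) (use assms in \<open>simp_all add: sorted_wrt_filter\<close>)
  then show ?thesis by (simp add: reading_def filter_map o_def)
qed

lemma
  assumes disjoint: "set xs \<inter> set ys = {}" and X: "X \<in> biwords xs" and Y: "Y \<in> biwords ys"
  shows biwords_Un_left: "{p \<in> X \<union> Y. snd p \<in> set xs} = X"
    and biwords_Un_right: "{p \<in> X \<union> Y. snd p \<notin> set xs} = Y"
    and biwords_Int: "X \<inter> Y = {}"
    and reading_biwords_Un: "reading (X \<union> Y) \<in> shuffles xs ys"
proof -
  have fin: "finite X" "finite Y" and reading: "reading X = xs" "reading Y = ys"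
    using X Y by (simp_all add: biwords_def)
  then have "set xs = snd ` X" "set ys = snd ` Y" by (auto simp flip: set_reading)
  with disjoint show split: "{p \<in> X \<union> Y. snd p \<in> set xs} = X" "{p \<in> X \<union> Y. snd p \<notin> set xs} = Y"
    "X \<inter> Y = {}" by blast+
  have "filter (\<lambda>y. y \<in> set xs) (reading (X \<union> Y)) = xs"
    "filter (\<lambda>y. y \<notin> set xs) (reading (X \<union> Y)) = ys"
    using reading_filter[of "X \<union> Y" "\<lambda>y. y \<in> set xs"] reading_filter[of "X \<union> Y" "\<lambda>y. y \<notin> set xs"]
    unfolding split by (simp_all add: fin reading)
  then show "reading (X \<union> Y) \<in> shuffles xs ys" by (metis partition_in_shuffles)
qed

lemma bij_betw_biwords_shuffles:
  assumes disjoint: "set xs \<inter> set ys = {}"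
  shows "bij_betw (\<lambda>(X, Y). X \<union> Y) (biwords xs \<times> biwords ys) (\<Union>zs\<in>shuffles xs ys. biwords zs)"
proof (rule bij_betw_imageI)
  show "inj_on (\<lambda>(X, Y). X \<union> Y) (biwords xs \<times> biwords ys)"
  proof (rule inj_onI, clarify)
    fix X Y X' Y'
    assume biwords: "X \<in> biwords xs" "Y \<in> biwords ys" "X' \<in> biwords xs" "Y' \<in> biwords ys"
      and eq: "X \<union> Y = X' \<union> Y'"
    show "X = X' \<and> Y = Y'"
      using biwords_Un_left[OF disjoint biwords(1,2)] biwords_Un_left[OF disjoint biwords(3,4)]
        biwords_Un_right[OF disjoint biwords(1,2)] biwords_Un_right[OF disjoint biwords(3,4)]
      unfolding eq by simp
  qed
  show "(\<lambda>(X, Y). X \<union> Y) ` (biwords xs \<times> biwords ys) = (\<Union>zs\<in>shuffles xs ys. biwords zs)"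
  proof (intro equalityI subsetI)
    fix Z :: "('c::linorder \<times> 'a) set"
    assume "Z \<in> (\<lambda>(X, Y). X \<union> Y) ` (biwords xs \<times> biwords ys)"
    then obtain X Y where "X \<in> biwords xs" "Y \<in> biwords ys" "Z = X \<union> Y" by auto
    then show "Z \<in> (\<Union>zs\<in>shuffles xs ys. biwords zs)"
      using reading_biwords_Un[OF disjoint] by (simp add: biwords_def)
  next
    fix Z :: "('c::linorder \<times> 'a) set"
    assume "Z \<in> (\<Union>zs\<in>shuffles xs ys. biwords zs)"
    then obtain zs where zs: "zs \<in> shuffles xs ys" and "finite Z" "reading Z = zs"
      by (auto simp: biwords_def)
    then have "({p \<in> Z. snd p \<in> set xs}, {p \<in> Z. snd p \<notin> set xs}) \<in> biwords xs \<times> biwords ys"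
      using filter_shuffles_disjoint1[OF disjoint zs]
        reading_filter[of Z "\<lambda>y. y \<in> set xs"] reading_filter[of Z "\<lambda>y. y \<notin> set xs"]
      by (simp add: biwords_def)
    then show "Z \<in> (\<lambda>(X, Y). X \<union> Y) ` (biwords xs \<times> biwords ys)"
      by (rule rev_image_eqI) auto
  qed
qed

lemma sorted_zip_iff:
  fixes xs :: "'a::linorder list" and ys :: "'b::linorder list"
  assumes len: "length xs = length ys" and "distinct ys"
  shows "sorted_wrt (<) (zip xs ys) \<longleftrightarrow> sorted xs \<and> descents ys \<subseteq> ascents xs"
proof -
  have neq: "ys ! i \<noteq> ys ! Suc i" if "Suc i < length xs" for i
    using assms that by (simp add: nth_eq_iff_index_eq)
  have "sorted_wrt (<) (zip xs ys) \<longleftrightarrow> (\<forall>i. Suc i < length xs \<longrightarrow> zip xs ys ! i < zip xs ys ! Suc i)"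
    by (subst sorted_wrt_iff_nth_Suc_transp) (auto simp: len transp_on_def)
  also have "\<dots> \<longleftrightarrow> (\<forall>i. Suc i < length xs \<longrightarrow> xs ! i \<le> xs ! Suc i)
      \<and> (\<forall>i. Suc i < length xs \<longrightarrow> ys ! i > ys ! Suc i \<longrightarrow> xs ! i < xs ! Suc i)"
    using neq by (auto simp: len less_prod_def less_le)
  finally show ?thesis
    using len by (simp add: sorted_iff_nth_Suc step_set_subset_iff)
qed

lemma bij_betw_words_biwords:
  fixes ys :: "'b::linorder list"
  assumes "distinct ys"
  shows "bij_betw (\<lambda>xs :: 'a::linorder list. set (zip xs ys))
    {xs. length xs = length ys \<and> sorted xs \<and> descents ys \<subseteq> ascents xs} (biwords ys)"
proof (rule bij_betw_byWitness[where f' = "\<lambda>Z. List.map fst (sorted_list_of_set Z)"])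
  let ?W = "{xs :: 'a list. length xs = length ys \<and> sorted xs \<and> descents ys \<subseteq> ascents xs}"
  have sort: "sorted_list_of_set (set (zip xs ys)) = zip xs ys" if "xs \<in> ?W" for xs
    using that sorted_zip_iff[OF _ assms, of xs]
    by (simp add: strict_sorted_iff sorted_list_of_set.idem_if_sorted_distinct)
  then show "\<forall>xs\<in>?W. List.map fst (sorted_list_of_set (set (zip xs ys))) = xs" by simp
  show "(\<lambda>xs. set (zip xs ys)) ` ?W \<subseteq> biwords ys"
    using sort by (auto simp: biwords_def reading_def)
  have zip: "zip (List.map fst (sorted_list_of_set Z)) ys = sorted_list_of_set Z"
    if "Z \<in> biwords ys" for Z :: "('a \<times> 'b) set"
    using that zip_map_fst_snd[of "sorted_list_of_set Z"] by (simp add: biwords_def reading_def)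
  show "\<forall>Z\<in>biwords ys :: ('a \<times> 'b) set set. set (zip (List.map fst (sorted_list_of_set Z)) ys) = Z"
  proof
    fix Z :: "('a \<times> 'b) set" assume Z: "Z \<in> biwords ys"
    then have "finite Z" by (simp add: biwords_def)
    then show "set (zip (List.map fst (sorted_list_of_set Z)) ys) = Z" by (simp add: zip[OF Z])
  qed
  have "List.map fst (sorted_list_of_set Z) \<in> ?W" if Z: "Z \<in> biwords ys" for Z :: "('a \<times> 'b) set"
  proof -
    have "length (List.map fst (sorted_list_of_set Z)) = length ys"
      using Z by (auto simp: biwords_def reading_def)
    moreover have "sorted_wrt (<) (zip (List.map fst (sorted_list_of_set Z)) ys)"
      unfolding zip[OF Z] by simp
    ultimately show ?thesis using sorted_zip_iff[OF _ assms] by blast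
  qed
  then show "(\<lambda>Z. List.map fst (sorted_list_of_set Z)) ` biwords ys \<subseteq> ?W" by blast
qed

lemma biword_monomial_zip:
  assumes "length xs = length ys" "distinct ys"
  shows "biword_monomial (set (zip xs ys)) = word_monomial xs"
proof -
  have "biword_monomial (set (zip xs ys)) = (\<Sum>p\<leftarrow>zip xs ys. Poly_Mapping.single (fst p) 1)"
    using assms by (simp add: biword_monomial_def sum_list_distinct_conv_sum_set distinct_zipI2)
  also have "\<dots> = word_monomial (List.map fst (zip xs ys))"
    by (simp add: word_monomial_def o_def)
  finally show ?thesis using assms(1) by simp
qed

lemma biword_monomial_Un:
  "finite X \<Longrightarrow> finite Y \<Longrightarrow> X \<inter> Y = {}
    \<Longrightarrow> biword_monomial (X \<union> Y) = biword_monomial X + biword_monomial Y"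
  by (simp add: biword_monomial_def sum.union_disjoint)

definition biwords_of_monomial :: "'b::linorder list \<Rightarrow> monomial \<Rightarrow> (nat \<times> 'b) set set"
  where "biwords_of_monomial ys m = {Z \<in> biwords ys. biword_monomial Z = m}"

lemma
  shows finite_biwords_of_monomial: "finite (biwords_of_monomial (letters \<pi>) m)"
    and coeff_of_F_Comp_eq_card:
      "coeff_of (F_qsym (Comp \<pi>)) m = of_nat (card (biwords_of_monomial (letters \<pi>) m))"
proof -
  let ?W = "{xs \<in> compatible_words (Comp \<pi>). word_monomial xs = m}"
  have "compatible_words (Comp \<pi>)
      = {xs. length xs = length (letters \<pi>) \<and> sorted xs \<and> descents (letters \<pi>) \<subseteq> ascents xs}"
    by (simp add: compatible_words_def sum_list_Comp partial_sums_Comp len_eq Des_eq_descents)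
  then have "bij_betw (\<lambda>xs. set (zip xs (letters \<pi>)))
      (compatible_words (Comp \<pi>)) (biwords (letters \<pi>))"
    using bij_betw_words_biwords[OF distinct_letters[of \<pi>]] by simp
  then have bij: "bij_betw (\<lambda>xs. set (zip xs (letters \<pi>))) ?W (biwords_of_monomial (letters \<pi>) m)"
    unfolding biwords_of_monomial_def
    by (rule bij_betw_Collect)
      (simp add: compatible_words_def sum_list_Comp len_eq biword_monomial_zip distinct_letters)
  have "finite ?W" by (simp add: compatible_words_with_monomial)
  then show "finite (biwords_of_monomial (letters \<pi>) m)"
    using bij_betw_finite[OF bij] by simp
  show "coeff_of (F_qsym (Comp \<pi>)) m = of_nat (card (biwords_of_monomial (letters \<pi>) m))"
    by (simp add: coeff_of_F_qsym_eq_card bij_betw_same_card[OF bij])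
qed

lemma bij_betw_biwords_of_monomial_shuffles:
  assumes disjoint: "set xs \<inter> set ys = {}"
  shows "bij_betw (\<lambda>(X, Y). X \<union> Y)
    (\<Union>(a, b)\<in>{(a, b). a + b = m}. biwords_of_monomial xs a \<times> biwords_of_monomial ys b)
    (\<Union>zs\<in>shuffles xs ys. biwords_of_monomial zs m)"
proof -
  have domain: "(\<Union>(a, b)\<in>{(a, b). a + b = m}. biwords_of_monomial xs a \<times> biwords_of_monomial ys b)
      = {p \<in> biwords xs \<times> biwords ys. biword_monomial (fst p) + biword_monomial (snd p) = m}"
    by (auto simp: biwords_of_monomial_def)
  have range: "(\<Union>zs\<in>shuffles xs ys. biwords_of_monomial zs m)
      = {Z \<in> (\<Union>zs\<in>shuffles xs ys. biwords zs). biword_monomial Z = m}"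
    by (auto simp: biwords_of_monomial_def)
  have "biword_monomial (X \<union> Y) = biword_monomial X + biword_monomial Y"
    if "X \<in> biwords xs" "Y \<in> biwords ys" for X Y
    using that biwords_Int[OF disjoint that]
    by (intro biword_monomial_Un) (simp_all add: biwords_def)
  then show ?thesis
    unfolding domain range
    by (intro bij_betw_Collect[OF bij_betw_biwords_shuffles[OF disjoint]]) auto
qed

lemma F_Comp_mult:
  assumes disjoint: "disjoint_perms \<pi> \<sigma>"
  shows "qsym_mult (F_qsym (Comp \<pi>)) (F_qsym (Comp \<sigma>)) = (\<Sum>\<tau>\<in>shuffle_set \<pi> \<sigma>. F_qsym (Comp \<tau>))"
proof (rule qsym_eqI)
  fix m :: monomial
  let ?B = "\<lambda>\<pi>. biwords_of_monomial (letters \<pi>)"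
  note bij = bij_betw_letters_shuffle_set[OF disjoint]
  have "coeff_of (qsym_mult (F_qsym (Comp \<pi>)) (F_qsym (Comp \<sigma>))) m
      = of_nat (\<Sum>(a, b) | a + b = m. card (?B \<pi> a \<times> ?B \<sigma> b))"
    by (simp add: qsym_mult.rep_eq coeff_of_F_Comp_eq_card card_cartesian_product case_prod_unfold)
  also have "(\<Sum>(a, b) | a + b = m. card (?B \<pi> a \<times> ?B \<sigma> b))
      = card (\<Union>(a, b)\<in>{(a, b). a + b = m}. ?B \<pi> a \<times> ?B \<sigma> b)"
    using finite_monomial_sums[of m] finite_biwords_of_monomial
    unfolding case_prod_unfold
    by (intro card_UN_disjoint[symmetric]) (auto simp: biwords_of_monomial_def)
  also have "\<dots> = card (\<Union>zs\<in>shuffles (letters \<pi>) (letters \<sigma>). biwords_of_monomial zs m)"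
    using disjoint
    by (intro bij_betw_same_card[OF bij_betw_biwords_of_monomial_shuffles])
      (simp add: disjoint_perms_def)
  also have "\<dots> = card (\<Union>\<tau>\<in>shuffle_set \<pi> \<sigma>. ?B \<tau> m)"
    by (simp flip: bij_betw_imp_surj_on[OF bij])
  also have "\<dots> = (\<Sum>\<tau>\<in>shuffle_set \<pi> \<sigma>. card (?B \<tau> m))"
    using bij_betw_finite[OF bij] finite_biwords_of_monomial
    by (intro card_UN_disjoint) (auto simp: biwords_of_monomial_def biwords_def letters_inject)
  finally show "coeff_of (qsym_mult (F_qsym (Comp \<pi>)) (F_qsym (Comp \<sigma>))) m
      = coeff_of (\<Sum>\<tau>\<in>shuffle_set \<pi> \<sigma>. F_qsym (Comp \<tau>)) m"
    by (simp add: coeff_of_sum coeff_of_F_Comp_eq_card)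
qed

section \<open>Coproducts of fundamental quasisymmetric functions\<close>

lemma step_set_append_subset_iff:
  assumes len: "length xs = length us" "length ys = length vs"
    and S: "us \<noteq> [] \<Longrightarrow> vs \<noteq> [] \<Longrightarrow> S (last us) (hd vs)"
  shows "step_set R (xs @ ys) \<subseteq> step_set S (us @ vs)
    \<longleftrightarrow> step_set R xs \<subseteq> step_set S us \<and> step_set R ys \<subseteq> step_set S vs"
proof -
  have left: "j \<in> step_set T zs \<longleftrightarrow> j \<in> step_set T (zs @ ws) \<and> j < length zs" for T zs ws j
    by (auto simp: step_set_def nth_append)
  have right: "j \<in> step_set T ws \<longleftrightarrow> length zs + j \<in> step_set T (zs @ ws) \<and> 1 \<le> j" for T zs ws j
    by (auto simp: step_set_def nth_append)
  show ?thesis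
  proof
    assume sub: "step_set R (xs @ ys) \<subseteq> step_set S (us @ vs)"
    have "step_set R xs \<subseteq> step_set S us"
    proof
      show "j \<in> step_set S us" if "j \<in> step_set R xs" for j
        using that sub left[of j R xs ys] left[of j S us vs] len(1) by auto
    qed
    moreover have "step_set R ys \<subseteq> step_set S vs"
    proof
      show "j \<in> step_set S vs" if "j \<in> step_set R ys" for j
        using that sub right[of j R ys xs] right[of j S vs us] len(1) by auto
    qed
    ultimately show "step_set R xs \<subseteq> step_set S us \<and> step_set R ys \<subseteq> step_set S vs" ..
  next
    assume sub: "step_set R xs \<subseteq> step_set S us \<and> step_set R ys \<subseteq> step_set S vs"
    have "xs = [] \<longleftrightarrow> us = []" "ys = [] \<longleftrightarrow> vs = []"
      using len by auto
    then have "(if xs \<noteq> [] \<and> ys \<noteq> [] \<and> R (last xs) (hd ys) then {length xs} else {})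
        \<subseteq> (if us \<noteq> [] \<and> vs \<noteq> [] \<and> S (last us) (hd vs) then {length us} else {})"
      using S len(1) by simp
    with sub show "step_set R (xs @ ys) \<subseteq> step_set S (us @ vs)"
      unfolding step_set_append len(1) by (intro Un_mono image_mono) simp_all
  qed
qed

lemma coeff_of_F_Comp:
  "coeff_of (F_qsym (Comp \<pi>)) m
    = (if total_degree m = len \<pi> \<and> Des \<pi> \<subseteq> ascents (word_of m) then 1 else 0)"
  by (simp add: coeff_of_F_qsym sum_list_Comp partial_sums_Comp)

lemma Des_subset_ascents_word_of_glue_iff:
  assumes keys: "Poly_Mapping.keys a \<subseteq> {..<N}"
    and len: "len \<pi> = total_degree a + total_degree b"
  shows "Des \<pi> \<subseteq> ascents (word_of (glue N a b))
    \<longleftrightarrow> Des (prefix_perm (total_degree a) \<pi>) \<subseteq> ascents (word_of a)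
      \<and> Des (suffix_perm (total_degree a) \<pi>) \<subseteq> ascents (word_of b)"
proof -
  let ?i = "total_degree a"
  have "last (word_of a) < hd (List.map (\<lambda>i. i + N) (word_of b))"
    if nonempty: "word_of a \<noteq> []" "List.map (\<lambda>i. i + N) (word_of b) \<noteq> []"
  proof -
    have "last (word_of a) < N" using last_in_set[OF nonempty(1)] keys by auto
    also have "N \<le> hd (List.map (\<lambda>i. i + N) (word_of b))" using nonempty(2) by (simp add: hd_map)
    finally show ?thesis .
  qed
  then have "descents (take ?i (letters \<pi>) @ drop ?i (letters \<pi>))
      \<subseteq> ascents (word_of a @ List.map (\<lambda>i. i + N) (word_of b))
    \<longleftrightarrow> descents (take ?i (letters \<pi>)) \<subseteq> ascents (word_of a)
      \<and> descents (drop ?i (letters \<pi>)) \<subseteq> ascents (List.map (\<lambda>i. i + N) (word_of b))"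
    using len by (intro step_set_append_subset_iff) (simp_all add: len_eq)
  then show ?thesis
    by (simp add: Des_eq_descents word_of_glue[OF keys] letters_prefix_perm letters_suffix_perm
        step_set_map)
qed

lemma coeff_of_F_Comp_glue:
  assumes keys: "Poly_Mapping.keys a \<subseteq> {..<N}"
  shows "coeff_of (F_qsym (Comp \<pi>)) (glue N a b) = (\<Sum>i\<le>len \<pi>.
    coeff_of (F_qsym (Comp (prefix_perm i \<pi>))) a * coeff_of (F_qsym (Comp (suffix_perm i \<pi>))) b)"
proof -
  have degree: "total_degree (glue N a b) = total_degree a + total_degree b"
    using word_of_glue[OF keys, of b] by (metis length_append length_map length_word_of)
  have len: "len (prefix_perm i \<pi>) = i" "len (suffix_perm i \<pi>) = len \<pi> - i" if "i \<le> len \<pi>" for i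
    using that by (simp_all add: len_eq letters_prefix_perm letters_suffix_perm)
  let ?t = "\<lambda>i. coeff_of (F_qsym (Comp (prefix_perm i \<pi>))) a
    * coeff_of (F_qsym (Comp (suffix_perm i \<pi>))) b"
  have "?t i = (if i = total_degree a then coeff_of (F_qsym (Comp \<pi>)) (glue N a b) else 0)"
    if "i \<le> len \<pi>" for i
    using that Des_subset_ascents_word_of_glue_iff[OF keys, of \<pi> b]
    by (auto simp: coeff_of_F_Comp len degree)
  then have "(\<Sum>i\<le>len \<pi>. ?t i)
      = (\<Sum>i\<le>len \<pi>. if i = total_degree a then coeff_of (F_qsym (Comp \<pi>)) (glue N a b) else 0)"
    by (intro sum.cong) auto
  also have "\<dots> = coeff_of (F_qsym (Comp \<pi>)) (glue N a b)"
    by (auto simp: coeff_of_F_Comp degree)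
  finally show ?thesis ..
qed

lemma qsym_comult_F_Comp:
  "qsym_comult (F_qsym (Comp \<pi>))
    = (\<Sum>i\<le>len \<pi>. F_qsym (Comp (prefix_perm i \<pi>)) \<otimes> F_qsym (Comp (suffix_perm i \<pi>)))"
proof (rule tensor_qsym_eqI)
  fix a b :: monomial
  obtain N where N: "Poly_Mapping.keys a \<subseteq> {..<N}" using ex_keys_bound by blast
  show "tensor_coeff a b (qsym_comult (F_qsym (Comp \<pi>)))
      = tensor_coeff a b
          (\<Sum>i\<le>len \<pi>. F_qsym (Comp (prefix_perm i \<pi>)) \<otimes> F_qsym (Comp (suffix_perm i \<pi>)))"
    by (simp add: tensor_coeff_qsym_comult[OF N] coeff_of_F_Comp_glue[OF N]
        qlinear_sum[OF qlinear_tensor_coeff] tensor_coeff_pure)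
qed

section \<open>The isomorphism\<close>

lemma H_Des_simps [simp]:
  "mult H_Des = (\<lambda>v w. linear_extension (\<lambda>c. linear_extension (des_class_mult c) w) v)"
  "unit H_Des = [empty_perm]\<^sub>D\<^sub>e\<^sub>s"
  "comult H_Des = linear_extension des_class_comult"
  "counit H_Des = linear_extension (\<lambda>c. if c = abs_des_class empty_perm then 1 else 0)"
  by (simp_all add: H_Des_def)

lemma Des_linear_eqI:
  assumes "qlinear f" "qlinear g" "\<And>\<pi>. f [\<pi>]\<^sub>D\<^sub>e\<^sub>s = g [\<pi>]\<^sub>D\<^sub>e\<^sub>s"
  shows "f v = g v"
proof (rule free_basis.linear_eqI[OF assms(1,2)])
  show "f (Poly_Mapping.single c 1) = g (Poly_Mapping.single c 1)" for c
    by (cases c) (use assms(3) in \<open>simp add: Des_basis_def\<close>)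
qed

lemma qlinear_Des_to_QSym: "qlinear Des_to_QSym"
  unfolding Des_to_QSym_def by (rule qlinear_linear_extension)

lemmas [linear_intros] = qlinear_compose[OF qlinear_Des_to_QSym]

lemma Des_to_QSym_basis: "Des_to_QSym [\<pi>]\<^sub>D\<^sub>e\<^sub>s = F_qsym (Comp \<pi>)"
  by (simp add: Des_to_QSym_def Des_basis_def des_class_Comp.abs_eq)

lemma bij_Des_to_QSym: "bij Des_to_QSym"
  unfolding Des_to_QSym_def
  by (rule qbasis.bij_linear_extension[OF F.qbasis_comp_bij[OF bij_des_class_Comp]])

lemma ex_disjoint_representative: "\<exists>\<sigma>'. abs_des_class \<sigma>' = abs_des_class \<sigma> \<and> disjoint_perms \<pi> \<sigma>'"
proof -
  obtain N where N: "\<And>x. x \<in> set (letters \<pi>) \<Longrightarrow> x < N"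
    using finite_nat_set_iff_bounded[of "set (letters \<pi>)"] by auto
  let ?xs = "List.map (\<lambda>x. x + N) (letters \<sigma>)"
  have "distinct ?xs" "0 \<notin> set ?xs"
    using distinct_letters[of \<sigma>] zero_notin_letters[of \<sigma>] by (auto simp: distinct_map)
  then have letters: "letters (Perm ?xs) = ?xs" by (intro Perm_inverse) simp
  have "Des_equiv (Perm ?xs) \<sigma>"
    by (simp add: Des_equiv_def Des_eq_descents len_eq letters step_set_map)
  moreover have "disjoint_perms \<pi> (Perm ?xs)"
    using N by (force simp: disjoint_perms_def letters)
  ultimately show ?thesis by (auto simp: des_class.abs_eq_iff)
qed

text \<open>Shuffle-compatibility of \<open>Des\<close>, read off from the injective image in \<open>QSym\<close>.\<close>

lemma des_class_mult_eq:
  assumes disjoint: "disjoint_perms \<pi> \<sigma>"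
  shows "des_class_mult (abs_des_class \<pi>) (abs_des_class \<sigma>) = (\<Sum>\<tau>\<in>shuffle_set \<pi> \<sigma>. [\<tau>]\<^sub>D\<^sub>e\<^sub>s)"
  unfolding des_class_mult_def
proof (rule the_equality)
  have image: "Des_to_QSym (\<Sum>\<tau>\<in>shuffle_set \<pi> \<sigma>. [\<tau>]\<^sub>D\<^sub>e\<^sub>s)
      = qsym_mult (F_qsym (des_class_Comp (abs_des_class \<pi>)))
          (F_qsym (des_class_Comp (abs_des_class \<sigma>)))"
    if "disjoint_perms \<pi> \<sigma>" for \<pi> \<sigma>
    by (simp add: qlinear_sum[OF qlinear_Des_to_QSym] Des_to_QSym_basis F_Comp_mult[OF that]
        des_class_Comp.abs_eq)
  have "(\<Sum>\<tau>\<in>shuffle_set \<pi> \<sigma>. [\<tau>]\<^sub>D\<^sub>e\<^sub>s) = (\<Sum>\<tau>\<in>shuffle_set \<pi>' \<sigma>'. [\<tau>]\<^sub>D\<^sub>e\<^sub>s)"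
    if "abs_des_class \<pi>' = abs_des_class \<pi>" "abs_des_class \<sigma>' = abs_des_class \<sigma>"
      and "disjoint_perms \<pi>' \<sigma>'" for \<pi>' \<sigma>'
    by (rule injD[OF bij_is_inj[OF bij_Des_to_QSym]])
      (simp only: image[OF disjoint] image[OF that(3)] that(1,2))
  then show "\<forall>\<pi>' \<sigma>'. abs_des_class \<pi>' = abs_des_class \<pi> \<longrightarrow> abs_des_class \<sigma>' = abs_des_class \<sigma>
      \<longrightarrow> disjoint_perms \<pi>' \<sigma>' \<longrightarrow> (\<Sum>\<tau>\<in>shuffle_set \<pi> \<sigma>. [\<tau>]\<^sub>D\<^sub>e\<^sub>s) = (\<Sum>\<tau>\<in>shuffle_set \<pi>' \<sigma>'. [\<tau>]\<^sub>D\<^sub>e\<^sub>s)"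
    by blast
qed (use disjoint in blast)

lemma Des_to_QSym_mult: "Des_to_QSym (mult H_Des v w) = qsym_mult (Des_to_QSym v) (Des_to_QSym w)"
proof (rule Des_linear_eqI[where v = v])
  show "Des_to_QSym (mult H_Des [\<pi>]\<^sub>D\<^sub>e\<^sub>s w)
      = qsym_mult (Des_to_QSym [\<pi>]\<^sub>D\<^sub>e\<^sub>s) (Des_to_QSym w)" for \<pi>
  proof (rule Des_linear_eqI[where v = w])
    fix \<sigma>
    obtain \<sigma>' where \<sigma>': "abs_des_class \<sigma>' = abs_des_class \<sigma>" "disjoint_perms \<pi> \<sigma>'"
      using ex_disjoint_representative by blast
    have "mult H_Des [\<pi>]\<^sub>D\<^sub>e\<^sub>s [\<sigma>]\<^sub>D\<^sub>e\<^sub>s = (\<Sum>\<tau>\<in>shuffle_set \<pi> \<sigma>'. [\<tau>]\<^sub>D\<^sub>e\<^sub>s)"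
      using des_class_mult_eq[OF \<sigma>'(2)] \<sigma>'(1) by (simp add: Des_basis_def)
    moreover have "[\<sigma>]\<^sub>D\<^sub>e\<^sub>s = [\<sigma>']\<^sub>D\<^sub>e\<^sub>s" by (simp add: Des_basis_def \<sigma>'(1))
    ultimately show "Des_to_QSym (mult H_Des [\<pi>]\<^sub>D\<^sub>e\<^sub>s [\<sigma>]\<^sub>D\<^sub>e\<^sub>s)
        = qsym_mult (Des_to_QSym [\<pi>]\<^sub>D\<^sub>e\<^sub>s) (Des_to_QSym [\<sigma>]\<^sub>D\<^sub>e\<^sub>s)"
      by (simp add: qlinear_sum[OF qlinear_Des_to_QSym] Des_to_QSym_basis
          F_Comp_mult[OF \<sigma>'(2)])
  qed (unfold H_Des_simps, (intro linear_intros)+)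
qed (unfold H_Des_simps, (intro linear_intros)+)

lemma len_empty_perm [simp]: "len empty_perm = 0"
  by transfer simp

lemma Des_eq_empty_if_len_eq_0: "len \<pi> = 0 \<Longrightarrow> Des \<pi> = {}"
  by (simp add: Des_def)

lemma Des_to_QSym_unit: "Des_to_QSym [empty_perm]\<^sub>D\<^sub>e\<^sub>s = qsym_one"
  by (rule qsym_eqI)
    (simp add: Des_to_QSym_basis coeff_of_F_Comp qsym_one.rep_eq total_degree_eq_0_iff
      Des_eq_empty_if_len_eq_0)

lemma Des_to_QSym_comult:
  "qsym_comult (Des_to_QSym v) = tensor_map Des_to_QSym Des_to_QSym (comult H_Des v)"
proof (rule Des_linear_eqI[where v = v])
  fix \<pi>
  have "comult H_Des [\<pi>]\<^sub>D\<^sub>e\<^sub>s = (\<Sum>i\<le>len \<pi>. [prefix_perm i \<pi>]\<^sub>D\<^sub>e\<^sub>s \<otimes> [suffix_perm i \<pi>]\<^sub>D\<^sub>e\<^sub>s)"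
    by (simp add: Des_basis_def[of \<pi>] des_class_comult.abs_eq)
  then show "qsym_comult (Des_to_QSym [\<pi>]\<^sub>D\<^sub>e\<^sub>s)
      = tensor_map Des_to_QSym Des_to_QSym (comult H_Des [\<pi>]\<^sub>D\<^sub>e\<^sub>s)"
    by (simp add: Des_to_QSym_basis qsym_comult_F_Comp tensor_map_sum tensor_map_pure
        qlinear_Des_to_QSym)
qed (unfold H_Des_simps, (intro linear_intros)+)

lemma Des_to_QSym_counit: "coeff_of (Des_to_QSym v) 0 = counit H_Des v"
proof (rule Des_linear_eqI[where v = v])
  fix \<pi>
  have "counit H_Des [\<pi>]\<^sub>D\<^sub>e\<^sub>s = (if len \<pi> = 0 then 1 else 0)"
    by (auto simp: Des_basis_def des_class.abs_eq_iff Des_equiv_def Des_eq_empty_if_len_eq_0)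
  then show "coeff_of (Des_to_QSym [\<pi>]\<^sub>D\<^sub>e\<^sub>s) 0 = counit H_Des [\<pi>]\<^sub>D\<^sub>e\<^sub>s"
    by (simp add: Des_to_QSym_basis coeff_of_F_Comp Des_eq_empty_if_len_eq_0)
qed (unfold H_Des_simps, (intro linear_intros)+)

lemma bialgebra_pullback_Des_to_QSym: "bialgebra_pullback H_Des QSym Des_to_QSym"
proof (intro bialgebra_pullback.intro bialgebra_ops_hom.intro bialgebra_pullback_axioms.intro)
  show "Des_to_QSym (mult H_Des v w) = mult QSym (Des_to_QSym v) (Des_to_QSym w)" for v w
    unfolding QSym_simps by (rule Des_to_QSym_mult)
  show "Des_to_QSym (unit H_Des) = unit QSym"
    unfolding QSym_simps H_Des_simps by (rule Des_to_QSym_unit)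
  show "comult QSym (Des_to_QSym v) = tensor_map Des_to_QSym Des_to_QSym (comult H_Des v)" for v
    unfolding QSym_simps by (rule Des_to_QSym_comult)
  show "counit QSym (Des_to_QSym v) = counit H_Des v" for v
    unfolding QSym_simps by (rule Des_to_QSym_counit)
qed (fact qlinear_Des_to_QSym QSym.bialgebra_axioms bij_Des_to_QSym)+

theorem proposition3p18:
  shows "(\<forall>\<pi>. Des_to_QSym [\<pi>]\<^sub>D\<^sub>e\<^sub>s = F_qsym (Comp \<pi>)) \<and> hopf_algebra_iso H_Des QSym Des_to_QSym"
  using Des_to_QSym_basis
    bialgebra_pullback.hopf_algebra_iso[OF bialgebra_pullback_Des_to_QSym hopf_algebra_QSym]
  by blast

end
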